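(* Let $X$ be a real random variable with $\mathbf E[X]=0$, $\mathbf E[X^2]=1$ and $\mathbf E[|X|^3]<\infty$. For each $m\ge1$ let $S^m$ be the affinely interpolated, normalized random walk on $[0,1]$ built from independent copies $X_0,\dots,X_{m-1}$ of $X$, namely $S^m(t)=\sum_{k=0}^{m-1}X_k\,\sqrt m\int_0^t\mathbf 1_{[k/m,(k+1)/m)}(s)\,ds$, and let $B$ be a standard one-dimensional Brownian motion on $[0,1]$ started at $0$. Put $$L_0^m(t)=\sup_{0\le s\le t}\max\bigl(0,-S^m(s)\bigr),\qquad L_0(t)=\sup_{0\le s\le t}\max\bigl(0,-B(s)\bigr),\qquad t\in[0,1].$$ Then there exists a constant $c>0$ such that for all integers $m\ge2$, $$\sup_{f\in\operatorname{Lip}_1(W_{0,\infty})}\Bigl(\mathbf E[f(L_0^m)]-\mathbf E[f(L_0)]\Bigr)\le c\,\|X\|_{L^3}\,m^{-\frac16}\ln(m).$$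
   Context: $W_{0,\infty}$ is the space of continuous real functions on $[0,1]$ with the uniform norm $\|\cdot\|_\infty$, and $\operatorname{Lip}_1(W_{0,\infty})$ is the set of $f:W_{0,\infty}\to\mathbf R$ with $|f(x)-f(y)|\le\|x-y\|_\infty$ for all $x,y$. $\|X\|_{L^3}=\mathbf E[|X|^3]^{1/3}$. *)

theory Defs
  imports "HOL-Probability.Probability"
begin

text \<open>The space of continuous real functions on the unit interval with the uniform metric. As
  usual for \<^const>\<open>cfunspace\<close>, its points are extensional: they are \<^const>\<open>undefined\<close> off
  the unit interval.\<close>

definition C01 :: "(real \<Rightarrow> real) metric" where
  "C01 = cfunspace (top_of_set {0..1}) euclidean_metric"

lemma mspace_C01: "mspace C01 = {w \<in> extensional {0..1}. continuous_on {0..1} w}"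
  by (auto simp: C01_def Met_TC.mbounded_def continuous_map_iff_continuous
      intro!: compact_imp_bounded compact_continuous_image)

lemma mdist_C01:
  assumes "x \<in> mspace C01" "y \<in> mspace C01"
  shows "mdist C01 x y = (SUP t\<in>{0..1}. \<bar>x t - y t\<bar>)"
  using assms by (auto simp: C01_def cfunspace_def Met_TC.fdist_def dist_real_def)

definition Lip1 :: "'a metric \<Rightarrow> ('a \<Rightarrow> real) set" where
  "Lip1 W = {f. \<forall>x\<in>mspace W. \<forall>y\<in>mspace W. \<bar>f x - f y\<bar> \<le> mdist W x y}"

definition scaled_walk :: "nat \<Rightarrow> (nat \<Rightarrow> real) \<Rightarrow> real \<Rightarrow> real" where
  "scaled_walk m x t =
     (\<Sum>k<m. x k * sqrt (real m) *
        (LINT s:{0..t}|lborel. indicator {real k / real m..<(real k + 1) / real m} s))"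

definition regulator :: "(real \<Rightarrow> real) \<Rightarrow> real \<Rightarrow> real" where
  "regulator w = (\<lambda>t\<in>{0..1}. SUP s\<in>{0..t}. max 0 (- w s))"

definition Lp_norm :: "'a measure \<Rightarrow> real \<Rightarrow> ('a \<Rightarrow> real) \<Rightarrow> real" where
  "Lp_norm M p X = (LINT \<omega>|M. \<bar>X \<omega>\<bar> powr p) powr (1 / p)"

text \<open>Standard Brownian motion indexed by the unit interval. Every path (rather than almost every
  one) starts at 0 and is continuous, so that the process is a map into \<^const>\<open>C01\<close>; values at
  times outside the unit interval are irrelevant.\<close>

locale brownian_motion = prob_space M for M :: "'a measure" +
  fixes B :: "real \<Rightarrow> 'a \<Rightarrow> real"
  assumes measurable_at: "\<And>t. t \<in> {0..1} \<Longrightarrow> random_variable borel (B t)"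
    and start: "\<And>\<omega>. \<omega> \<in> space M \<Longrightarrow> B 0 \<omega> = 0"
    and continuous_paths: "\<And>\<omega>. \<omega> \<in> space M \<Longrightarrow> continuous_on {0..1} (\<lambda>t. B t \<omega>)"
    and gaussian_increments: "\<And>s t. 0 \<le> s \<Longrightarrow> s < t \<Longrightarrow> t \<le> 1 \<Longrightarrow>
      distributed M lborel (\<lambda>\<omega>. B t \<omega> - B s \<omega>) (\<lambda>x. ennreal (normal_density 0 (sqrt (t - s)) x))"
    and independent_increments: "\<And>n (\<tau> :: nat \<Rightarrow> real). mono_on {..n} \<tau> \<Longrightarrow> \<tau> ` {..n} \<subseteq> {0..1} \<Longrightarrow>
      indep_vars (\<lambda>_. borel) (\<lambda>i \<omega>. B (\<tau> (Suc i)) \<omega> - B (\<tau> i) \<omega>) {..<n}"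

end

theory Submission
  imports Defs
begin

text \<open>
  The constant may depend on the law of $X$, and both processes enter only through a functional that is
  Lipschitz for the uniform norm of the paths (lemma \<open>Lip1_regulator\<close>). So it suffices to compare the walk and
  Brownian motion themselves at the rate $m^{-1/6} \log m$.

  Time is cut into about $m^{1/3}$ blocks of $K \approx m^{2/3}$ steps of the walk, and either path is replaced by
  the polygon through its values at the block ends. This costs the oscillation over a block, which is of
  order $\sqrt{K/m} \log m \approx m^{-1/6} \log m$ in expectation for both processes. For the walk
  (lemma \<open>walk_oscillation_expectation\<close>) the steps are truncated at $\sqrt K \approx m^{1/3}$. As the third moment is
  finite, all the truncation errors together are of order $m^{1/3}$ in expectation, which is $m^{-1/6}$ after
  normalization. The truncated partial sums have exponential moments at the scale $\sqrt K$, so the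
  maximum of all $m$ of them is of order $\sqrt K \log m$. For Brownian motion (lemma
  \<open>brownian_oscillation\<close>) the same bound for maxima is applied on each level of a dyadic chaining.

  What remains are functions of the independent block increments that are Lipschitz in each
  coordinate. Exchanging the coordinates one by one (lemma \<open>product_replacement\<close>) costs the number of blocks
  times the Lipschitz distance between one block increment of the walk and a Gaussian. For a
  sum of $K$ standardized variables with third moments that distance is $O(\log K)$ before normalization
  (lemma \<open>normal_approximation_lipschitz\<close>): in a Lindeberg telescoping sum the $k$-th term sees a
  test function already smoothed by a Gaussian of variance $k$, hence is of order $1/k$. The total
  is $m^{1/3} \cdot \log K / \sqrt m \approx m^{-1/6} \log m$ again.
\<close>

section \<open>Averaging operators on Lipschitz functions\<close>

text \<open>The probability laws on the line with a finite first moment; these are the laws against which every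
  Lipschitz function can be integrated.\<close>

definition has_mean :: "real measure \<Rightarrow> bool" where
  "has_mean \<mu> \<longleftrightarrow> prob_space \<mu> \<and> sets \<mu> = sets borel \<and> integrable \<mu> (\<lambda>x. x)"

text \<open>The transition operator of a random walk with step law \<^term>\<open>\<mu>\<close>. The partial sums of an
  i.i.d. sequence are governed by its powers, so the comparison of two sums becomes a comparison of
  powers of two operators that contract the uniform norm and preserve Lipschitz constants.\<close>

definition avg :: "real measure \<Rightarrow> (real \<Rightarrow> real) \<Rightarrow> real \<Rightarrow> real" where
  "avg \<mu> g x = (\<integral>y. g (x + y) \<partial>\<mu>)"

lemma lipschitz_real_iff:
  "L-lipschitz_on UNIV (g :: real \<Rightarrow> real) \<longleftrightarrow> 0 \<le> L \<and> (\<forall>x y. \<bar>g x - g y\<bar> \<le> L * \<bar>x - y\<bar>)"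
  by (auto simp: lipschitz_on_def dist_real_def)

lemma lipschitz_realD:
  assumes "L-lipschitz_on UNIV (g :: real \<Rightarrow> real)"
  shows "\<bar>g (x + t) - g x\<bar> \<le> L * \<bar>t\<bar>" "\<bar>g x - g y\<bar> \<le> L * \<bar>x - y\<bar>" "0 \<le> L"
proof -
  show "\<bar>g x - g y\<bar> \<le> L * \<bar>x - y\<bar>" for x y
    using assms by (simp add: lipschitz_real_iff)
  from this[of "x + t" x] show "\<bar>g (x + t) - g x\<bar> \<le> L * \<bar>t\<bar>" by simp
  show "0 \<le> L" using assms by (simp add: lipschitz_real_iff)
qed

lemma lipschitz_real_borel:
  "L-lipschitz_on UNIV (g :: real \<Rightarrow> real) \<Longrightarrow> g \<in> borel_measurable borel"
  by (intro borel_measurable_continuous_onI lipschitz_on_continuous_on)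

lemma avg_integrable:
  fixes g :: "real \<Rightarrow> real"
  assumes "has_mean \<mu>" "L-lipschitz_on UNIV g"
  shows "integrable \<mu> (\<lambda>y. g (x + y))"
proof -
  interpret prob_space \<mu> using assms(1) by (simp add: has_mean_def)
  note [measurable_cong] = assms(1)[unfolded has_mean_def, THEN conjunct2, THEN conjunct1]
  note [measurable] = lipschitz_real_borel[OF assms(2)]
  show ?thesis
  proof (rule Bochner_Integration.integrable_bound)
    show "integrable \<mu> (\<lambda>y. \<bar>g x\<bar> + L * \<bar>y\<bar>)"
      using assms(1) by (auto simp: has_mean_def)
    show "AE y in \<mu>. norm (g (x + y)) \<le> norm (\<bar>g x\<bar> + L * \<bar>y\<bar>)"
    proof (rule AE_I2)
      fix y
      show "norm (g (x + y)) \<le> norm (\<bar>g x\<bar> + L * \<bar>y\<bar>)"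
        using lipschitz_realD(1)[OF assms(2), of x y] lipschitz_realD(3)[OF assms(2)] by simp
    qed
  qed measurable
qed

text \<open>Averaging contracts the uniform distance.\<close>

lemma avg_diff_le:
  assumes "has_mean \<mu>" "L-lipschitz_on UNIV g" "L'-lipschitz_on UNIV h" "\<And>x. \<bar>g x - h x\<bar> \<le> e"
  shows "\<bar>avg \<mu> g x - avg \<mu> h x\<bar> \<le> e"
proof -
  interpret prob_space \<mu> using assms(1) by (simp add: has_mean_def)
  note i = avg_integrable[OF assms(1,2), of x] avg_integrable[OF assms(1,3), of x]
  have "avg \<mu> g x - avg \<mu> h x = (\<integral>y. g (x + y) - h (x + y) \<partial>\<mu>)"
    using i by (simp add: avg_def)
  also have "\<bar>\<dots>\<bar> \<le> (\<integral>y. \<bar>g (x + y) - h (x + y)\<bar> \<partial>\<mu>)"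
    by (rule integral_abs_bound)
  also have "\<dots> \<le> (\<integral>y. e \<partial>\<mu>)"
    using i assms(4) by (intro integral_mono) auto
  finally show ?thesis by (simp add: prob_space)
qed

lemma avg_lipschitz:
  assumes "has_mean \<mu>" "L-lipschitz_on UNIV g"
  shows "L-lipschitz_on UNIV (avg \<mu> g)"
  unfolding lipschitz_real_iff
proof (intro conjI allI)
  show "0 \<le> L" using assms(2) by (simp add: lipschitz_real_iff)
  fix x x'
  have l: "L-lipschitz_on UNIV (\<lambda>z. g (z + (x' - x)))"
    unfolding lipschitz_real_iff
    using lipschitz_realD(2)[OF assms(2), of "_ + (x' - x)" "_ + (x' - x)"] lipschitz_realD(3)[OF assms(2)]
    by simp
  have "\<bar>avg \<mu> g x - avg \<mu> (\<lambda>z. g (z + (x' - x))) x\<bar> \<le> L * \<bar>x - x'\<bar>"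
  proof (rule avg_diff_le[OF assms(1,2) l])
    fix z show "\<bar>g z - g (z + (x' - x))\<bar> \<le> L * \<bar>x - x'\<bar>"
      using lipschitz_realD(2)[OF assms(2), of z "z + (x' - x)"] by simp
  qed
  then show "\<bar>avg \<mu> g x - avg \<mu> g x'\<bar> \<le> L * \<bar>x - x'\<bar>"
    by (simp add: avg_def add_ac)
qed

text \<open>Fubini's theorem applies because the inner integral of the modulus is again a Lipschitz function.\<close>

lemma lipschitz_sum_integrable:
  assumes "has_mean \<mu>" "has_mean \<nu>" "L-lipschitz_on UNIV g"
  shows "integrable (\<mu> \<Otimes>\<^sub>M \<nu>) (\<lambda>(y, z). g (x + y + z) :: real)"
proof -
  interpret \<mu>: prob_space \<mu> using assms(1) by (simp add: has_mean_def)
  interpret \<nu>: prob_space \<nu> using assms(2) by (simp add: has_mean_def)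
  interpret pair_sigma_finite \<mu> \<nu> ..
  note [measurable_cong] = assms(1)[unfolded has_mean_def, THEN conjunct2, THEN conjunct1]
    assms(2)[unfolded has_mean_def, THEN conjunct2, THEN conjunct1]
  note [measurable] = lipschitz_real_borel[OF assms(3)]
  have labs: "L-lipschitz_on UNIV (\<lambda>z. \<bar>g z\<bar>)"
    unfolding lipschitz_real_iff
    using lipschitz_realD(2,3)[OF assms(3)] order_trans[OF abs_triangle_ineq3] by blast
  show ?thesis
  proof (rule Fubini_integrable)
    show "integrable \<mu> (\<lambda>y. \<integral>z. norm ((\<lambda>(y, z). g (x + y + z)) (y, z)) \<partial>\<nu>)"
      using avg_integrable[OF assms(1) avg_lipschitz[OF assms(2) labs], of x]
      by (simp add: avg_def)
    show "AE y in \<mu>. integrable \<nu> (\<lambda>z. (\<lambda>(y, z). g (x + y + z)) (y, z))"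
      using avg_integrable[OF assms(2,3)] by simp
  qed measurable
qed

lemma avg_convolution:
  assumes "has_mean \<mu>" "has_mean \<nu>" "L-lipschitz_on UNIV g"
  shows "avg (\<mu> \<star> \<nu>) g = avg \<mu> (avg \<nu> g)"
proof
  fix x
  interpret \<mu>: prob_space \<mu> using assms(1) by (simp add: has_mean_def)
  interpret \<nu>: prob_space \<nu> using assms(2) by (simp add: has_mean_def)
  interpret pair_sigma_finite \<mu> \<nu> ..
  note [measurable_cong] = assms(1)[unfolded has_mean_def, THEN conjunct2, THEN conjunct1]
    assms(2)[unfolded has_mean_def, THEN conjunct2, THEN conjunct1]
  note [measurable] = lipschitz_real_borel[OF assms(3)]
  from integral_fst'[OF lipschitz_sum_integrable[OF assms]]
  show "avg (\<mu> \<star> \<nu>) g x = avg \<mu> (avg \<nu> g) x"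
    unfolding avg_def convolution_def
    by (subst integral_distr) (simp_all add: case_prod_unfold add.assoc)
qed

lemma has_mean_convolution:
  assumes "has_mean \<mu>" "has_mean \<nu>"
  shows "has_mean (\<mu> \<star> \<nu>)"
proof -
  interpret \<mu>: prob_space \<mu> using assms(1) by (simp add: has_mean_def)
  interpret \<nu>: prob_space \<nu> using assms(2) by (simp add: has_mean_def)
  interpret pair_prob_space \<mu> \<nu> ..
  note [measurable_cong] = assms(1)[unfolded has_mean_def, THEN conjunct2, THEN conjunct1]
    assms(2)[unfolded has_mean_def, THEN conjunct2, THEN conjunct1]
  have "1-lipschitz_on UNIV (\<lambda>x::real. x)" by (simp add: lipschitz_real_iff)
  from lipschitz_sum_integrable[OF assms this, of 0]
  have "integrable (\<mu> \<star> \<nu>) (\<lambda>x. x)"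
    unfolding convolution_def by (subst integrable_distr_eq) (simp_all add: case_prod_unfold)
  moreover have "prob_space (\<mu> \<star> \<nu>)"
    unfolding convolution_def by (rule P.prob_space_distr) measurable
  ultimately show ?thesis by (simp add: has_mean_def)
qed

text \<open>The form in which derivatives of averages are computed: an explicit quadratic error passes through
  an integral.\<close>

lemma derivative_from_quadratic_error:
  fixes f :: "real \<Rightarrow> real"
  assumes "\<And>u. \<bar>u\<bar> \<le> 1 \<Longrightarrow> \<bar>f (x + u) - f x - u * d\<bar> \<le> C * u\<^sup>2"
  shows "(f has_real_derivative d) (at x)"
  unfolding has_field_derivative_def has_derivative_at
proof (intro conjI)
  show "bounded_linear ((*) d)" by (rule bounded_linear_mult_right)
  show "(\<lambda>u. norm (f (x + u) - f x - d * u) / norm u) \<midarrow>0\<rightarrow> 0"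
  proof (rule tendsto_sandwich)
    show "\<forall>\<^sub>F u in at 0. 0 \<le> norm (f (x + u) - f x - d * u) / norm u" by simp
    show "\<forall>\<^sub>F u in at (0::real). norm (f (x + u) - f x - d * u) / norm u \<le> C * \<bar>u\<bar>"
      unfolding eventually_at
    proof (intro exI[of _ 1] conjI ballI impI)
      fix u :: real assume "u \<noteq> 0 \<and> dist u 0 < 1"
      then have "\<bar>f (x + u) - f x - u * d\<bar> \<le> C * (\<bar>u\<bar> * \<bar>u\<bar>)" "u \<noteq> 0"
        using assms[of u] by (auto simp: power2_eq_square)
      then show "norm (f (x + u) - f x - d * u) / norm u \<le> C * \<bar>u\<bar>"
        by (simp add: field_simps)
    qed simp
    show "(\<lambda>u. C * \<bar>u\<bar>) \<midarrow>0\<rightarrow> 0"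
      by (auto intro!: tendsto_eq_intros)
  qed simp
qed

lemma lipschitz_derivative_taylor1:
  fixes f D :: "real \<Rightarrow> real"
  assumes "\<And>x. (f has_real_derivative D x) (at x)" "K-lipschitz_on UNIV D"
  shows "\<bar>f (x + u) - f x - u * D x\<bar> \<le> K * u\<^sup>2"
proof -
  define diff where "diff = (\<lambda>m::nat. if m = 0 then (\<lambda>u. f (x + u)) else (\<lambda>u. D (x + u)))"
  have "\<exists>t. \<bar>t\<bar> \<le> \<bar>u\<bar> \<and> f (x + u) = (\<Sum>m<1. diff m 0 / fact m * u ^ m) + diff 1 t / fact 1 * u ^ 1"
  proof (rule Maclaurin_bi_le)
    show "\<forall>m t. m < 1 \<and> \<bar>t\<bar> \<le> \<bar>u\<bar> \<longrightarrow> (diff m has_real_derivative diff (Suc m) t) (at t)"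
      using assms(1) by (auto simp: diff_def DERIV_shift[symmetric] add.commute)
  qed (simp add: diff_def)
  then obtain t where t: "\<bar>t\<bar> \<le> \<bar>u\<bar>" "f (x + u) = f x + D (x + t) * u"
    by (auto simp: diff_def)
  have "\<bar>D (x + t) - D x\<bar> \<le> K * \<bar>t\<bar>" "0 \<le> K"
    using lipschitz_realD[OF assms(2)] by auto
  then have "\<bar>D (x + t) - D x\<bar> \<le> K * \<bar>u\<bar>"
    using t(1) by (meson mult_left_mono order_trans)
  then have "\<bar>D (x + t) - D x\<bar> * \<bar>u\<bar> \<le> K * \<bar>u\<bar> * \<bar>u\<bar>"
    by (rule mult_right_mono) simp
  then show ?thesis
    using t(2) by (simp add: power2_eq_square abs_mult[symmetric] algebra_simps)
qed

lemma lipschitz_derivative_taylor2: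
  fixes f D D2 :: "real \<Rightarrow> real"
  assumes "\<And>x. (f has_real_derivative D x) (at x)" "\<And>x. (D has_real_derivative D2 x) (at x)"
    "K-lipschitz_on UNIV D2"
  shows "\<bar>f (x + u) - f x - u * D x - u\<^sup>2 / 2 * D2 x\<bar> \<le> K * \<bar>u\<bar> ^ 3"
proof -
  define diff where "diff = (\<lambda>m::nat. if m = 0 then (\<lambda>u. f (x + u)) else
    if m = 1 then (\<lambda>u. D (x + u)) else (\<lambda>u. D2 (x + u)))"
  have "\<exists>t. \<bar>t\<bar> \<le> \<bar>u\<bar> \<and> f (x + u) = (\<Sum>m<2. diff m 0 / fact m * u ^ m) + diff 2 t / fact 2 * u ^ 2"
  proof (rule Maclaurin_bi_le)
    show "\<forall>m t. m < 2 \<and> \<bar>t\<bar> \<le> \<bar>u\<bar> \<longrightarrow> (diff m has_real_derivative diff (Suc m) t) (at t)"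
      using assms(1,2) by (auto simp: diff_def DERIV_shift[symmetric] add.commute)
  qed (simp add: diff_def)
  then obtain t where t: "\<bar>t\<bar> \<le> \<bar>u\<bar>" "f (x + u) = f x + D x * u + D2 (x + t) / 2 * u\<^sup>2"
    by (auto simp: diff_def numeral_2_eq_2)
  have "\<bar>D2 (x + t) - D2 x\<bar> \<le> K * \<bar>t\<bar>" "0 \<le> K"
    using lipschitz_realD[OF assms(3)] by auto
  then have *: "\<bar>D2 (x + t) - D2 x\<bar> \<le> K * \<bar>u\<bar>" "0 \<le> K"
    using t(1) by (meson mult_left_mono order_trans)+
  have "f (x + u) - f x - u * D x - u\<^sup>2 / 2 * D2 x = (D2 (x + t) - D2 x) * (u\<^sup>2 / 2)"
    using t(2) by (simp add: field_simps)
  also have "\<bar>\<dots>\<bar> = \<bar>D2 (x + t) - D2 x\<bar> * (u\<^sup>2 / 2)"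
    by (simp add: abs_mult)
  also have "\<dots> \<le> (K * \<bar>u\<bar>) * (u\<^sup>2 / 2)"
    using * by (intro mult_right_mono) auto
  also have "\<dots> = K * \<bar>u\<bar> ^ 3 / 2"
    by (simp add: power2_eq_square power3_eq_cube abs_mult_self)
  also have "\<dots> \<le> K * \<bar>u\<bar> ^ 3" using * by simp
  finally show ?thesis .
qed

text \<open>Differentiation commutes with averaging because the first order Taylor error is quadratic uniformly
  in the base point.\<close>

lemma avg_derivative:
  assumes "has_mean \<mu>" "L-lipschitz_on UNIV f" "K-lipschitz_on UNIV D"
    "\<And>x. (f has_real_derivative D x) (at x)"
  shows "(avg \<mu> f has_real_derivative avg \<mu> D x) (at x)"
proof (rule derivative_from_quadratic_error)
  fix u :: real
  interpret prob_space \<mu> using assms(1) by (simp add: has_mean_def)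
  have xyu: "x + u + y = x + y + u" for y by simp
  have i: "integrable \<mu> (\<lambda>y. f (x + y + u))" "integrable \<mu> (\<lambda>y. f (x + y))"
    "integrable \<mu> (\<lambda>y. D (x + y))"
    using avg_integrable[OF assms(1,2), of "x + u"] avg_integrable[OF assms(1,2), of x]
      avg_integrable[OF assms(1,3), of x] by (simp_all only: xyu)
  have "avg \<mu> f (x + u) - avg \<mu> f x - u * avg \<mu> D x
      = (\<integral>y. f (x + y + u) - f (x + y) - u * D (x + y) \<partial>\<mu>)"
    unfolding avg_def xyu using i by simp
  then have "\<bar>avg \<mu> f (x + u) - avg \<mu> f x - u * avg \<mu> D x\<bar>
      \<le> (\<integral>y. \<bar>f (x + y + u) - f (x + y) - u * D (x + y)\<bar> \<partial>\<mu>)"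
    by (simp only: integral_abs_bound)
  also have "\<dots> \<le> (\<integral>y. K * u\<^sup>2 \<partial>\<mu>)"
  proof (rule integral_mono)
    show "integrable \<mu> (\<lambda>y. \<bar>f (x + y + u) - f (x + y) - u * D (x + y)\<bar>)"
      using i by simp
  qed (use lipschitz_derivative_taylor1[OF assms(4,3)] in simp_all)
  finally show "\<bar>avg \<mu> f (x + u) - avg \<mu> f x - u * avg \<mu> D x\<bar> \<le> K * u\<^sup>2"
    by (simp add: prob_space)
qed

text \<open>To second order an average only sees the first two moments of the step law. Two standardized laws
  therefore have averages of a smooth function that differ by third order terms only.\<close>

lemma avg_second_order_expansion:
  assumes "has_mean \<mu>" "(\<integral>y. y \<partial>\<mu>) = 0" "integrable \<mu> (\<lambda>y. y\<^sup>2)" "(\<integral>y. y\<^sup>2 \<partial>\<mu>) = 1"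
    and "integrable \<mu> (\<lambda>y. \<bar>y\<bar> ^ 3)"
    and "L-lipschitz_on UNIV f" "K-lipschitz_on UNIV D2"
    and "\<And>x. (f has_real_derivative D x) (at x)" "\<And>x. (D has_real_derivative D2 x) (at x)"
  shows "\<bar>avg \<mu> f x - f x - D2 x / 2\<bar> \<le> K * (\<integral>y. \<bar>y\<bar> ^ 3 \<partial>\<mu>)"
proof -
  interpret prob_space \<mu> using assms(1) by (simp add: has_mean_def)
  note i = avg_integrable[OF assms(1,6), of x]
  have i1: "integrable \<mu> (\<lambda>y. y)" using assms(1) by (simp add: has_mean_def)
  have "avg \<mu> f x - f x - D2 x / 2 = (\<integral>y. f (x + y) - f x - y * D x - y\<^sup>2 / 2 * D2 x \<partial>\<mu>)"
    using i i1 assms(2-4) by (simp add: avg_def prob_space)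
  then have "\<bar>avg \<mu> f x - f x - D2 x / 2\<bar>
      \<le> (\<integral>y. \<bar>f (x + y) - f x - y * D x - y\<^sup>2 / 2 * D2 x\<bar> \<partial>\<mu>)"
    by (simp only: integral_abs_bound)
  also have "\<dots> \<le> (\<integral>y. K * \<bar>y\<bar> ^ 3 \<partial>\<mu>)"
  proof (rule integral_mono)
    show "integrable \<mu> (\<lambda>y. \<bar>f (x + y) - f x - y * D x - y\<^sup>2 / 2 * D2 x\<bar>)"
      using i i1 assms(3) by simp
    show "integrable \<mu> (\<lambda>y. K * \<bar>y\<bar> ^ 3)"
      using assms(5) by simp
  qed (rule lipschitz_derivative_taylor2[OF assms(8,9,7)])
  finally show ?thesis by simp
qed

section \<open>Gaussian smoothing\<close>

definition gauss :: "real \<Rightarrow> real measure" where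
  "gauss v = density lborel (\<lambda>x. ennreal (normal_density 0 (sqrt v) x))"

lemma sets_gauss [simp, measurable_cong]: "sets (gauss v) = sets borel"
  and space_gauss [simp]: "space (gauss v) = UNIV"
  by (simp_all add: gauss_def)

lemma prob_space_gauss: "0 < v \<Longrightarrow> prob_space (gauss v)"
  unfolding gauss_def by (rule prob_space_normal_density) simp

lemma integrable_gauss:
  fixes g :: "real \<Rightarrow> real"
  assumes "g \<in> borel_measurable borel"
  shows "integrable (gauss v) g \<longleftrightarrow> integrable lborel (\<lambda>x. normal_density 0 (sqrt v) x * g x)"
  using assms unfolding gauss_def by (subst integrable_density) auto

lemma integral_gauss:
  fixes g :: "real \<Rightarrow> real"
  assumes "g \<in> borel_measurable borel"
  shows "(\<integral>x. g x \<partial>gauss v) = (\<integral>x. normal_density 0 (sqrt v) x * g x \<partial>lborel)"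
  using assms unfolding gauss_def by (subst integral_density) auto

lemma gauss_moments:
  assumes "0 < v"
  shows "integrable (gauss v) (\<lambda>x. x)" "(\<integral>x. x \<partial>gauss v) = 0"
    "integrable (gauss v) (\<lambda>x. x\<^sup>2)" "(\<integral>x. x\<^sup>2 \<partial>gauss v) = v"
    "integrable (gauss v) (\<lambda>x. \<bar>x\<bar>)" "(\<integral>x. \<bar>x\<bar> \<partial>gauss v) \<le> sqrt v"
    "integrable (gauss v) (\<lambda>x. \<bar>x\<bar> ^ 3)"
proof -
  have s: "0 < sqrt v" using assms by simp
  show "integrable (gauss v) (\<lambda>x. x)" "(\<integral>x. x \<partial>gauss v) = 0"
    using integrable_normal_moment_nz_1[OF s, of 0] integral_normal_moment_nz_1[OF s, of 0]
    by (simp_all add: integrable_gauss integral_gauss)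
  show "integrable (gauss v) (\<lambda>x. x\<^sup>2)" "(\<integral>x. x\<^sup>2 \<partial>gauss v) = v"
    using integrable_normal_moment[OF s, of 0 2] integral_normal_moment_even[OF s, of 0 1] assms
    by (simp_all add: integrable_gauss integral_gauss fact_2)
  show "integrable (gauss v) (\<lambda>x. \<bar>x\<bar>)" "integrable (gauss v) (\<lambda>x. \<bar>x\<bar> ^ 3)"
    using integrable_normal_moment_abs[OF s, of 0 1] integrable_normal_moment_abs[OF s, of 0 3]
    by (simp_all add: integrable_gauss)
  have "(\<integral>x. \<bar>x\<bar> \<partial>gauss v) = sqrt v * sqrt (2 / pi)"
    using integral_normal_moment_abs_odd[OF s, of 0 0] by (simp add: integral_gauss)
  also have "\<dots> \<le> sqrt v * 1"
    using assms pi_ge_two by (intro mult_left_mono) auto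
  finally show "(\<integral>x. \<bar>x\<bar> \<partial>gauss v) \<le> sqrt v" by simp
qed

lemma has_mean_gauss: "0 < v \<Longrightarrow> has_mean (gauss v)"
  by (simp add: has_mean_def prob_space_gauss gauss_moments)

text \<open>The Cameron-Martin formula on the line: a translation of a Gaussian is an exponential change of
  density. It moves a translation of the argument of a non-smooth function onto a smooth weight.\<close>

lemma normal_density_shift:
  assumes "0 < v"
  shows "normal_density 0 (sqrt v) (y - u)
    = normal_density 0 (sqrt v) y * exp (u * y / v - u\<^sup>2 / (2 * v))"
proof -
  have "- (y - u)\<^sup>2 / (2 * v) = - y\<^sup>2 / (2 * v) + (u * y / v - u\<^sup>2 / (2 * v))"
    using assms by (simp add: field_simps power2_eq_square)
  then show ?thesis
    using assms unfolding normal_density_def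
    by (simp add: exp_add[symmetric])
qed

lemma gauss_shift:
  fixes g :: "real \<Rightarrow> real"
  assumes "0 < v" "g \<in> borel_measurable borel"
  shows "(\<integral>y. g (u + y) \<partial>gauss v) = (\<integral>y. g y * exp (u * y / v - u\<^sup>2 / (2 * v)) \<partial>gauss v)"
    "integrable (gauss v) (\<lambda>y. g (u + y)) \<longleftrightarrow>
     integrable (gauss v) (\<lambda>y. g y * exp (u * y / v - u\<^sup>2 / (2 * v)))"
proof -
  note [measurable] = assms(2)
  let ?d = "normal_density 0 (sqrt v)"
  have e: "(\<lambda>x. ?d (- u + x) * g x) = (\<lambda>y. ?d y * (g y * exp (u * y / v - u\<^sup>2 / (2 * v))))"
    using normal_density_shift[OF assms(1), of _ u] by (simp add: fun_eq_iff)
  have "(\<integral>y. g (u + y) \<partial>gauss v) = (\<integral>y. ?d y * g (u + y) \<partial>lborel)"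
    by (rule integral_gauss) measurable
  also have "\<dots> = (\<integral>x. ?d (- u + x) * g x \<partial>lborel)"
    by (subst lborel_integral_real_affine[where c=1 and t="- u"]) auto
  finally show "(\<integral>y. g (u + y) \<partial>gauss v) = (\<integral>y. g y * exp (u * y / v - u\<^sup>2 / (2 * v)) \<partial>gauss v)"
    unfolding e by (subst integral_gauss) auto
  have "integrable (gauss v) (\<lambda>y. g (u + y)) \<longleftrightarrow> integrable lborel (\<lambda>y. ?d y * g (u + y))"
    by (rule integrable_gauss) measurable
  also have "\<dots> \<longleftrightarrow> integrable lborel (\<lambda>x. ?d (- u + x) * g x)"
    using lborel_integrable_real_affine_iff[of 1 "\<lambda>y. ?d y * g (u + y)" "- u"] by simp
  finally show "integrable (gauss v) (\<lambda>y. g (u + y)) \<longleftrightarrow>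
     integrable (gauss v) (\<lambda>y. g y * exp (u * y / v - u\<^sup>2 / (2 * v)))"
    unfolding e by (subst integrable_gauss) auto
qed

text \<open>The Laplace transform is the shift formula applied to a constant function.\<close>

lemma gauss_exp:
  assumes "0 < v"
  shows "integrable (gauss v) (\<lambda>y. exp (c * y))" "(\<integral>y. exp (c * y) \<partial>gauss v) = exp (c\<^sup>2 * v / 2)"
proof -
  interpret prob_space "gauss v" by (rule prob_space_gauss) fact
  have e: "1 * exp (c * v * y / v - (c * v)\<^sup>2 / (2 * v)) = exp (- (c\<^sup>2 * v / 2)) * exp (c * y)" for y
    using assms by (simp add: exp_add[symmetric] power2_eq_square)
  have 1: "integrable (gauss v) (\<lambda>y. exp (- (c\<^sup>2 * v / 2)) * exp (c * y))"
    using gauss_shift(2)[OF assms, of "\<lambda>_. 1" "c * v"] unfolding e by simp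
  then show "integrable (gauss v) (\<lambda>y. exp (c * y))" by simp
  have "exp (- (c\<^sup>2 * v / 2)) * (\<integral>y. exp (c * y) \<partial>gauss v) = 1"
    using gauss_shift(1)[OF assms, of "\<lambda>_. 1" "c * v"] prob_space unfolding e by simp
  then show "(\<integral>y. exp (c * y) \<partial>gauss v) = exp (c\<^sup>2 * v / 2)"
    by (simp add: exp_minus field_simps)
qed

lemma gauss_exp_abs:
  assumes "0 < v"
  shows "integrable (gauss v) (\<lambda>y. exp (c * \<bar>y\<bar>))"
    "0 \<le> c \<Longrightarrow> (\<integral>y. exp (c * \<bar>y\<bar>) \<partial>gauss v) \<le> 2 * exp (c\<^sup>2 * v / 2)"
proof -
  have i: "integrable (gauss v) (\<lambda>y. exp (c * y) + exp (- c * y))"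
    using gauss_exp(1)[OF assms] by (intro Bochner_Integration.integrable_add)
  have le: "exp (c * \<bar>y\<bar>) \<le> exp (c * y) + exp (- c * y)" for y :: real
    by (cases "0 \<le> y") auto
  show i2: "integrable (gauss v) (\<lambda>y. exp (c * \<bar>y\<bar>))"
    by (rule Bochner_Integration.integrable_bound[OF i]) (auto intro!: order_trans[OF le])
  have "(\<integral>y. exp (c * \<bar>y\<bar>) \<partial>gauss v) \<le> (\<integral>y. exp (c * y) + exp (- c * y) \<partial>gauss v)"
    by (rule integral_mono[OF i2 i]) (rule le)
  also have "\<dots> = 2 * exp (c\<^sup>2 * v / 2)"
    using gauss_exp[OF assms, of c] gauss_exp[OF assms, of "- c"] by simp
  finally show "(\<integral>y. exp (c * \<bar>y\<bar>) \<partial>gauss v) \<le> 2 * exp (c\<^sup>2 * v / 2)" .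
qed

lemma gauss_convolution:
  assumes "0 < s" "0 < t"
  shows "gauss s \<star> gauss t = gauss (s + t)"
proof -
  have "gauss s \<star> gauss t = density lborel (\<lambda>x. \<integral>\<^sup>+y. ennreal (normal_density 0 (sqrt s) (x - y))
      * ennreal (normal_density 0 (sqrt t) y) \<partial>lborel)"
    unfolding gauss_def
    using prob_space_gauss[OF assms(1)] prob_space_gauss[OF assms(2)]
    by (intro convolution_density) (auto simp: gauss_def prob_space_def)
  also have "\<dots> = gauss (s + t)"
    using conv_normal_density_zero_mean[of "sqrt s" "sqrt t"] assms
    by (simp add: gauss_def ennreal_mult'[symmetric] fun_eq_iff)
  finally show ?thesis .
qed

lemma integral_gauss_rescale:
  fixes h :: "real \<Rightarrow> real"
  assumes c: "0 < c" and h: "h \<in> borel_measurable borel"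
  shows "(\<integral>x. h (x / c) \<partial>gauss (c\<^sup>2 * v)) = (\<integral>x. h x \<partial>gauss v)"
proof -
  note [measurable] = h
  have s: "sqrt (c\<^sup>2 * v) = c * sqrt v" using c by (simp add: real_sqrt_mult)
  have d: "c * normal_density 0 (c * sqrt v) (c * x) = normal_density 0 (sqrt v) x" for x
  proof -
    have "(c * x)\<^sup>2 / (2 * (c * sqrt v)\<^sup>2) = x\<^sup>2 / (2 * (sqrt v)\<^sup>2)"
      using c by (simp add: power_mult_distrib)
    moreover have "sqrt (2 * pi * (c * sqrt v)\<^sup>2) = c * sqrt (2 * pi * (sqrt v)\<^sup>2)"
      using c by (simp add: real_sqrt_mult power_mult_distrib)
    ultimately show ?thesis using c by (simp add: normal_density_def)
  qed
  have "(\<integral>x. h (x / c) \<partial>gauss (c\<^sup>2 * v)) = (\<integral>x. normal_density 0 (c * sqrt v) x * h (x / c) \<partial>lborel)"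
    unfolding s[symmetric] by (rule integral_gauss) measurable
  also have "\<dots> = \<bar>c\<bar> *\<^sub>R (\<integral>x. normal_density 0 (c * sqrt v) (0 + c * x) * h ((0 + c * x) / c) \<partial>lborel)"
    using c by (intro lborel_integral_real_affine) simp
  also have "\<dots> = (\<integral>x. c * normal_density 0 (c * sqrt v) (c * x) * h x \<partial>lborel)"
    using c by (simp add: mult.assoc)
  also have "\<dots> = (\<integral>x. h x \<partial>gauss v)"
    unfolding d by (rule integral_gauss[OF h, symmetric])
  finally show ?thesis .
qed

text \<open>The density in the shift formula is \<^term>\<open>exp (a - b)\<close> with \<^term>\<open>a\<close> linear and \<^term>\<open>b\<close> quadratic
  in the shift; to first order it is \<^term>\<open>1 + a\<close>.\<close>

lemma exp_perturbed_linear_error: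
  fixes a b :: real
  assumes "0 \<le> b"
  shows "\<bar>exp (a - b) - 1 - a\<bar> \<le> exp \<bar>a\<bar> * (a\<^sup>2 + b)"
proof -
  obtain t where t: "\<bar>t\<bar> \<le> \<bar>a\<bar>" "exp a = (\<Sum>m<2. a ^ m / fact m) + exp t / fact 2 * a ^ 2"
    using Maclaurin_exp_le[of a 2] by auto
  have t2: "exp a - 1 - a = exp t / 2 * a\<^sup>2"
    using t(2) by (simp add: numeral_2_eq_2)
  have "exp t / 2 * a\<^sup>2 \<le> exp \<bar>a\<bar> * a\<^sup>2"
  proof (rule mult_right_mono)
    have "exp t \<le> exp \<bar>a\<bar>" using t(1) by simp
    then show "exp t / 2 \<le> exp \<bar>a\<bar>" using exp_gt_zero[of t] by linarith
  qed simp
  then have 1: "\<bar>exp a - 1 - a\<bar> \<le> exp \<bar>a\<bar> * a\<^sup>2"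
    unfolding t2 by (simp add: abs_mult)
  have "1 - exp (- b) \<le> b" "0 \<le> 1 - exp (- b)"
    using exp_ge_add_one_self[of "- b"] assms by auto
  then have "exp a * (1 - exp (- b)) \<le> exp \<bar>a\<bar> * b" "0 \<le> exp a * (1 - exp (- b))"
    by (auto intro!: mult_mono)
  moreover have "exp a - exp (a - b) = exp a * (1 - exp (- b))"
    by (simp add: exp_diff exp_minus field_simps)
  ultimately have "\<bar>exp (a - b) - exp a\<bar> \<le> exp \<bar>a\<bar> * b" by simp
  moreover have "\<bar>exp (a - b) - 1 - a\<bar> \<le> \<bar>exp (a - b) - exp a\<bar> + \<bar>exp a - 1 - a\<bar>"
    by linarith
  ultimately have "\<bar>exp (a - b) - 1 - a\<bar> \<le> exp \<bar>a\<bar> * b + exp \<bar>a\<bar> * a\<^sup>2"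
    using 1 by linarith
  then show ?thesis by (simp add: algebra_simps)
qed

text \<open>Gaussian integration by parts for a merely Lipschitz \<^term>\<open>g\<close>: after the shift formula the increment
  of the average is an integral of \<^term>\<open>g\<close> against an exponential weight, which is expanded to first
  order with a quadratic error that has a Gaussian-integrable constant.\<close>

lemma gauss_smoothing_derivative:
  assumes v: "0 < v" and g: "L-lipschitz_on UNIV g"
  shows "(avg (gauss v) g has_real_derivative (\<integral>y. g (x + y) * (y / v) \<partial>gauss v)) (at x)"
    "integrable (gauss v) (\<lambda>y. g (x + y) * (y / v))"
proof -
  note [measurable] = lipschitz_real_borel[OF g]
  define K where "K y = exp (\<bar>y\<bar> / v) * (y\<^sup>2 / v\<^sup>2 + 1 / (2 * v))" for y
  define C where "C = (\<bar>g x\<bar> + L) * (2 / v\<^sup>2 + 1 / (2 * v))"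
  have L: "0 \<le> L" using lipschitz_realD(3)[OF g] .
  have e1: "\<bar>y\<bar> \<le> exp \<bar>y\<bar>" "1 \<le> exp \<bar>y\<bar>" "y\<^sup>2 \<le> 2 * exp \<bar>y\<bar>" for y :: real
  proof -
    have "1 + \<bar>y\<bar> \<le> exp \<bar>y\<bar>" "1 + \<bar>y\<bar> + y\<^sup>2 / 2 \<le> exp \<bar>y\<bar>"
      using exp_ge_add_one_self[of "\<bar>y\<bar>"] exp_lower_Taylor_quadratic[of "\<bar>y\<bar>"] by auto
    then show "\<bar>y\<bar> \<le> exp \<bar>y\<bar>" "1 \<le> exp \<bar>y\<bar>" "y\<^sup>2 \<le> 2 * exp \<bar>y\<bar>"
      using abs_ge_zero[of y] by linarith+
  qed
  have gb: "\<bar>g (x + y)\<bar> \<le> (\<bar>g x\<bar> + L) * exp \<bar>y\<bar>" for y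
  proof -
    have "\<bar>g (x + y)\<bar> \<le> \<bar>g x\<bar> * 1 + L * \<bar>y\<bar>"
      using lipschitz_realD(1)[OF g, of x y] by simp
    also have "\<dots> \<le> \<bar>g x\<bar> * exp \<bar>y\<bar> + L * exp \<bar>y\<bar>"
      using L e1 by (intro add_mono mult_left_mono) auto
    finally show ?thesis by (simp add: algebra_simps)
  qed
  have Kb: "0 \<le> K y" "K y \<le> (2 / v\<^sup>2 + 1 / (2 * v)) * exp ((1 / v + 1) * \<bar>y\<bar>)" for y
  proof -
    have "y\<^sup>2 / v\<^sup>2 + 1 / (2 * v) * 1 \<le> 2 * exp \<bar>y\<bar> / v\<^sup>2 + 1 / (2 * v) * exp \<bar>y\<bar>"
      using v e1 by (intro add_mono divide_right_mono mult_left_mono) auto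
    then have "K y \<le> exp (\<bar>y\<bar> / v) * (2 * exp \<bar>y\<bar> / v\<^sup>2 + 1 / (2 * v) * exp \<bar>y\<bar>)"
      unfolding K_def by (intro mult_left_mono) auto
    also have "\<dots> = (2 / v\<^sup>2 + 1 / (2 * v)) * (exp (\<bar>y\<bar> / v) * exp \<bar>y\<bar>)"
      by (simp add: algebra_simps)
    also have "exp (\<bar>y\<bar> / v) * exp \<bar>y\<bar> = exp ((1 / v + 1) * \<bar>y\<bar>)"
      by (simp add: exp_add[symmetric] algebra_simps)
    finally show "K y \<le> (2 / v\<^sup>2 + 1 / (2 * v)) * exp ((1 / v + 1) * \<bar>y\<bar>)" .
    show "0 \<le> K y" using v by (auto simp: K_def)
  qed
  have iK: "integrable (gauss v) (\<lambda>y. \<bar>g (x + y)\<bar> * K y)"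
  proof (rule Bochner_Integration.integrable_bound)
    show "integrable (gauss v) (\<lambda>y. C * exp ((2 + 1 / v) * \<bar>y\<bar>))"
      using gauss_exp_abs(1)[OF v] by simp
    show "(\<lambda>y. \<bar>g (x + y)\<bar> * K y) \<in> borel_measurable (gauss v)"
      unfolding K_def by measurable
    show "AE y in gauss v. norm (\<bar>g (x + y)\<bar> * K y) \<le> norm (C * exp ((2 + 1 / v) * \<bar>y\<bar>))"
    proof (rule AE_I2)
      fix y
      have "\<bar>g (x + y)\<bar> * K y \<le> ((\<bar>g x\<bar> + L) * exp \<bar>y\<bar>)
          * ((2 / v\<^sup>2 + 1 / (2 * v)) * exp ((1 / v + 1) * \<bar>y\<bar>))"
        using gb Kb L by (intro mult_mono) auto
      also have "\<dots> = C * (exp \<bar>y\<bar> * exp ((1 / v + 1) * \<bar>y\<bar>))"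
        by (simp add: C_def)
      also have "exp \<bar>y\<bar> * exp ((1 / v + 1) * \<bar>y\<bar>) = exp ((2 + 1 / v) * \<bar>y\<bar>)"
        by (simp add: exp_add[symmetric] algebra_simps)
      finally have "\<bar>g (x + y)\<bar> * K y \<le> C * exp ((2 + 1 / v) * \<bar>y\<bar>)" .
      moreover have "0 \<le> C" using L v by (simp add: C_def)
      ultimately show "norm (\<bar>g (x + y)\<bar> * K y) \<le> norm (C * exp ((2 + 1 / v) * \<bar>y\<bar>))"
        using Kb(1) by (simp add: abs_mult)
    qed
  qed
  have i0: "integrable (gauss v) (\<lambda>y. g (x + y))"
    by (rule avg_integrable[OF has_mean_gauss[OF v] g])
  show i1: "integrable (gauss v) (\<lambda>y. g (x + y) * (y / v))"
  proof (rule Bochner_Integration.integrable_bound)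
    show "integrable (gauss v) (\<lambda>y. ((\<bar>g x\<bar> + L) / v) * exp (2 * \<bar>y\<bar>))"
      using gauss_exp_abs(1)[OF v] by simp
    show "AE y in gauss v. norm (g (x + y) * (y / v)) \<le> norm (((\<bar>g x\<bar> + L) / v) * exp (2 * \<bar>y\<bar>))"
    proof (rule AE_I2)
      fix y
      have "\<bar>g (x + y)\<bar> * \<bar>y\<bar> \<le> ((\<bar>g x\<bar> + L) * exp \<bar>y\<bar>) * exp \<bar>y\<bar>"
        using gb e1 L by (intro mult_mono) auto
      also have "\<dots> = (\<bar>g x\<bar> + L) * exp (2 * \<bar>y\<bar>)"
        by (simp add: exp_add[symmetric])
      finally show "norm (g (x + y) * (y / v)) \<le> norm (((\<bar>g x\<bar> + L) / v) * exp (2 * \<bar>y\<bar>))"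
        using v L by (simp add: abs_mult divide_right_mono)
    qed
  qed measurable
  show "(avg (gauss v) g has_real_derivative (\<integral>y. g (x + y) * (y / v) \<partial>gauss v)) (at x)"
  proof (rule derivative_from_quadratic_error)
    fix u :: real assume u: "\<bar>u\<bar> \<le> 1"
    have i2: "integrable (gauss v) (\<lambda>y. g (x + y) * exp (u * y / v - u\<^sup>2 / (2 * v)))"
      using gauss_shift(2)[OF v, of "\<lambda>y. g (x + y)" u]
        avg_integrable[OF has_mean_gauss[OF v] g, of "x + u"] by (simp add: add.assoc)
    have "avg (gauss v) g (x + u) = (\<integral>y. g (x + y) * exp (u * y / v - u\<^sup>2 / (2 * v)) \<partial>gauss v)"
      unfolding avg_def using gauss_shift(1)[OF v, of "\<lambda>y. g (x + y)" u] by (simp add: add.assoc)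
    then have "avg (gauss v) g (x + u) - avg (gauss v) g x - u * (\<integral>y. g (x + y) * (y / v) \<partial>gauss v)
      = (\<integral>y. g (x + y) * exp (u * y / v - u\<^sup>2 / (2 * v)) - g (x + y) - u * (g (x + y) * (y / v)) \<partial>gauss v)"
      using i0 i1 i2 by (simp add: avg_def del: times_divide_eq_right)
    also have "\<dots> = (\<integral>y. g (x + y) * (exp (u * y / v - u\<^sup>2 / (2 * v)) - 1 - u * y / v) \<partial>gauss v)"
      by (intro Bochner_Integration.integral_cong) (auto simp: algebra_simps)
    finally have eq: "avg (gauss v) g (x + u) - avg (gauss v) g x - u * (\<integral>y. g (x + y) * (y / v) \<partial>gauss v)
      = (\<integral>y. g (x + y) * (exp (u * y / v - u\<^sup>2 / (2 * v)) - 1 - u * y / v) \<partial>gauss v)" .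
    have "norm (\<integral>y. g (x + y) * (exp (u * y / v - u\<^sup>2 / (2 * v)) - 1 - u * y / v) \<partial>gauss v)
      \<le> (\<integral>y. u\<^sup>2 * (\<bar>g (x + y)\<bar> * K y) \<partial>gauss v)"
    proof (rule Bochner_Integration.integral_norm_bound_integral)
      show "integrable (gauss v) (\<lambda>y. u\<^sup>2 * (\<bar>g (x + y)\<bar> * K y))" using iK by simp
      have "integrable (gauss v) (\<lambda>y. g (x + y) * exp (u * y / v - u\<^sup>2 / (2 * v)) - g (x + y) - u * (g (x + y) * (y / v)))"
        using i0 i1 i2 by (simp del: times_divide_eq_right)
      then show "integrable (gauss v) (\<lambda>y. g (x + y) * (exp (u * y / v - u\<^sup>2 / (2 * v)) - 1 - u * y / v))"
        by (rule back_subst[of "integrable (gauss v)"]) (auto simp: algebra_simps)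
      fix y
      have "\<bar>exp (u * y / v - u\<^sup>2 / (2 * v)) - 1 - u * y / v\<bar>
        \<le> exp \<bar>u * y / v\<bar> * ((u * y / v)\<^sup>2 + u\<^sup>2 / (2 * v))"
        using v by (intro exp_perturbed_linear_error) simp
      also have "\<dots> \<le> exp (\<bar>y\<bar> / v) * ((u * y / v)\<^sup>2 + u\<^sup>2 / (2 * v))"
      proof (rule mult_right_mono)
        have "\<bar>u\<bar> * \<bar>y\<bar> \<le> 1 * \<bar>y\<bar>" using u by (intro mult_right_mono) auto
        then show "exp \<bar>u * y / v\<bar> \<le> exp (\<bar>y\<bar> / v)"
          using v by (simp add: abs_mult divide_right_mono)
      qed (use v in simp)
      also have "\<dots> = u\<^sup>2 * K y"
        by (simp add: K_def power_mult_distrib power_divide algebra_simps)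
      finally have "\<bar>g (x + y)\<bar> * \<bar>exp (u * y / v - u\<^sup>2 / (2 * v)) - 1 - u * y / v\<bar> \<le> \<bar>g (x + y)\<bar> * (u\<^sup>2 * K y)"
        by (rule mult_left_mono) simp
      then show "norm (g (x + y) * (exp (u * y / v - u\<^sup>2 / (2 * v)) - 1 - u * y / v)) \<le> u\<^sup>2 * (\<bar>g (x + y)\<bar> * K y)"
        by (simp add: abs_mult mult_ac)
    qed
    then show "\<bar>avg (gauss v) g (x + u) - avg (gauss v) g x - u * (\<integral>y. g (x + y) * (y / v) \<partial>gauss v)\<bar>
      \<le> (\<integral>y. \<bar>g (x + y)\<bar> * K y \<partial>gauss v) * u\<^sup>2"
      unfolding eq by (simp add: mult.commute)
  qed
qed

text \<open>Smoothing at scale \<^term>\<open>sqrt v\<close> gains one derivative at the price of the factor \<^term>\<open>1 / sqrt v\<close>: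
  the derivative is an average of \<^term>\<open>g\<close> against \<^term>\<open>y / v\<close>, whose first absolute moment is at most
  \<^term>\<open>1 / sqrt v\<close>.\<close>

lemma gauss_smoothing:
  assumes v: "0 < v" and g: "L-lipschitz_on UNIV g"
  obtains D where "\<And>x. (avg (gauss v) g has_real_derivative D x) (at x)"
    "(L / sqrt v)-lipschitz_on UNIV D"
proof
  define D where "D x = (\<integral>y. g (x + y) * (y / v) \<partial>gauss v)" for x
  show "(avg (gauss v) g has_real_derivative D x) (at x)" for x
    unfolding D_def by (rule gauss_smoothing_derivative(1)[OF assms])
  note i = gauss_smoothing_derivative(2)[OF assms]
  have L: "0 \<le> L" using lipschitz_realD(3)[OF g] .
  show "(L / sqrt v)-lipschitz_on UNIV D"
    unfolding lipschitz_real_iff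
  proof (intro conjI allI)
    fix x x'
    have "norm (D x - D x') = norm (\<integral>y. g (x + y) * (y / v) - g (x' + y) * (y / v) \<partial>gauss v)"
      unfolding D_def using i[of x] i[of x'] by (subst Bochner_Integration.integral_diff) auto
    also have "\<dots> \<le> (\<integral>y. (L * \<bar>x - x'\<bar> / v) * \<bar>y\<bar> \<partial>gauss v)"
    proof (rule Bochner_Integration.integral_norm_bound_integral)
      show "integrable (gauss v) (\<lambda>y. g (x + y) * (y / v) - g (x' + y) * (y / v))"
        using i[of x] i[of x'] by (intro Bochner_Integration.integrable_diff)
      show "integrable (gauss v) (\<lambda>y. (L * \<bar>x - x'\<bar> / v) * \<bar>y\<bar>)"
        using gauss_moments(5)[OF v] by simp
      fix y
      have "g (x + y) * (y / v) - g (x' + y) * (y / v) = (g (x + y) - g (x' + y)) * (y / v)"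
        by (simp add: algebra_simps)
      moreover have "\<bar>g (x + y) - g (x' + y)\<bar> * (\<bar>y\<bar> / v) \<le> L * \<bar>x - x'\<bar> * (\<bar>y\<bar> / v)"
        using lipschitz_realD(2)[OF g, of "x + y" "x' + y"] v by (intro mult_right_mono) auto
      ultimately show "norm (g (x + y) * (y / v) - g (x' + y) * (y / v)) \<le> (L * \<bar>x - x'\<bar> / v) * \<bar>y\<bar>"
        using v by (simp add: abs_mult)
    qed
    also have "\<dots> = (L * \<bar>x - x'\<bar> / v) * (\<integral>y. \<bar>y\<bar> \<partial>gauss v)"
      by (rule integral_mult_right_zero)
    also have "\<dots> \<le> (L * \<bar>x - x'\<bar> / v) * sqrt v"
      using gauss_moments(6)[OF v] L v by (intro mult_left_mono) auto
    also have "\<dots> = L / sqrt v * \<bar>x - x'\<bar>"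
      using v by (simp add: field_simps real_sqrt_mult_self)
    finally show "\<bar>D x - D x'\<bar> \<le> L / sqrt v * \<bar>x - x'\<bar>" by simp
  qed (use L v in simp)
qed

text \<open>Two derivatives are gained by smoothing twice with half of the variance. The Lipschitz constant of
  the second derivative decays like \<^term>\<open>1 / v\<close>; this rate makes the telescoping sum in the normal
  approximation a harmonic sum.\<close>

lemma gauss_smoothing_second_derivative:
  assumes v: "0 < v" and g: "L-lipschitz_on UNIV g"
  obtains D D2 where "\<And>x. (avg (gauss v) g has_real_derivative D x) (at x)"
    "\<And>x. (D has_real_derivative D2 x) (at x)" "(2 * L / v)-lipschitz_on UNIV D2"
proof -
  let ?G = "gauss (v / 2)"
  have v2: "0 < v / 2" using v by simp
  have split: "avg (gauss v) g = avg ?G (avg ?G g)"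
    using gauss_convolution[OF v2 v2] avg_convolution[OF has_mean_gauss[OF v2] has_mean_gauss[OF v2] g]
    by simp
  obtain D where D: "\<And>x. (avg ?G g has_real_derivative D x) (at x)"
    "(L / sqrt (v / 2))-lipschitz_on UNIV D"
    using gauss_smoothing[OF v2 g] by blast
  obtain D2 where D2: "\<And>x. (avg ?G D has_real_derivative D2 x) (at x)"
    "(L / sqrt (v / 2) / sqrt (v / 2))-lipschitz_on UNIV D2"
    using gauss_smoothing[OF v2 D(2)] by blast
  have "L / sqrt (v / 2) / sqrt (v / 2) = L / (sqrt (v / 2) * sqrt (v / 2))"
    by simp
  also have "\<dots> = 2 * L / v"
    using v2 by (simp only: real_sqrt_mult_self) simp
  finally have "(2 * L / v)-lipschitz_on UNIV D2"
    using D2(2) by simp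
  moreover have "(avg (gauss v) g has_real_derivative avg ?G D x) (at x)" for x
    unfolding split
    by (rule avg_derivative[OF has_mean_gauss[OF v2] avg_lipschitz[OF has_mean_gauss[OF v2] g] D(2,1)])
  ultimately show ?thesis using that D2(1) by blast
qed

section \<open>Normal approximation of sums in the Lipschitz metric\<close>

lemma avg_funpow_lipschitz:
  assumes "has_mean \<mu>" "L-lipschitz_on UNIV h"
  shows "L-lipschitz_on UNIV ((avg \<mu> ^^ k) h)"
  by (induction k) (auto intro: avg_lipschitz assms)

lemma avg_minus_id_le:
  assumes "has_mean \<mu>" "integrable \<mu> (\<lambda>y. y\<^sup>2)" "(\<integral>y. y\<^sup>2 \<partial>\<mu>) = 1" "L-lipschitz_on UNIV h"
  shows "\<bar>avg \<mu> h x - h x\<bar> \<le> L"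
proof -
  interpret prob_space \<mu> using assms(1) by (simp add: has_mean_def)
  note L = lipschitz_realD[OF assms(4)]
  note i = avg_integrable[OF assms(1,4), of x]
  have "norm (\<integral>y. h (x + y) - h x \<partial>\<mu>) \<le> (\<integral>y. L * ((1 + y\<^sup>2) / 2) \<partial>\<mu>)"
  proof (rule Bochner_Integration.integral_norm_bound_integral)
    fix y :: real
    have "0 \<le> (\<bar>y\<bar> - 1)\<^sup>2" by simp
    then have "\<bar>y\<bar> \<le> (1 + y\<^sup>2) / 2" by (simp add: power2_diff)
    then have "L * \<bar>y\<bar> \<le> L * ((1 + y\<^sup>2) / 2)" using L(3) by (rule mult_left_mono)
    then show "norm (h (x + y) - h x) \<le> L * ((1 + y\<^sup>2) / 2)" using L(1)[of x y] by simp
  qed (use i assms(2) in auto)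
  also have "\<dots> = L" using assms(2,3) by (simp add: prob_space)
  finally show ?thesis using i by (simp add: avg_def prob_space)
qed

text \<open>Lindeberg's replacement with Gaussian smoothing. Write $T$ for averaging over the step law and $G$ for averaging
  over the standard normal law. Since $T^{k+1} h - G^{k+1} h = T (T^k h - G^k h) + (T - G) G^k h$ and $T$ is a
  contraction, the error grows in each step by the size of $(T - G) G^k h$. The function $G^k h$ is smoothed
  at variance $k$, so its second derivative has Lipschitz constant of order $1/k$, and the two laws agree
  to second order. Hence the total error is a harmonic sum. The first step, where the test function is
  not smoothed, costs a constant.\<close>

lemma normal_approximation_lipschitz:
  assumes \<mu>: "has_mean \<mu>" "(\<integral>y. y \<partial>\<mu>) = 0" "integrable \<mu> (\<lambda>y. y\<^sup>2)" "(\<integral>y. y\<^sup>2 \<partial>\<mu>) = 1"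
    "integrable \<mu> (\<lambda>y. \<bar>y\<bar> ^ 3)"
  obtains C where "0 \<le> C" "\<And>L h k x. L-lipschitz_on UNIV h \<Longrightarrow> 1 \<le> k \<Longrightarrow>
    \<bar>(avg \<mu> ^^ k) h x - avg (gauss (real k)) h x\<bar> \<le> L * C * (1 + ln (real k))"
proof -
  define \<gamma> where "\<gamma> = gauss 1"
  have \<gamma>: "has_mean \<gamma>" "(\<integral>y. y \<partial>\<gamma>) = 0" "integrable \<gamma> (\<lambda>y. y\<^sup>2)" "(\<integral>y. y\<^sup>2 \<partial>\<gamma>) = 1"
    "integrable \<gamma> (\<lambda>y. \<bar>y\<bar> ^ 3)"
    using gauss_moments[of 1] has_mean_gauss[of 1] by (simp_all add: \<gamma>_def)
  define b where "b = (\<integral>y. \<bar>y\<bar> ^ 3 \<partial>\<mu>) + (\<integral>y. \<bar>y\<bar> ^ 3 \<partial>\<gamma>)"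
  have b: "0 \<le> b" unfolding b_def by simp
  \<comment> \<open>the 2 pays for the first step, \<^term>\<open>4 * b\<close> for the increments of a harmonic sum against those of the logarithm\<close>
  define C where "C = 2 + 4 * b"
  have main: "\<bar>(avg \<mu> ^^ k) h x - avg (gauss (real k)) h x\<bar> \<le> L * C * (1 + ln (real k))"
    if h: "L-lipschitz_on UNIV h" and "1 \<le> k" for L h k x
    using \<open>1 \<le> k\<close>
  proof (induction k arbitrary: x rule: nat_induct_at_least)
    case base
    have "\<bar>avg \<mu> h x - avg \<gamma> h x\<bar> \<le> 2 * L"
      using avg_minus_id_le[OF \<mu>(1,3,4) h, of x] avg_minus_id_le[OF \<gamma>(1,3,4) h, of x] by linarith
    also have "\<dots> \<le> L * C"
      using b lipschitz_realD(3)[OF h] by (simp add: C_def algebra_simps)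
    finally show ?case by (simp add: \<gamma>_def)
  next
    case (Suc k)
    have k: "0 < real k" using Suc.hyps by simp
    have L: "0 \<le> L" using lipschitz_realD(3)[OF h] .
    define U where "U = avg (gauss (real k)) h"
    have U: "L-lipschitz_on UNIV U"
      unfolding U_def by (rule avg_lipschitz[OF has_mean_gauss[OF k] h])
    have "avg (gauss (real (Suc k))) h = avg \<gamma> U"
      unfolding U_def \<gamma>_def
      using avg_convolution[OF has_mean_gauss[of 1] has_mean_gauss[OF k] h] gauss_convolution[of 1 "real k"] k
      by simp
    moreover have "\<bar>avg \<mu> ((avg \<mu> ^^ k) h) x - avg \<mu> U x\<bar> \<le> L * C * (1 + ln (real k))"
      using Suc.IH unfolding U_def[symmetric]
      by (intro avg_diff_le[OF \<mu>(1) avg_funpow_lipschitz[OF \<mu>(1) h] U])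
    moreover have "\<bar>avg \<mu> U x - avg \<gamma> U x\<bar> \<le> 2 * L / real k * b"
    proof -
      obtain D D2 where D: "\<And>x. (U has_real_derivative D x) (at x)"
        "\<And>x. (D has_real_derivative D2 x) (at x)" "(2 * L / real k)-lipschitz_on UNIV D2"
        using gauss_smoothing_second_derivative[OF k h] unfolding U_def by blast
      have "\<bar>avg \<mu> U x - U x - D2 x / 2\<bar> \<le> 2 * L / real k * (\<integral>y. \<bar>y\<bar> ^ 3 \<partial>\<mu>)"
        "\<bar>avg \<gamma> U x - U x - D2 x / 2\<bar> \<le> 2 * L / real k * (\<integral>y. \<bar>y\<bar> ^ 3 \<partial>\<gamma>)"
        using avg_second_order_expansion[OF \<mu> U D(3,1,2)] avg_second_order_expansion[OF \<gamma> U D(3,1,2)] by auto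
      then show ?thesis unfolding b_def distrib_left by linarith
    qed
    moreover have "2 * L / real k * b \<le> L * C * (ln (real (Suc k)) - ln (real k))"
    proof -
      \<comment> \<open>the reciprocal of \<^term>\<open>k\<close> is dominated by twice the increment of the logarithm\<close>
      have "1 / (2 * real k) \<le> 1 / (real k + 1)"
        using Suc.hyps by (simp add: field_simps)
      also have "\<dots> \<le> ln (real (Suc k)) - ln (real k)"
        using ln_one_minus_pos_lower_bound ln_le_minus_one[of "real k / (real k + 1)"] k
        by (simp add: ln_div field_simps)
      finally have "L * (4 * b) * (1 / (2 * real k)) \<le> L * (4 * b) * (ln (real (Suc k)) - ln (real k))"
        using L b by (intro mult_left_mono) auto
      also have "\<dots> \<le> L * C * (ln (real (Suc k)) - ln (real k))"
        using L b k by (intro mult_right_mono mult_left_mono) (auto simp: C_def)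
      finally show ?thesis by (simp add: field_simps)
    qed
    ultimately have "\<bar>(avg \<mu> ^^ Suc k) h x - avg (gauss (real (Suc k))) h x\<bar>
      \<le> L * C * (1 + ln (real k)) + L * C * (ln (real (Suc k)) - ln (real k))"
      by simp
    also have "\<dots> = L * C * (1 + ln (real (Suc k)))" by (simp only: algebra_simps)
    finally show ?case .
  qed
  show ?thesis
    using that[of C] main b by (simp add: C_def)
qed

text \<open>The law of a sum of \<^term>\<open>k\<close> independent variables with law \<^term>\<open>\<mu>\<close>.\<close>

definition conv_power :: "real measure \<Rightarrow> nat \<Rightarrow> real measure" where
  "conv_power \<mu> k = (convolution \<mu> ^^ k) (return borel 0)"

lemma has_mean_conv_power:
  assumes "has_mean \<mu>"
  shows "has_mean (conv_power \<mu> k)"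
proof (induction k)
  case 0
  have "integrable (return borel (0::real)) (\<lambda>x. x)"
    by (subst integrable_cong_AE[of _ _ "\<lambda>_. 0"]) (auto simp: AE_return)
  then show ?case by (simp add: conv_power_def has_mean_def prob_space_return)
next
  case (Suc k)
  then show ?case using has_mean_convolution[OF assms] by (simp add: conv_power_def)
qed

lemma avg_conv_power:
  assumes "has_mean \<mu>" "L-lipschitz_on UNIV h"
  shows "avg (conv_power \<mu> k) h = (avg \<mu> ^^ k) h"
proof (induction k)
  case 0
  show ?case
    using lipschitz_real_borel[OF assms(2)] by (auto simp: conv_power_def avg_def fun_eq_iff integral_return)
next
  case (Suc k)
  have "avg (conv_power \<mu> (Suc k)) h = avg \<mu> (avg (conv_power \<mu> k) h)"
    using avg_convolution[OF assms(1) has_mean_conv_power[OF assms(1)] assms(2)] by (simp add: conv_power_def)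
  then show ?case using Suc by simp
qed

lemma (in prob_space) distr_iid_sum:
  fixes \<xi> :: "'i \<Rightarrow> 'a \<Rightarrow> real"
  assumes "finite I" "indep_vars (\<lambda>_. borel) \<xi> I" "\<And>k. k \<in> I \<Longrightarrow> distr M borel (\<xi> k) = \<mu>"
  shows "distr M borel (\<lambda>\<omega>. \<Sum>k\<in>I. \<xi> k \<omega>) = conv_power \<mu> (card I)"
  using assms
proof (induction I rule: finite_induct)
  case empty
  show ?case
    by (rule measure_eqI)
      (auto simp: conv_power_def emeasure_distr emeasure_space_1 split: split_indicator)
next
  case (insert i I)
  have rv: "\<And>k. k \<in> insert i I \<Longrightarrow> \<xi> k \<in> borel_measurable M"
    using insert.prems(1) by (auto simp: indep_vars_def)
  then have [measurable]: "(\<lambda>\<omega>. \<Sum>k\<in>I. \<xi> k \<omega>) \<in> borel_measurable M" "\<xi> i \<in> borel_measurable M"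
    by auto
  have IH: "distr M borel (\<lambda>\<omega>. \<Sum>k\<in>I. \<xi> k \<omega>) = conv_power \<mu> (card I)"
    using insert.IH insert.prems indep_vars_subset[of _ \<xi> "insert i I" I] by auto
  have ind: "indep_var borel (\<xi> i) borel (\<lambda>\<omega>. \<Sum>k\<in>I. \<xi> k \<omega>)"
    by (rule indep_vars_sum) (use insert in auto)
  have "distr M borel (\<lambda>\<omega>. \<Sum>k\<in>insert i I. \<xi> k \<omega>)
      = convolution \<mu> (distr M borel (\<lambda>\<omega>. \<Sum>k\<in>I. \<xi> k \<omega>))"
    using sum_indep_random_variable[OF ind] insert.hyps insert.prems(2)[of i] by simp
  then show ?case unfolding IH using insert.hyps by (simp add: conv_power_def)
qed

text \<open>The law of an increment of the walk over a block of \<^term>\<open>K\<close> steps.\<close>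

definition rescaled_conv_power :: "real measure \<Rightarrow> nat \<Rightarrow> nat \<Rightarrow> real measure" where
  "rescaled_conv_power \<mu> m K = distr (conv_power \<mu> K) borel (\<lambda>x. x / sqrt (real m))"

lemma has_mean_rescaled_conv_power:
  assumes "has_mean \<mu>"
  shows "has_mean (rescaled_conv_power \<mu> m K)"
proof -
  have h: "prob_space (conv_power \<mu> K)" "sets (conv_power \<mu> K) = sets borel" "integrable (conv_power \<mu> K) (\<lambda>x. x)"
    using has_mean_conv_power[OF assms, of K] by (simp_all add: has_mean_def)
  note [measurable_cong] = h(2)
  have m: "(\<lambda>x. x / sqrt (real m)) \<in> conv_power \<mu> K \<rightarrow>\<^sub>M borel" by measurable
  have "integrable (conv_power \<mu> K) (\<lambda>x. x * (1 / sqrt (real m)))"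
    by (rule integrable_mult_left) (rule h(3))
  then have "integrable (conv_power \<mu> K) (\<lambda>x. x / sqrt (real m))" by simp
  moreover have "(\<lambda>x::real. x) \<in> borel_measurable borel" by measurable
  ultimately have "integrable (rescaled_conv_power \<mu> m K) (\<lambda>x. x)"
    unfolding rescaled_conv_power_def by (subst integrable_distr_eq[OF m])
  moreover have "prob_space (rescaled_conv_power \<mu> m K)"
    unfolding rescaled_conv_power_def by (rule prob_space.prob_space_distr[OF h(1) m])
  ultimately show ?thesis by (simp add: has_mean_def rescaled_conv_power_def)
qed

text \<open>The Lipschitz distance between a block increment of the walk and the Brownian increment over the
  same time. It is of order $\log K / \sqrt m$, with no loss in $K$ beyond the logarithm, so the errors of
  all the blocks can simply be added up.\<close>

lemma block_law_distance:
  assumes \<mu>: "has_mean \<mu>" "(\<integral>y. y \<partial>\<mu>) = 0" "integrable \<mu> (\<lambda>y. y\<^sup>2)" "(\<integral>y. y\<^sup>2 \<partial>\<mu>) = 1"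
    "integrable \<mu> (\<lambda>y. \<bar>y\<bar> ^ 3)"
  obtains C where "0 \<le> C" "\<And>L h m K. L-lipschitz_on UNIV h \<Longrightarrow> 1 \<le> K \<Longrightarrow> 1 \<le> m \<Longrightarrow>
    \<bar>(\<integral>z. h z \<partial>rescaled_conv_power \<mu> m K) - (\<integral>z. h z \<partial>gauss (real K / real m))\<bar>
    \<le> L * (C * (1 + ln (real K)) / sqrt (real m))"
proof -
  obtain C where C: "0 \<le> C" "\<And>L h k x. L-lipschitz_on UNIV h \<Longrightarrow> 1 \<le> k \<Longrightarrow>
    \<bar>(avg \<mu> ^^ k) h x - avg (gauss (real k)) h x\<bar> \<le> L * C * (1 + ln (real k))"
    using normal_approximation_lipschitz[OF \<mu>] by blast
  have main: "\<bar>(\<integral>z. h z \<partial>rescaled_conv_power \<mu> m K) - (\<integral>z. h z \<partial>gauss (real K / real m))\<bar>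
    \<le> L * (C * (1 + ln (real K)) / sqrt (real m))"
    if h: "L-lipschitz_on UNIV h" and K: "1 \<le> K" and m: "1 \<le> m" for L h and m K :: nat
  proof -
    note [measurable] = lipschitz_real_borel[OF h]
    have sm: "0 < sqrt (real m)" using m by simp
    have h': "(L / sqrt (real m))-lipschitz_on UNIV (\<lambda>x. h (x / sqrt (real m)))"
      unfolding lipschitz_real_iff
    proof (intro conjI allI)
      show "0 \<le> L / sqrt (real m)" using lipschitz_realD(3)[OF h] sm by simp
      fix x y
      have "\<bar>h (x / sqrt (real m)) - h (y / sqrt (real m))\<bar> \<le> L * \<bar>x / sqrt (real m) - y / sqrt (real m)\<bar>"
        by (rule lipschitz_realD(2)[OF h])
      also have "\<dots> = L / sqrt (real m) * \<bar>x - y\<bar>"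
        using sm by (simp add: diff_divide_distrib[symmetric])
      finally show "\<bar>h (x / sqrt (real m)) - h (y / sqrt (real m))\<bar> \<le> L / sqrt (real m) * \<bar>x - y\<bar>" .
    qed
    have 1: "(\<integral>z. h z \<partial>rescaled_conv_power \<mu> m K) = (avg \<mu> ^^ K) (\<lambda>x. h (x / sqrt (real m))) 0"
    proof -
      have s: "sets (conv_power \<mu> K) = sets borel"
        using has_mean_conv_power[OF \<mu>(1), of K] by (simp add: has_mean_def)
      have "(\<integral>z. h z \<partial>rescaled_conv_power \<mu> m K) = (\<integral>x. h (x / sqrt (real m)) \<partial>conv_power \<mu> K)"
        unfolding rescaled_conv_power_def
        by (rule integral_distr) (simp_all cong: measurable_cong_sets add: s)
      also have "\<dots> = avg (conv_power \<mu> K) (\<lambda>x. h (x / sqrt (real m))) 0" by (simp add: avg_def)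
      finally show ?thesis unfolding avg_conv_power[OF \<mu>(1) h'] .
    qed
    have 2: "(\<integral>z. h z \<partial>gauss (real K / real m)) = avg (gauss (real K)) (\<lambda>x. h (x / sqrt (real m))) 0"
    proof -
      have "(sqrt (real m))\<^sup>2 * (real K / real m) = real K" using m by simp
      then show ?thesis
        using integral_gauss_rescale[OF sm, of h "real K / real m"] by (simp add: avg_def)
    qed
    show ?thesis using C(2)[OF h' K, of 0] unfolding 1 2 by simp
  qed
  show ?thesis by (rule that[OF C(1) main])
qed

section \<open>Replacing the coordinates of a product measure\<close>

text \<open>Lipschitz with respect to the sum metric on the first \<^term>\<open>n\<close> coordinates; in particular a
  function of these coordinates only.\<close>

definition coord_lipschitz :: "nat \<Rightarrow> real \<Rightarrow> ((nat \<Rightarrow> real) \<Rightarrow> real) \<Rightarrow> bool" where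
  "coord_lipschitz n L \<Phi> \<longleftrightarrow> 0 \<le> L \<and> (\<forall>y y'. \<bar>\<Phi> y - \<Phi> y'\<bar> \<le> L * (\<Sum>i<n. \<bar>y i - y' i\<bar>))"

lemma coord_lipschitz_continuous:
  assumes "coord_lipschitz n L \<Phi>"
  shows "continuous_on UNIV \<Phi>"
  unfolding continuous_on_def
proof
  fix y :: "nat \<Rightarrow> real"
  have c: "((\<lambda>z. z i) \<longlongrightarrow> y i) (at y)" for i
    using continuous_on_product_coordinates[of i] by (auto simp: continuous_on_def)
  have "((\<lambda>z. L * (\<Sum>i<n. \<bar>z i - y i\<bar>)) \<longlongrightarrow> L * (\<Sum>i<n. \<bar>y i - y i\<bar>)) (at y)"
    by (intro tendsto_intros c)
  then have "((\<lambda>z. L * (\<Sum>i<n. \<bar>z i - y i\<bar>)) \<longlongrightarrow> 0) (at y)" by simp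
  then have "((\<lambda>z. \<Phi> z - \<Phi> y) \<longlongrightarrow> 0) (at y)"
    by (rule Lim_null_comparison[rotated])
      (use assms in \<open>auto simp: coord_lipschitz_def intro!: always_eventually\<close>)
  then show "(\<Phi> \<longlongrightarrow> \<Phi> y) (at y within UNIV)" by (simp add: LIM_zero_iff)
qed

text \<open>On a countable product of lines the product \<open>\<sigma>\<close>-algebra is the Borel \<open>\<sigma>\<close>-algebra of the product topology, so
  continuity suffices.\<close>

lemma coord_lipschitz_measurable:
  assumes "coord_lipschitz n L \<Phi>" "\<And>i. i < n \<Longrightarrow> Y i \<in> borel_measurable M"
  shows "(\<lambda>\<omega>. \<Phi> (\<lambda>i. Y i \<omega>)) \<in> borel_measurable M"
proof -
  have cut: "\<Phi> y = \<Phi> (\<lambda>i. if i < n then y i else 0)" for y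
  proof -
    have "\<bar>\<Phi> y - \<Phi> (\<lambda>i. if i < n then y i else 0)\<bar>
        \<le> L * (\<Sum>i<n. \<bar>y i - (if i < n then y i else 0)\<bar>)"
      using assms(1) by (simp only: coord_lipschitz_def)
    then show ?thesis by simp
  qed
  have "\<Phi> \<in> borel_measurable (\<Pi>\<^sub>M i\<in>UNIV. borel)"
    using borel_measurable_continuous_onI[OF coord_lipschitz_continuous[OF assms(1)]]
    by (simp cong: measurable_cong_sets add: sets_PiM_equal_borel)
  moreover have "(\<lambda>\<omega> i. if i < n then Y i \<omega> else 0) \<in> M \<rightarrow>\<^sub>M (\<Pi>\<^sub>M i\<in>UNIV. borel)"
  proof (rule measurable_PiM_single')
    show "(\<lambda>\<omega>. if i < n then Y i \<omega> else 0) \<in> borel_measurable M" for i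
      using assms(2)[of i] by (cases "i < n") auto
  qed auto
  ultimately have "(\<lambda>\<omega>. \<Phi> (\<lambda>i. if i < n then Y i \<omega> else 0)) \<in> borel_measurable M"
    by (rule measurable_compose[rotated])
  then show ?thesis by (subst cut)
qed

lemma coord_lipschitz_section:
  assumes "coord_lipschitz (Suc n) L \<Phi>"
  shows "L-lipschitz_on UNIV (\<lambda>z. \<Phi> (y(n := z)))"
  unfolding lipschitz_real_iff
proof (intro conjI allI)
  show "0 \<le> L" using assms by (simp add: coord_lipschitz_def)
  fix a b
  have "\<bar>\<Phi> (y(n := a)) - \<Phi> (y(n := b))\<bar> \<le> L * (\<Sum>i<Suc n. \<bar>(y(n := a)) i - (y(n := b)) i\<bar>)"
    using assms by (simp only: coord_lipschitz_def)
  then show "\<bar>\<Phi> (y(n := a)) - \<Phi> (y(n := b))\<bar> \<le> L * \<bar>a - b\<bar>" by simp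
qed

lemma coord_lipschitz_marginal:
  assumes \<mu>: "has_mean \<mu>" and \<Phi>: "coord_lipschitz (Suc n) L \<Phi>"
  shows "coord_lipschitz n L (\<lambda>y. \<integral>z. \<Phi> (y(n := z)) \<partial>\<mu>)"
  unfolding coord_lipschitz_def
proof (intro conjI allI)
  interpret prob_space \<mu> using \<mu> by (simp add: has_mean_def)
  show "0 \<le> L" using \<Phi> by (simp add: coord_lipschitz_def)
  fix y y' :: "nat \<Rightarrow> real"
  have i: "integrable \<mu> (\<lambda>z. \<Phi> (y(n := z)))" for y
    using avg_integrable[OF \<mu> coord_lipschitz_section[OF \<Phi>], where x = 0] by simp
  have "norm (\<integral>z. \<Phi> (y(n := z)) - \<Phi> (y'(n := z)) \<partial>\<mu>) \<le> (\<integral>z. L * (\<Sum>i<n. \<bar>y i - y' i\<bar>) \<partial>\<mu>)"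
  proof (rule Bochner_Integration.integral_norm_bound_integral)
    fix z
    have "\<bar>\<Phi> (y(n := z)) - \<Phi> (y'(n := z))\<bar> \<le> L * (\<Sum>i<Suc n. \<bar>(y(n := z)) i - (y'(n := z)) i\<bar>)"
      using \<Phi> by (simp only: coord_lipschitz_def)
    then show "norm (\<Phi> (y(n := z)) - \<Phi> (y'(n := z))) \<le> L * (\<Sum>i<n. \<bar>y i - y' i\<bar>)"
      by simp
  qed (use i in auto)
  then show "\<bar>(\<integral>z. \<Phi> (y(n := z)) \<partial>\<mu>) - (\<integral>z. \<Phi> (y'(n := z)) \<partial>\<mu>)\<bar> \<le> L * (\<Sum>i<n. \<bar>y i - y' i\<bar>)"
    using i by (simp add: prob_space)
qed

lemma coord_lipschitz_integrable:
  assumes \<mu>: "has_mean \<mu>" and \<Phi>: "coord_lipschitz n L \<Phi>"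
  shows "integrable (PiM {..<n} (\<lambda>_. \<mu>)) \<Phi>"
proof -
  interpret prob_space \<mu> using \<mu> by (simp add: has_mean_def)
  interpret product_prob_space "\<lambda>_. \<mu>" "{..<n}" ..
  note [measurable_cong] = \<mu>[unfolded has_mean_def, THEN conjunct2, THEN conjunct1]
  have coord: "(\<lambda>y. y i) \<in> borel_measurable (PiM {..<n} (\<lambda>_. \<mu>))" if "i < n" for i
    using measurable_component_singleton[of i "{..<n}" "\<lambda>_. \<mu>"] that \<mu>
    by (simp add: has_mean_def cong: measurable_cong_sets)
  have i: "integrable (PiM {..<n} (\<lambda>_. \<mu>)) (\<lambda>y. y i)" if "i < n" for i
  proof -
    have "integrable (distr (PiM {..<n} (\<lambda>_. \<mu>)) \<mu> (\<lambda>y. y i)) (\<lambda>x. x)"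
      using \<mu> that prob_space_axioms by (subst distr_PiM_component) (auto simp: has_mean_def)
    then show ?thesis
      using that by (subst (asm) integrable_distr_eq) auto
  qed
  show ?thesis
  proof (rule Bochner_Integration.integrable_bound)
    show "integrable (PiM {..<n} (\<lambda>_. \<mu>)) (\<lambda>y. \<bar>\<Phi> (\<lambda>_. 0)\<bar> + L * (\<Sum>i<n. \<bar>y i\<bar>))"
      using i by (intro Bochner_Integration.integrable_add integrable_mult_right
          Bochner_Integration.integrable_sum integrable_abs) auto
    show "\<Phi> \<in> borel_measurable (PiM {..<n} (\<lambda>_. \<mu>))"
      using coord_lipschitz_measurable[OF \<Phi> coord] by simp
    show "AE y in PiM {..<n} (\<lambda>_. \<mu>). norm (\<Phi> y) \<le> norm (\<bar>\<Phi> (\<lambda>_. 0)\<bar> + L * (\<Sum>i<n. \<bar>y i\<bar>))"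
    proof (rule AE_I2)
      fix y :: "nat \<Rightarrow> real"
      have "\<bar>\<Phi> y - \<Phi> (\<lambda>_. 0)\<bar> \<le> L * (\<Sum>i<n. \<bar>y i - 0\<bar>)"
        using \<Phi> by (simp only: coord_lipschitz_def)
      then show "norm (\<Phi> y) \<le> norm (\<bar>\<Phi> (\<lambda>_. 0)\<bar> + L * (\<Sum>i<n. \<bar>y i\<bar>))"
        by simp
    qed
  qed
qed

text \<open>Coordinates are exchanged one at a time. When the last coordinate is integrated out under either law the
  result is again Lipschitz in the other coordinates, and the two results differ uniformly by at most the
  distance of the marginals, because the function is Lipschitz in the last coordinate.\<close>

lemma product_replacement:
  assumes \<mu>: "has_mean \<mu>" and \<nu>: "has_mean \<nu>"
    and eps: "\<And>L h. L-lipschitz_on UNIV h \<Longrightarrow> \<bar>(\<integral>z. h z \<partial>\<mu>) - (\<integral>z. h z \<partial>\<nu>)\<bar> \<le> L * e"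
    and \<Phi>: "coord_lipschitz n L \<Phi>"
  shows "\<bar>integral\<^sup>L (PiM {..<n} (\<lambda>_. \<mu>)) \<Phi> - integral\<^sup>L (PiM {..<n} (\<lambda>_. \<nu>)) \<Phi>\<bar> \<le> real n * (L * e)"
  using \<Phi>
proof (induction n arbitrary: \<Phi>)
  case 0
  show ?case by (simp add: PiM_empty)
next
  case (Suc n)
  interpret M: prob_space \<mu> using \<mu> by (simp add: has_mean_def)
  interpret N: prob_space \<nu> using \<nu> by (simp add: has_mean_def)
  interpret \<mu>: product_prob_space "\<lambda>_::nat. \<mu>" "{..<n}" ..
  interpret \<nu>: product_prob_space "\<lambda>_::nat. \<nu>" "{..<n}" ..
  define A where "A y = (\<integral>z. \<Phi> (y(n := z)) \<partial>\<mu>)" for y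
  define B where "B y = (\<integral>z. \<Phi> (y(n := z)) \<partial>\<nu>)" for y
  have A: "coord_lipschitz n L A" and B: "coord_lipschitz n L B"
    unfolding A_def[abs_def] B_def[abs_def]
    using coord_lipschitz_marginal[OF \<mu> Suc.prems] coord_lipschitz_marginal[OF \<nu> Suc.prems]
    by blast+
  have AB: "\<bar>A y - B y\<bar> \<le> L * e" for y
    unfolding A_def B_def by (rule eps[OF coord_lipschitz_section[OF Suc.prems]])
  have ins: "{..<Suc n} = insert n {..<n}" by auto
  have 1: "integral\<^sup>L (PiM {..<Suc n} (\<lambda>_. \<mu>)) \<Phi> = integral\<^sup>L (PiM {..<n} (\<lambda>_. \<mu>)) A"
    using coord_lipschitz_integrable[OF \<mu> Suc.prems] unfolding ins A_def
    by (subst \<mu>.product_integral_insert) auto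
  have 2: "integral\<^sup>L (PiM {..<Suc n} (\<lambda>_. \<nu>)) \<Phi> = integral\<^sup>L (PiM {..<n} (\<lambda>_. \<nu>)) B"
    using coord_lipschitz_integrable[OF \<nu> Suc.prems] unfolding ins B_def
    by (subst \<nu>.product_integral_insert) auto
  have P\<mu>: "prob_space (PiM {..<n} (\<lambda>_. \<mu>))"
    by (rule prob_space_PiM) (rule M.prob_space_axioms)
  note iA = coord_lipschitz_integrable[OF \<mu> A] and iB = coord_lipschitz_integrable[OF \<mu> B]
  have "\<bar>\<integral>y. A y - B y \<partial>PiM {..<n} (\<lambda>_. \<mu>)\<bar> \<le> (\<integral>y. \<bar>A y - B y\<bar> \<partial>PiM {..<n} (\<lambda>_. \<mu>))"
    by (rule integral_abs_bound)
  also have "\<dots> \<le> (\<integral>y. L * e \<partial>PiM {..<n} (\<lambda>_. \<mu>))"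
    using iA iB AB by (intro integral_mono) auto
  finally have "\<bar>integral\<^sup>L (PiM {..<n} (\<lambda>_. \<mu>)) A - integral\<^sup>L (PiM {..<n} (\<lambda>_. \<mu>)) B\<bar> \<le> L * e"
    using iA iB prob_space.prob_space[OF P\<mu>] by simp
  moreover have "real (Suc n) * (L * e) = L * e + real n * (L * e)"
    by (simp add: algebra_simps)
  ultimately show ?case
    using Suc.IH[OF B] unfolding 1 2 by linarith
qed

lemma (in prob_space) expectation_iid:
  fixes Y :: "nat \<Rightarrow> 'a \<Rightarrow> real"
  assumes \<mu>: "has_mean \<mu>" and \<Phi>: "coord_lipschitz n L \<Phi>"
    and ind: "indep_vars (\<lambda>_. borel) Y {..<n}" and law: "\<And>i. i < n \<Longrightarrow> distr M borel (Y i) = \<mu>"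
  shows "expectation (\<lambda>\<omega>. \<Phi> (\<lambda>i. Y i \<omega>)) = integral\<^sup>L (PiM {..<n} (\<lambda>_. \<mu>)) \<Phi>"
    "integrable M (\<lambda>\<omega>. \<Phi> (\<lambda>i. Y i \<omega>))"
proof -
  have rv: "Y i \<in> borel_measurable M" if "i < n" for i
    using ind that by (auto simp: indep_vars_def)
  have cut: "\<Phi> (\<lambda>i\<in>{..<n}. y i) = \<Phi> y" for y
  proof -
    have "\<bar>\<Phi> (\<lambda>i\<in>{..<n}. y i) - \<Phi> y\<bar> \<le> L * (\<Sum>i<n. \<bar>(\<lambda>i\<in>{..<n}. y i) i - y i\<bar>)"
      using \<Phi> by (simp only: coord_lipschitz_def)
    then show ?thesis by simp
  qed
  have "expectation (\<lambda>\<omega>. \<Phi> (\<lambda>i. Y i \<omega>)) = integral\<^sup>L (PiM {..<n} (\<lambda>_. \<mu>)) \<Phi>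
    \<and> integrable M (\<lambda>\<omega>. \<Phi> (\<lambda>i. Y i \<omega>))"
  proof (cases "n = 0")
    case True
    have "\<Phi> y = \<Phi> (\<lambda>_. undefined)" for y using cut[of y] True by (simp add: restrict_def)
    then have "(\<lambda>\<omega>. \<Phi> (\<lambda>i. Y i \<omega>)) = (\<lambda>_. \<Phi> (\<lambda>_. undefined))" by auto
    then show ?thesis using True by (simp add: PiM_empty lebesgue_integral_count_space_finite prob_space)
  next
    case False
    let ?P = "PiM {..<n} (\<lambda>_. borel :: real measure)"
    have eq: "distr M ?P (\<lambda>\<omega>. \<lambda>i\<in>{..<n}. Y i \<omega>) = PiM {..<n} (\<lambda>_. \<mu>)"
      using ind False rv law by (subst (asm) indep_vars_iff_distr_eq_PiM') (auto intro: PiM_cong)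
    have m: "\<Phi> \<in> borel_measurable ?P"
      using coord_lipschitz_measurable[OF \<Phi>, of "\<lambda>i y. y i" ?P] by simp
    have m2: "(\<lambda>\<omega>. \<lambda>i\<in>{..<n}. Y i \<omega>) \<in> M \<rightarrow>\<^sub>M ?P"
      using rv by (intro measurable_restrict) auto
    show ?thesis
      using coord_lipschitz_integrable[OF \<mu> \<Phi>] m m2 unfolding eq[symmetric]
      by (simp add: integral_distr integrable_distr_eq cut)
  qed
  then show "expectation (\<lambda>\<omega>. \<Phi> (\<lambda>i. Y i \<omega>)) = integral\<^sup>L (PiM {..<n} (\<lambda>_. \<mu>)) \<Phi>"
    "integrable M (\<lambda>\<omega>. \<Phi> (\<lambda>i. Y i \<omega>))" by auto
qed

section \<open>Polygonal paths and the regulator map\<close>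

definition ramp :: "real \<Rightarrow> real" where "ramp x = max 0 (min 1 x)"

text \<open>The path that is affine on each of the first \<^term>\<open>n\<close> intervals of length \<open>\<delta>\<close>, has the increments
  \<^term>\<open>y\<close> over them and is constant afterwards. Written as a sum of ramps it is visibly linear in the increments.\<close>

definition polyline :: "real \<Rightarrow> nat \<Rightarrow> (nat \<Rightarrow> real) \<Rightarrow> real \<Rightarrow> real" where
  "polyline \<delta> n y t = (\<Sum>i<n. y i * ramp (t / \<delta> - real i))"

lemma continuous_on_polyline: "continuous_on A (polyline \<delta> n y)"
  unfolding polyline_def[abs_def] ramp_def divide_inverse by (intro continuous_intros)

text \<open>Each ramp takes values in the unit interval, so the path is Lipschitz in its increments for the uniform
  norm.\<close>

lemma polyline_diff_le:
  "\<bar>polyline \<delta> n y t - polyline \<delta> n y' t\<bar> \<le> (\<Sum>i<n. \<bar>y i - y' i\<bar>)"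
proof -
  have "polyline \<delta> n y t - polyline \<delta> n y' t = (\<Sum>i<n. (y i - y' i) * ramp (t / \<delta> - real i))"
    by (simp add: polyline_def sum_subtractf algebra_simps)
  also have "\<bar>\<dots>\<bar> \<le> (\<Sum>i<n. \<bar>(y i - y' i) * ramp (t / \<delta> - real i)\<bar>)"
    by (rule sum_abs)
  also have "\<dots> \<le> (\<Sum>i<n. \<bar>y i - y' i\<bar>)"
    by (intro sum_mono) (auto simp: abs_mult ramp_def intro: mult_left_le)
  finally show ?thesis .
qed

lemma polyline_on_cell:
  assumes "0 < \<delta>" "real j * \<delta> \<le> t" "t \<le> (real j + 1) * \<delta>" "j < n"
  shows "polyline \<delta> n y t = (\<Sum>i<j. y i) + y j * (t / \<delta> - real j)"
proof -
  have t: "real j \<le> t / \<delta>" "t / \<delta> \<le> real j + 1"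
    using assms by (simp_all add: field_simps)
  have "polyline \<delta> n y t = (\<Sum>i<n. if i < j then y i else if i = j then y j * (t / \<delta> - real j) else 0)"
    unfolding polyline_def
  proof (rule sum.cong)
    fix i
    consider "i < j" "real i + 1 \<le> real j" | "i = j" | "j < i" "real j + 1 \<le> real i"
      by (cases i j rule: linorder_cases) auto
    then show "y i * ramp (t / \<delta> - real i)
      = (if i < j then y i else if i = j then y j * (t / \<delta> - real j) else 0)"
      using t by cases (auto simp: ramp_def)
  qed simp
  also have "\<dots> = (\<Sum>i\<in>{..<j} \<union> {j}. if i < j then y i else if i = j then y j * (t / \<delta> - real j) else 0)"
    using assms(4) by (intro sum.mono_neutral_right) auto
  also have "\<dots> = (\<Sum>i<j. y i) + y j * (t / \<delta> - real j)"
    by (subst sum.union_disjoint) auto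
  finally show ?thesis .
qed

lemma polyline_after_last_cell:
  assumes "0 < \<delta>" "real n * \<delta> \<le> t"
  shows "polyline \<delta> n y t = (\<Sum>i<n. y i)"
  unfolding polyline_def
proof (rule sum.cong)
  fix i assume "i \<in> {..<n}"
  then have "real i + 1 \<le> real n" by auto
  moreover have "real n \<le> t / \<delta>" using assms by (simp add: field_simps)
  ultimately show "y i * ramp (t / \<delta> - real i) = y i" by (simp add: ramp_def)
qed simp

text \<open>Interpolating a path at the grid points costs at most twice its oscillation over a cell. The time after
  the last full cell counts as one more, shorter, cell.\<close>

lemma polyline_interpolation_error:
  assumes \<delta>: "0 < \<delta>" and w0: "w 0 = 0"
    and osc: "\<And>j t. j \<le> n \<Longrightarrow> real j * \<delta> \<le> t \<Longrightarrow> t \<le> (real j + 1) * \<delta> \<Longrightarrow> t \<le> 1 \<Longrightarrow> \<bar>w t - w (real j * \<delta>)\<bar> \<le> e"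
    and n: "real n * \<delta> \<le> 1" "1 < (real n + 1) * \<delta>" and t: "0 \<le> t" "t \<le> 1"
  shows "\<bar>w t - polyline \<delta> n (\<lambda>i. w (real (Suc i) * \<delta>) - w (real i * \<delta>)) t\<bar> \<le> 2 * e"
proof -
  let ?y = "\<lambda>i. w (real (Suc i) * \<delta>) - w (real i * \<delta>)"
  have e: "0 \<le> e" using osc[of 0 0] \<delta> by (simp add: w0)
  have tel: "(\<Sum>i<j. ?y i) = w (real j * \<delta>)" for j
    using sum_lessThan_telescope[of "\<lambda>i. w (real i * \<delta>)" j] w0 by simp
  show ?thesis
  proof (cases "real n * \<delta> \<le> t")
    case True
    then have "\<bar>w t - polyline \<delta> n ?y t\<bar> \<le> e"
      using osc[of n t] n t unfolding polyline_after_last_cell[OF \<delta> True] tel by simp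
    then show ?thesis using e by simp
  next
    case False
    define j where "j = nat \<lfloor>t / \<delta>\<rfloor>"
    have td: "0 \<le> t / \<delta>" using t \<delta> by simp
    then have "real j \<le> t / \<delta>" "t / \<delta> < real j + 1"
      unfolding j_def by (simp_all add: of_nat_floor)
    then have j: "real j * \<delta> \<le> t" "t < (real j + 1) * \<delta>"
      using \<delta> by (simp_all add: field_simps)
    have "real j * \<delta> < real n * \<delta>" using False j by simp
    then have jn: "j < n" using \<delta> by simp
    then have "(real j + 1) * \<delta> \<le> real n * \<delta>"
      using \<delta> by (intro mult_right_mono) auto
    then have "\<bar>w ((real j + 1) * \<delta>) - w (real j * \<delta>)\<bar> \<le> e"
      using osc[of j "(real j + 1) * \<delta>"] jn \<delta> n(1) by (simp add: algebra_simps)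
    moreover have "\<bar>t / \<delta> - real j\<bar> \<le> 1"
      using j \<delta> by (simp add: field_simps abs_le_iff)
    ultimately have "\<bar>w ((real j + 1) * \<delta>) - w (real j * \<delta>)\<bar> * \<bar>t / \<delta> - real j\<bar> \<le> e * 1"
      using e by (intro mult_mono) auto
    then have "\<bar>?y j * (t / \<delta> - real j)\<bar> \<le> e"
      by (simp add: abs_mult add.commute)
    moreover have "\<bar>w t - w (real j * \<delta>)\<bar> \<le> e"
      using osc[of j t] j jn t by simp
    moreover have "polyline \<delta> n ?y t = w (real j * \<delta>) + ?y j * (t / \<delta> - real j)"
      using polyline_on_cell[of \<delta> j t n ?y] j jn \<delta> unfolding tel by simp
    ultimately show ?thesis by linarith
  qed
qed

lemma scaled_walk_polyline:
  assumes m: "0 < m" and t: "0 \<le> t"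
  shows "scaled_walk m x t = polyline (1 / real m) m (\<lambda>k. x k / sqrt (real m)) t"
proof -
  have r: "0 < real m" using m by simp
  have "(LINT s:{0..t}|lborel. indicator {real k / real m..<(real k + 1) / real m} s)
      = ramp (t * real m - real k) / real m" for k
  proof -
    let ?a = "real k / real m" and ?b = "(real k + 1) / real m"
    have ab: "0 \<le> ?a" "?a < ?b" using r by (simp_all add: divide_strict_right_mono)
    have I: "(LINT s:{0..t}|lborel. indicator {?a..<?b} s) = measure lborel ({0..t} \<inter> {?a..<?b})"
      unfolding set_lebesgue_integral_def by (simp add: indicator_inter_arith[symmetric])
    consider "t < ?a" | "?a \<le> t" "t < ?b" | "?b \<le> t" by linarith
    then show ?thesis
    proof cases
      case 1
      then have "{0..t} \<inter> {?a..<?b} = {}" by auto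
      moreover have "t * real m - real k \<le> 0" using 1 r by (simp add: field_simps)
      ultimately show ?thesis unfolding I by (simp add: ramp_def)
    next
      case 2
      then have "{0..t} \<inter> {?a..<?b} = {?a..t}" by (auto intro: order_trans[OF ab(1)])
      moreover have "0 \<le> t * real m - real k" "t * real m - real k \<le> 1"
        using 2 r by (simp_all add: field_simps)
      moreover from this have "ramp (t * real m - real k) = t * real m - real k"
        unfolding ramp_def by linarith
      moreover have "t - ?a = (t * real m - real k) / real m"
        using r by (simp add: diff_divide_distrib)
      ultimately show ?thesis unfolding I using 2 by simp
    next
      case 3
      then have "{0..t} \<inter> {?a..<?b} = {?a..<?b}" by (auto intro: order_trans[OF ab(1)])
      moreover have "1 \<le> t * real m - real k" using 3 r by (simp add: field_simps)
      moreover from this have "ramp (t * real m - real k) = 1"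
        unfolding ramp_def by linarith
      moreover have "?b - ?a = 1 / real m"
        by (simp add: diff_divide_distrib[symmetric])
      ultimately show ?thesis unfolding I using ab by simp
    qed
  qed
  then have "scaled_walk m x t = (\<Sum>k<m. x k * sqrt (real m) * (ramp (t * real m - real k) / real m))"
    by (simp add: scaled_walk_def)
  also have "\<dots> = polyline (1 / real m) m (\<lambda>k. x k / sqrt (real m)) t"
    unfolding polyline_def
  proof (rule sum.cong)
    fix k
    have "sqrt (real m) / (sqrt (real m) * sqrt (real m)) = 1 / sqrt (real m)"
      using r by (simp del: real_sqrt_mult_self)
    then have "sqrt (real m) / real m = 1 / sqrt (real m)" using r by simp
    then have "x k * ramp (t * real m - real k) * (sqrt (real m) / real m)
        = x k * ramp (t * real m - real k) * (1 / sqrt (real m))" by simp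
    moreover have "x k * sqrt (real m) * (ramp (t * real m - real k) / real m)
        = x k * ramp (t * real m - real k) * (sqrt (real m) / real m)" by simp
    moreover have "x k / sqrt (real m) * ramp (t / (1 / real m) - real k)
        = x k * ramp (t * real m - real k) * (1 / sqrt (real m))" by simp
    ultimately show "x k * sqrt (real m) * (ramp (t * real m - real k) / real m)
        = x k / sqrt (real m) * ramp (t / (1 / real m) - real k)"
      by (simp only:)
  qed simp
  finally show ?thesis .
qed

lemma scaled_walk_at:
  assumes "i < m" "real i / real m \<le> t" "t \<le> (real i + 1) / real m"
  shows "scaled_walk m x t = ((\<Sum>k<i. x k) + x i * (t * real m - real i)) / sqrt (real m)"
proof -
  have m: "0 < m" using assms(1) by simp
  have "0 \<le> real i / real m" by simp
  then have t: "0 \<le> t" using assms(2) by linarith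
  have "scaled_walk m x t = (\<Sum>k<i. x k / sqrt (real m)) + x i / sqrt (real m) * (t / (1 / real m) - real i)"
    unfolding scaled_walk_polyline[OF m t] using assms m by (intro polyline_on_cell) auto
  then show ?thesis by (simp add: sum_divide_distrib add_divide_distrib)
qed

lemma scaled_walk_grid:
  assumes "0 < m" "k \<le> m"
  shows "scaled_walk m x (real k / real m) = (\<Sum>l<k. x l) / sqrt (real m)"
proof (cases "k = m")
  case True
  have "scaled_walk m x (real k / real m) = (\<Sum>l<m. x l / sqrt (real m))"
    using assms True by (subst scaled_walk_polyline) (auto intro!: polyline_after_last_cell)
  then show ?thesis using True by (simp add: sum_divide_distrib)
next
  case False
  then show ?thesis
    using scaled_walk_at[of k m "real k / real m" x] assms by (simp add: divide_right_mono)
qed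

lemma continuous_on_scaled_walk:
  assumes "0 < m"
  shows "continuous_on {0..1} (scaled_walk m x)"
  by (rule continuous_on_eq[OF continuous_on_polyline[of _ "1 / real m" m "\<lambda>k. x k / sqrt (real m)"]])
    (use scaled_walk_polyline[OF assms] in auto)

lemma bdd_above_neg_part:
  fixes w :: "real \<Rightarrow> real"
  assumes "continuous_on {0..1} w" "t \<in> {0..1}"
  shows "bdd_above ((\<lambda>s. max 0 (- w s)) ` {0..t::real})"
proof -
  have "continuous_on {0..t} (\<lambda>s. max 0 (- w s))"
    using assms by (intro continuous_intros) (auto elim: continuous_on_subset)
  then show ?thesis
    by (intro bounded_imp_bdd_above compact_imp_bounded compact_continuous_image) auto
qed

lemma regulator_upper:
  assumes "continuous_on {0..1} w" "t \<in> {0..1}" "s \<in> {0..t}"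
  shows "max 0 (- w s) \<le> regulator w t"
proof -
  have "max 0 (- w s) \<le> (SUP s\<in>{0..t}. max 0 (- w s))"
    by (rule cSUP_upper[OF assms(3) bdd_above_neg_part[OF assms(1,2)]])
  then show ?thesis using assms(2) by (simp add: regulator_def del: max.bounded_iff)
qed

lemma regulator_least:
  assumes "t \<in> {0..1}" "\<And>s. s \<in> {0..t} \<Longrightarrow> max 0 (- w s) \<le> a"
  shows "regulator w t \<le> a"
proof -
  have "(SUP s\<in>{0..t}. max 0 (- w s)) \<le> a"
    using assms by (intro cSUP_least) auto
  then show ?thesis using assms(1) by (simp add: regulator_def)
qed

lemma regulator_diff_le:
  assumes "continuous_on {0..1} w" "continuous_on {0..1} w'" "\<And>t. t \<in> {0..1} \<Longrightarrow> \<bar>w t - w' t\<bar> \<le> d"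
    "t \<in> {0..1}"
  shows "regulator w t \<le> regulator w' t + d"
proof (rule regulator_least[OF assms(4)])
  fix s assume s: "s \<in> {0..t}"
  then have "\<bar>w s - w' s\<bar> \<le> d" using assms(3,4) by auto
  then have "max 0 (- w s) \<le> max 0 (- w' s) + d" by linarith
  then show "max 0 (- w s) \<le> regulator w' t + d"
    using regulator_upper[OF assms(2,4) s] by linarith
qed

text \<open>On a short time interval the running supremum grows by no more than the path oscillates.\<close>

lemma regulator_in_C01:
  assumes w: "continuous_on {0..1} w"
  shows "regulator w \<in> mspace C01"
proof -
  have "uniformly_continuous_on {0..1} w"
    using w by (intro compact_uniformly_continuous) auto
  then have "uniformly_continuous_on {0..1} (regulator w)"
    unfolding uniformly_continuous_on_def
  proof (intro allI impI)
    fix e :: real assume u: "\<forall>e>0. \<exists>d>0. \<forall>x\<in>{0..1}. \<forall>x'\<in>{0..1}. dist x' x < d \<longrightarrow> dist (w x') (w x) < e" and "0 < e"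
    then obtain d where d: "0 < d" "\<And>x x'. x \<in> {0..1} \<Longrightarrow> x' \<in> {0..1} \<Longrightarrow> dist x' x < d \<Longrightarrow> dist (w x') (w x) < e / 2"
      by (meson half_gt_zero)
    have le: "regulator w t \<le> regulator w s + e / 2" "regulator w s \<le> regulator w t"
      if st: "s \<in> {0..1}" "t \<in> {0..1}" "s \<le> t" "t - s < d" for s t
    proof -
      show "regulator w s \<le> regulator w t"
      proof (rule regulator_least[OF st(1)])
        fix u assume "u \<in> {0..s}"
        then show "max 0 (- w u) \<le> regulator w t" using st by (intro regulator_upper[OF w]) auto
      qed
      show "regulator w t \<le> regulator w s + e / 2"
      proof (rule regulator_least[OF st(2)])
        fix u assume u: "u \<in> {0..t}"
        show "max 0 (- w u) \<le> regulator w s + e / 2"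
        proof (cases "u \<le> s")
          case True
          then show ?thesis using u regulator_upper[OF w st(1), of u] \<open>0 < e\<close> by simp
        next
          case False
          then have "dist (w u) (w s) < e / 2" using u st by (intro d(2)) (auto simp: dist_real_def)
          moreover have "max 0 (- w s) \<le> regulator w s"
            using regulator_upper[OF w st(1), of s] st(1) by simp
          ultimately show ?thesis
            using \<open>0 < e\<close> unfolding dist_real_def by linarith
        qed
      qed
    qed
    show "\<exists>d>0. \<forall>x\<in>{0..1}. \<forall>x'\<in>{0..1}. dist x' x < d \<longrightarrow> dist (regulator w x') (regulator w x) < e"
    proof (intro exI[of _ d] conjI ballI impI)
      fix x x' :: real assume x: "x \<in> {0..1}" "x' \<in> {0..1}" "dist x' x < d"
      show "dist (regulator w x') (regulator w x) < e"
      proof (cases "x \<le> x'")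
        case True
        then show ?thesis using le[of x x'] x \<open>0 < e\<close> by (simp add: dist_real_def)
      next
        case False
        then show ?thesis using le[of x' x] x \<open>0 < e\<close> by (simp add: dist_real_def)
      qed
    qed (rule d(1))
  qed
  then have "continuous_on {0..1} (regulator w)"
    by (rule uniformly_continuous_imp_continuous)
  then show ?thesis by (simp add: mspace_C01 regulator_def)
qed

text \<open>The regulator map is Lipschitz for the uniform norm, so the estimates for the reflected paths reduce
  to estimates for the paths themselves.\<close>

lemma Lip1_regulator:
  assumes f: "f \<in> Lip1 C01" and w: "continuous_on {0..1} w" "continuous_on {0..1} w'"
    and d: "\<And>t. t \<in> {0..1} \<Longrightarrow> \<bar>w t - w' t\<bar> \<le> d"
  shows "\<bar>f (regulator w) - f (regulator w')\<bar> \<le> d"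
proof -
  have "\<bar>f (regulator w) - f (regulator w')\<bar> \<le> mdist C01 (regulator w) (regulator w')"
    using f regulator_in_C01[OF w(1)] regulator_in_C01[OF w(2)] by (auto simp: Lip1_def)
  also have "\<dots> = (SUP t\<in>{0..1}. \<bar>regulator w t - regulator w' t\<bar>)"
    by (rule mdist_C01[OF regulator_in_C01[OF w(1)] regulator_in_C01[OF w(2)]])
  also have "\<dots> \<le> d"
  proof (rule cSUP_least)
    fix t :: real assume t: "t \<in> {0..1}"
    have "regulator w t \<le> regulator w' t + d"
      by (rule regulator_diff_le[OF w _ t]) (rule d)
    moreover have "regulator w' t \<le> regulator w t + d"
    proof (rule regulator_diff_le[OF w(2,1) _ t])
      show "\<bar>w' t - w t\<bar> \<le> d" if "t \<in> {0..1}" for t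
        using d[OF that] by (simp add: abs_minus_commute)
    qed
    ultimately show "\<bar>regulator w t - regulator w' t\<bar> \<le> d" by linarith
  qed simp
  finally show ?thesis .
qed

lemma coord_lipschitz_regulator:
  assumes "f \<in> Lip1 C01"
  shows "coord_lipschitz n 1 (\<lambda>y. f (regulator (polyline \<delta> n y)))"
  unfolding coord_lipschitz_def
  using Lip1_regulator[OF assms continuous_on_polyline continuous_on_polyline polyline_diff_le] by simp

text \<open>A Lipschitz functional of a process with continuous paths is measurable, since it is the limit
  of the functional along polygonal interpolations, each of which depends on finitely many values.\<close>

lemma regulator_functional_measurable:
  assumes f: "f \<in> Lip1 C01"
    and W: "\<And>t. t \<in> {0..1} \<Longrightarrow> (\<lambda>\<omega>. W \<omega> t) \<in> borel_measurable M"
    and c: "\<And>\<omega>. \<omega> \<in> space M \<Longrightarrow> continuous_on {0..1} (W \<omega>)"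
    and W0: "\<And>\<omega>. \<omega> \<in> space M \<Longrightarrow> W \<omega> 0 = 0"
  shows "(\<lambda>\<omega>. f (regulator (W \<omega>))) \<in> borel_measurable M"
proof (rule borel_measurable_LIMSEQ_real)
  define \<delta> where "\<delta> n = 1 / real (Suc n)" for n
  define Y where "Y n i \<omega> = W \<omega> (real (Suc i) * \<delta> n) - W \<omega> (real i * \<delta> n)" for n i \<omega>
  show "(\<lambda>\<omega>. f (regulator (polyline (\<delta> n) (Suc n) (\<lambda>i. Y n i \<omega>)))) \<in> borel_measurable M" for n
  proof (rule coord_lipschitz_measurable[OF coord_lipschitz_regulator[OF f]])
    fix i assume "i < Suc n"
    then have "real i * \<delta> n \<in> {0..1}" "real (Suc i) * \<delta> n \<in> {0..1}"
      by (auto simp: \<delta>_def field_simps)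
    from W[OF this(1)] W[OF this(2)] show "Y n i \<in> borel_measurable M"
      by (simp add: Y_def[abs_def])
  qed
  fix \<omega> assume \<omega>: "\<omega> \<in> space M"
  show "(\<lambda>n. f (regulator (polyline (\<delta> n) (Suc n) (\<lambda>i. Y n i \<omega>)))) \<longlonglongrightarrow> f (regulator (W \<omega>))"
  proof (rule metric_LIMSEQ_I)
    fix e :: real assume "0 < e"
    have "uniformly_continuous_on {0..1} (W \<omega>)"
      using c[OF \<omega>] by (intro compact_uniformly_continuous) auto
    moreover have "0 < e / 4" using \<open>0 < e\<close> by simp
    ultimately have "\<exists>d>0. \<forall>x\<in>{0..1}. \<forall>x'\<in>{0..1}. dist x' x < d \<longrightarrow> dist (W \<omega> x') (W \<omega> x) < e / 4"
      unfolding uniformly_continuous_on_def by blast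
    then obtain d where d: "0 < d" "\<And>x x'. x \<in> {0..1} \<Longrightarrow> x' \<in> {0..1} \<Longrightarrow> dist x' x < d \<Longrightarrow> dist (W \<omega> x') (W \<omega> x) < e / 4"
      by blast
    obtain N where N: "1 / real (Suc N) < d"
      using reals_Archimedean[OF d(1)] by (auto simp: inverse_eq_divide)
    show "\<exists>N. \<forall>n\<ge>N. dist (f (regulator (polyline (\<delta> n) (Suc n) (\<lambda>i. Y n i \<omega>)))) (f (regulator (W \<omega>))) < e"
    proof (intro exI[of _ N] allI impI)
      fix n assume "N \<le> n"
      then have "\<delta> n \<le> 1 / real (Suc N)" by (simp add: \<delta>_def frac_le)
      with N have \<delta>d: "\<delta> n < d" "0 < \<delta> n" by (auto simp: \<delta>_def)
      have "\<bar>f (regulator (W \<omega>)) - f (regulator (polyline (\<delta> n) (Suc n) (\<lambda>i. Y n i \<omega>)))\<bar> \<le> 2 * (e / 4)"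
      proof (rule Lip1_regulator[OF f c[OF \<omega>] continuous_on_polyline])
        fix t :: real assume t: "t \<in> {0..1}"
        show "\<bar>W \<omega> t - polyline (\<delta> n) (Suc n) (\<lambda>i. Y n i \<omega>) t\<bar> \<le> 2 * (e / 4)"
          unfolding Y_def
        proof (rule polyline_interpolation_error)
          fix j t assume j: "j \<le> Suc n" "real j * \<delta> n \<le> t" "t \<le> (real j + 1) * \<delta> n" "t \<le> 1"
          then have 1: "t - real j * \<delta> n \<le> \<delta> n" by (simp add: algebra_simps)
          have 2: "0 \<le> real j * \<delta> n" using \<delta>d by simp
          have "dist (W \<omega> t) (W \<omega> (real j * \<delta> n)) < e / 4"
          proof (rule d(2))
            show "real j * \<delta> n \<in> {0..1}" "t \<in> {0..1}" using 2 j by auto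
            show "dist t (real j * \<delta> n) < d" using 1 2 j \<delta>d by (simp add: dist_real_def)
          qed
          then show "\<bar>W \<omega> t - W \<omega> (real j * \<delta> n)\<bar> \<le> e / 4" by (simp add: dist_real_def)
        next
          show "real (Suc n) * \<delta> n \<le> 1" "1 < (real (Suc n) + 1) * \<delta> n"
            by (auto simp: \<delta>_def field_simps)
        qed (use t W0[OF \<omega>] \<delta>d in auto)
      qed
      then show "dist (f (regulator (polyline (\<delta> n) (Suc n) (\<lambda>i. Y n i \<omega>)))) (f (regulator (W \<omega>))) < e"
        using \<open>0 < e\<close> by (simp add: dist_real_def abs_minus_commute)
    qed
  qed
qed

lemma walk_functional_measurable:
  assumes f: "f \<in> Lip1 C01" and m: "0 < m"
    and \<xi>: "\<And>k. k < m \<Longrightarrow> \<xi> k \<in> borel_measurable M"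
  shows "(\<lambda>\<omega>. f (regulator (scaled_walk m (\<lambda>k. \<xi> k \<omega>)))) \<in> borel_measurable M"
proof (rule regulator_functional_measurable[OF f])
  show "(\<lambda>\<omega>. scaled_walk m (\<lambda>k. \<xi> k \<omega>) t) \<in> borel_measurable M" for t
    unfolding scaled_walk_def using \<xi> by (intro borel_measurable_sum borel_measurable_times) auto
  show "continuous_on {0..1} (scaled_walk m (\<lambda>k. \<xi> k \<omega>))" for \<omega>
    by (rule continuous_on_scaled_walk[OF m])
  show "scaled_walk m (\<lambda>k. \<xi> k \<omega>) 0 = 0" for \<omega>
    using scaled_walk_grid[OF m, of 0] by simp
qed

section \<open>Oscillation of the random walk over blocks\<close>

text \<open>The bound $e^x \ge 1 + x$ at scale \<^term>\<open>b\<close> and level \<^term>\<open>a\<close>. With $a = \log n$ it bounds the maximum of $n$ variables by $b \log n$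
  plus $b$ times the mean of their exponentials. The expectation of a maximum
  thus follows from exponential moments alone.\<close>

lemma soft_max_bound:
  fixes x b a :: real
  assumes "0 < b"
  shows "x \<le> b * (a + exp (- a) * exp (x / b))"
proof -
  have "1 + (x / b - a) \<le> exp (x / b - a)" by (rule exp_ge_add_one_self)
  moreover have "exp (x / b - a) = exp (- a) * exp (x / b)" by (simp add: exp_add[symmetric])
  ultimately have "x / b \<le> a + exp (- a) * exp (x / b)" by linarith
  then have "b * (x / b) \<le> b * (a + exp (- a) * exp (x / b))"
    using assms by (intro mult_left_mono) auto
  then show ?thesis using assms by simp
qed

text \<open>Truncation at level \<^term>\<open>b\<close>, centred again.\<close>

definition truncate_centered :: "real measure \<Rightarrow> real \<Rightarrow> real \<Rightarrow> real" where
  "truncate_centered \<mu> b y = (if \<bar>y\<bar> \<le> b then y else 0) - (\<integral>z. (if \<bar>z\<bar> \<le> b then z else 0) \<partial>\<mu>)"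

text \<open>A third moment is not enough for exponential moments, so the steps are truncated. The third moment pays for
  the truncation: the expected error per step is of order $b^{-2}$. The truncated step has exponential
  moments at scale \<^term>\<open>b\<close>, and as its mean vanishes they exceed 1 by only $O(b^{-2})$, which can be
  multiplied over $b^2$ independent steps.\<close>

lemma truncation_bounds:
  assumes \<mu>: "has_mean \<mu>" "(\<integral>y. y \<partial>\<mu>) = 0" "integrable \<mu> (\<lambda>y. y\<^sup>2)" "(\<integral>y. y\<^sup>2 \<partial>\<mu>) = 1"
    "integrable \<mu> (\<lambda>y. \<bar>y\<bar> ^ 3)" and b: "0 < b"
  shows "truncate_centered \<mu> b \<in> borel_measurable borel" "\<bar>truncate_centered \<mu> b y\<bar> \<le> 2 * b"
    "integrable \<mu> (\<lambda>y. \<bar>y - truncate_centered \<mu> b y\<bar>)"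
    "(\<integral>y. \<bar>y - truncate_centered \<mu> b y\<bar> \<partial>\<mu>) \<le> 2 * (\<integral>y. \<bar>y\<bar> ^ 3 \<partial>\<mu>) / b\<^sup>2"
    "\<bar>c\<bar> = 1 / b \<Longrightarrow> integrable \<mu> (\<lambda>y. exp (c * truncate_centered \<mu> b y))"
    "\<bar>c\<bar> = 1 / b \<Longrightarrow> (\<integral>y. exp (c * truncate_centered \<mu> b y) \<partial>\<mu>) \<le> exp (exp 2 / b\<^sup>2)"
proof -
  interpret prob_space \<mu> using \<mu>(1) by (simp add: has_mean_def)
  note [measurable_cong] = \<mu>(1)[unfolded has_mean_def, THEN conjunct2, THEN conjunct1]
  have i1: "integrable \<mu> (\<lambda>y. y)" using \<mu>(1) by (simp add: has_mean_def)
  define g where "g = (\<lambda>y::real. if \<bar>y\<bar> \<le> b then y else 0)"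
  define a where "a = (\<integral>y. g y \<partial>\<mu>)"
  let ?\<beta> = "\<integral>y. \<bar>y\<bar> ^ 3 \<partial>\<mu>"
  have tr: "truncate_centered \<mu> b y = g y - a" for y by (simp add: truncate_centered_def g_def a_def)
  have gm [measurable]: "g \<in> borel_measurable borel" unfolding g_def by measurable
  show tm: "truncate_centered \<mu> b \<in> borel_measurable borel" unfolding tr[abs_def] by measurable
  have gb: "\<bar>g y\<bar> \<le> b" for y using b by (simp add: g_def)
  have ig: "integrable \<mu> g"
    by (rule integrable_const_bound[of _ b]) (use gb in \<open>auto\<close>)
  have "norm a \<le> (\<integral>y. b \<partial>\<mu>)" unfolding a_def
    by (rule Bochner_Integration.integral_norm_bound_integral) (use ig gb in auto)
  then have ab: "\<bar>a\<bar> \<le> b" by (simp add: prob_space)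
  show tb: "\<bar>truncate_centered \<mu> b y\<bar> \<le> 2 * b" for y using gb[of y] ab unfolding tr by linarith
  have it: "integrable \<mu> (truncate_centered \<mu> b)" unfolding tr[abs_def] using ig by simp
  show id: "integrable \<mu> (\<lambda>y. \<bar>y - truncate_centered \<mu> b y\<bar>)"
    using i1 it by simp
  have tail: "\<bar>y - g y\<bar> \<le> \<bar>y\<bar> ^ 3 / b\<^sup>2" for y
  proof (cases "\<bar>y\<bar> \<le> b")
    case False
    then have "b\<^sup>2 \<le> \<bar>y\<bar>\<^sup>2" using b by (intro power_mono) auto
    then have "\<bar>y\<bar> * b\<^sup>2 \<le> \<bar>y\<bar> * \<bar>y\<bar>\<^sup>2" by (rule mult_left_mono) simp
    then show ?thesis using b False by (simp add: g_def field_simps power3_eq_cube power2_eq_square)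
  qed (simp add: g_def)
  have itail: "integrable \<mu> (\<lambda>y. y - g y)" using i1 ig by simp
  have "norm (\<integral>y. y - g y \<partial>\<mu>) \<le> (\<integral>y. \<bar>y\<bar> ^ 3 / b\<^sup>2 \<partial>\<mu>)"
    by (rule Bochner_Integration.integral_norm_bound_integral) (use itail tail \<mu>(5) in auto)
  then have a2: "\<bar>a\<bar> \<le> ?\<beta> / b\<^sup>2"
    using i1 ig \<mu>(2) by (simp add: a_def)
  have "(\<integral>y. \<bar>y - truncate_centered \<mu> b y\<bar> \<partial>\<mu>) \<le> (\<integral>y. \<bar>y\<bar> ^ 3 / b\<^sup>2 + \<bar>a\<bar> \<partial>\<mu>)"
  proof (rule integral_mono[OF id])
    show "integrable \<mu> (\<lambda>y. \<bar>y\<bar> ^ 3 / b\<^sup>2 + \<bar>a\<bar>)" using \<mu>(5) by simp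
    show "\<bar>y - truncate_centered \<mu> b y\<bar> \<le> \<bar>y\<bar> ^ 3 / b\<^sup>2 + \<bar>a\<bar>" for y
      using tail[of y] unfolding tr by linarith
  qed
  also have "\<dots> \<le> 2 * ?\<beta> / b\<^sup>2" using a2 \<mu>(5) by (simp add: prob_space)
  finally show "(\<integral>y. \<bar>y - truncate_centered \<mu> b y\<bar> \<partial>\<mu>) \<le> 2 * ?\<beta> / b\<^sup>2" .
  assume c: "\<bar>c\<bar> = 1 / b"
  have cb: "\<bar>c * truncate_centered \<mu> b y\<bar> \<le> 2" for y
  proof -
    have "\<bar>c * truncate_centered \<mu> b y\<bar> \<le> 1 / b * (2 * b)"
      unfolding abs_mult c using tb b by (intro mult_left_mono) auto
    then show ?thesis using b by simp
  qed
  show ie: "integrable \<mu> (\<lambda>y. exp (c * truncate_centered \<mu> b y))"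
  proof (rule integrable_const_bound[of _ "exp 2"])
    show "AE y in \<mu>. norm (exp (c * truncate_centered \<mu> b y)) \<le> exp 2"
      using cb by (intro AE_I2) (simp add: abs_le_iff)
    show "(\<lambda>y. exp (c * truncate_centered \<mu> b y)) \<in> borel_measurable \<mu>" using tm by measurable
  qed
  have i2: "integrable \<mu> (\<lambda>y. (g y)\<^sup>2)"
  proof (rule integrable_const_bound[of _ "b\<^sup>2"])
    show "AE y in \<mu>. norm ((g y)\<^sup>2) \<le> b\<^sup>2"
      using gb b by (intro AE_I2) (simp add: abs_le_square_iff[symmetric])
  qed measurable
  have "(\<integral>y. (truncate_centered \<mu> b y)\<^sup>2 \<partial>\<mu>) = (\<integral>y. (g y)\<^sup>2 - 2 * a * g y + a\<^sup>2 \<partial>\<mu>)"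
    unfolding tr by (simp add: power2_diff algebra_simps)
  also have "\<dots> = (\<integral>y. (g y)\<^sup>2 \<partial>\<mu>) - a\<^sup>2"
    using i2 ig by (simp add: prob_space a_def[symmetric] power2_eq_square)
  also have "\<dots> \<le> (\<integral>y. (g y)\<^sup>2 \<partial>\<mu>)" by simp
  also have "\<dots> \<le> (\<integral>y. y\<^sup>2 \<partial>\<mu>)"
    using i2 \<mu>(3) by (intro integral_mono) (auto simp: g_def)
  finally have v: "(\<integral>y. (truncate_centered \<mu> b y)\<^sup>2 \<partial>\<mu>) \<le> 1" using \<mu>(4) by simp
  have it2: "integrable \<mu> (\<lambda>y. (truncate_centered \<mu> b y)\<^sup>2)"
    unfolding tr power2_diff using i2 ig by simp
  have "(\<integral>y. exp (c * truncate_centered \<mu> b y) \<partial>\<mu>)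
    \<le> (\<integral>y. 1 + c * truncate_centered \<mu> b y + exp 2 / b\<^sup>2 * (truncate_centered \<mu> b y)\<^sup>2 \<partial>\<mu>)"
  proof (rule integral_mono[OF ie])
    show "integrable \<mu> (\<lambda>y. 1 + c * truncate_centered \<mu> b y + exp 2 / b\<^sup>2 * (truncate_centered \<mu> b y)\<^sup>2)"
      using it it2 by simp
    fix y
    let ?z = "c * truncate_centered \<mu> b y"
    have "\<bar>exp (?z - 0) - 1 - ?z\<bar> \<le> exp \<bar>?z\<bar> * (?z\<^sup>2 + 0)"
      by (rule exp_perturbed_linear_error) simp
    then have "exp ?z \<le> 1 + ?z + exp \<bar>?z\<bar> * ?z\<^sup>2" by (simp add: abs_le_iff)
    also have "exp \<bar>?z\<bar> * ?z\<^sup>2 \<le> exp 2 * ?z\<^sup>2"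
      using cb[of y] by (intro mult_right_mono) auto
    also have "?z\<^sup>2 = (truncate_centered \<mu> b y)\<^sup>2 / b\<^sup>2"
      by (metis c power2_abs power_mult_distrib power_one_over mult.commute divide_inverse inverse_eq_divide)
    finally show "exp ?z \<le> 1 + ?z + exp 2 / b\<^sup>2 * (truncate_centered \<mu> b y)\<^sup>2" by simp
  qed
  also have "\<dots> = 1 + c * (\<integral>y. truncate_centered \<mu> b y \<partial>\<mu>) + exp 2 / b\<^sup>2 * (\<integral>y. (truncate_centered \<mu> b y)\<^sup>2 \<partial>\<mu>)"
    using it it2 by (simp add: prob_space)
  also have "(\<integral>y. truncate_centered \<mu> b y \<partial>\<mu>) = 0"
    unfolding tr using ig by (simp add: prob_space a_def)
  also have "1 + c * 0 + exp 2 / b\<^sup>2 * (\<integral>y. (truncate_centered \<mu> b y)\<^sup>2 \<partial>\<mu>) \<le> 1 + exp 2 / b\<^sup>2 * 1"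
    using v by (simp add: divide_right_mono)
  also have "\<dots> \<le> exp (exp 2 / b\<^sup>2)"
    using exp_ge_add_one_self[of "exp 2 / b\<^sup>2"] by simp
  finally show "(\<integral>y. exp (c * truncate_centered \<mu> b y) \<partial>\<mu>) \<le> exp (exp 2 / b\<^sup>2)" .
qed

text \<open>A block of at most $b^2$ truncated steps has exponential moments at scale \<^term>\<open>b\<close> that are bounded by an
  absolute constant.\<close>

lemma (in prob_space) truncated_sum_exponential_moment:
  fixes \<xi> :: "nat \<Rightarrow> 'a \<Rightarrow> real"
  assumes \<mu>: "has_mean \<mu>" "(\<integral>y. y \<partial>\<mu>) = 0" "integrable \<mu> (\<lambda>y. y\<^sup>2)" "(\<integral>y. y\<^sup>2 \<partial>\<mu>) = 1"
    "integrable \<mu> (\<lambda>y. \<bar>y\<bar> ^ 3)" and b: "0 < b"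
    and I: "finite I" "real (card I) \<le> b\<^sup>2"
    and ind: "indep_vars (\<lambda>_. borel) \<xi> I" and law: "\<And>k. k \<in> I \<Longrightarrow> distr M borel (\<xi> k) = \<mu>"
  shows "integrable M (\<lambda>\<omega>. exp (\<bar>\<Sum>k\<in>I. truncate_centered \<mu> b (\<xi> k \<omega>)\<bar> / b))"
    "expectation (\<lambda>\<omega>. exp (\<bar>\<Sum>k\<in>I. truncate_centered \<mu> b (\<xi> k \<omega>)\<bar> / b)) \<le> 2 * exp (exp 2)"
proof -
  note tp = truncation_bounds[OF \<mu> b]
  note [measurable] = tp(1)
  have rv [measurable]: "k \<in> I \<Longrightarrow> \<xi> k \<in> borel_measurable M" for k
    using ind by (auto simp: indep_vars_def)
  let ?S = "\<lambda>\<omega>. \<Sum>k\<in>I. truncate_centered \<mu> b (\<xi> k \<omega>)"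
  have signed: "integrable M (\<lambda>\<omega>. exp (c * ?S \<omega>)) \<and> expectation (\<lambda>\<omega>. exp (c * ?S \<omega>)) \<le> exp (exp 2)"
    if c: "\<bar>c\<bar> = 1 / b" for c
  proof -
    have eq: "exp (c * ?S \<omega>) = (\<Prod>k\<in>I. exp (c * truncate_centered \<mu> b (\<xi> k \<omega>)))" for \<omega>
      using I(1) by (simp add: sum_distrib_left exp_sum)
    have ind2: "indep_vars (\<lambda>_. borel) (\<lambda>k \<omega>. exp (c * truncate_centered \<mu> b (\<xi> k \<omega>))) I"
      by (rule indep_vars_compose2[OF ind, where Y = "\<lambda>_ x. exp (c * truncate_centered \<mu> b x)"]) measurable
    have ik: "integrable M (\<lambda>\<omega>. exp (c * truncate_centered \<mu> b (\<xi> k \<omega>)))"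
      "expectation (\<lambda>\<omega>. exp (c * truncate_centered \<mu> b (\<xi> k \<omega>))) \<le> exp (exp 2 / b\<^sup>2)" if "k \<in> I" for k
    proof -
      have m: "(\<lambda>y. exp (c * truncate_centered \<mu> b y)) \<in> borel_measurable borel" by measurable
      have l: "integrable (distr M borel (\<xi> k)) (\<lambda>y. exp (c * truncate_centered \<mu> b y))"
        "(\<integral>y. exp (c * truncate_centered \<mu> b y) \<partial>distr M borel (\<xi> k)) \<le> exp (exp 2 / b\<^sup>2)"
        using tp(5,6)[OF c] law[OF that] by simp_all
      show "integrable M (\<lambda>\<omega>. exp (c * truncate_centered \<mu> b (\<xi> k \<omega>)))"
        "expectation (\<lambda>\<omega>. exp (c * truncate_centered \<mu> b (\<xi> k \<omega>))) \<le> exp (exp 2 / b\<^sup>2)"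
        using l integrable_distr_eq[OF rv[OF that] m] integral_distr[OF rv[OF that] m] by simp_all
    qed
    have "integrable M (\<lambda>\<omega>. exp (c * ?S \<omega>))"
      unfolding eq by (rule indep_vars_integrable[OF I(1) ind2 ik(1)])
    moreover have "expectation (\<lambda>\<omega>. exp (c * ?S \<omega>)) \<le> exp (exp 2)"
    proof -
      have "expectation (\<lambda>\<omega>. exp (c * ?S \<omega>)) = (\<Prod>k\<in>I. expectation (\<lambda>\<omega>. exp (c * truncate_centered \<mu> b (\<xi> k \<omega>))))"
        unfolding eq by (rule indep_vars_lebesgue_integral[OF I(1) ind2 ik(1)])
      also have "\<dots> \<le> (\<Prod>k\<in>I. exp (exp 2 / b\<^sup>2))"
        using ik(2) by (intro prod_mono) auto
      also have "\<dots> = exp (real (card I) / b\<^sup>2 * exp 2)"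
        by (simp add: exp_of_nat_mult[symmetric])
      also have "\<dots> \<le> exp (1 * exp 2)"
      proof -
        have "real (card I) / b\<^sup>2 \<le> 1" using I(2) b by simp
        then have "real (card I) / b\<^sup>2 * exp 2 \<le> 1 * exp 2" by (rule mult_right_mono) simp
        then show ?thesis by simp
      qed
      finally show ?thesis by simp
    qed
    ultimately show ?thesis by blast
  qed
  have s1: "integrable M (\<lambda>\<omega>. exp (1 / b * ?S \<omega>))" "expectation (\<lambda>\<omega>. exp (1 / b * ?S \<omega>)) \<le> exp (exp 2)"
    and s2: "integrable M (\<lambda>\<omega>. exp (- (1 / b) * ?S \<omega>))" "expectation (\<lambda>\<omega>. exp (- (1 / b) * ?S \<omega>)) \<le> exp (exp 2)"
    using signed[of "1 / b"] signed[of "- (1 / b)"] b by auto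
  have le: "exp (\<bar>?S \<omega>\<bar> / b) \<le> exp (1 / b * ?S \<omega>) + exp (- (1 / b) * ?S \<omega>)" for \<omega>
    by (cases "0 \<le> ?S \<omega>") (auto simp: abs_of_nonneg abs_of_neg)
  have i: "integrable M (\<lambda>\<omega>. exp (1 / b * ?S \<omega>) + exp (- (1 / b) * ?S \<omega>))"
    by (intro Bochner_Integration.integrable_add s1 s2)
  show i2: "integrable M (\<lambda>\<omega>. exp (\<bar>?S \<omega>\<bar> / b))"
  proof (rule Bochner_Integration.integrable_bound[OF i])
    show "AE \<omega> in M. norm (exp (\<bar>?S \<omega>\<bar> / b)) \<le> norm (exp (1 / b * ?S \<omega>) + exp (- (1 / b) * ?S \<omega>))"
      using order_trans[OF le abs_ge_self] by (intro AE_I2) simp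
  qed measurable
  have "expectation (\<lambda>\<omega>. exp (\<bar>?S \<omega>\<bar> / b)) \<le> expectation (\<lambda>\<omega>. exp (1 / b * ?S \<omega>) + exp (- (1 / b) * ?S \<omega>))"
    by (rule integral_mono[OF i2 i le])
  also have "\<dots> = expectation (\<lambda>\<omega>. exp (1 / b * ?S \<omega>)) + expectation (\<lambda>\<omega>. exp (- (1 / b) * ?S \<omega>))"
    by (rule Bochner_Integration.integral_add[OF s1(1) s2(1)])
  also have "\<dots> \<le> 2 * exp (exp 2)" using s1(2) s2(2) by simp
  finally show "expectation (\<lambda>\<omega>. exp (\<bar>?S \<omega>\<bar> / b)) \<le> 2 * exp (exp 2)" .
qed

text \<open>Between two grid points the walk is a convex combination of the values at them, so its oscillation over a
  block is controlled by the partial sums inside the block. Such a sum is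
  indexed by its last step \<^term>\<open>i\<close>, whose block starts at step \<^term>\<open>K * (i div K)\<close>.\<close>

lemma scaled_walk_oscillation:
  assumes K: "0 < K" and m: "0 < m"
    and e: "0 \<le> e" "\<And>i. i < m \<Longrightarrow> \<bar>\<Sum>k\<in>{K * (i div K)..i}. x k\<bar> \<le> e"
    and t: "real j * (real K / real m) \<le> t" "t \<le> (real j + 1) * (real K / real m)" "t \<le> 1"
  shows "\<bar>scaled_walk m x t - scaled_walk m x (real j * (real K / real m))\<bar> \<le> e / sqrt (real m)"
proof (cases "t = real j * (real K / real m)")
  case True
  then show ?thesis using e(1) by simp
next
  case False
  have r: "0 < real m" using m by simp
  \<comment> \<open>rounding up keeps \<^term>\<open>i\<close> inside the block even at its right end point, and \<^term>\<open>i < m\<close> at time 1\<close>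
  define i where "i = nat (\<lceil>t * real m\<rceil> - 1)"
  have tj: "real (j * K) < t * real m"
    using t(1) False r by (simp add: field_simps)
  then have "0 < t * real m" using of_nat_0_le_iff[of "j * K"] by linarith
  then have "0 < \<lceil>t * real m\<rceil>" by simp
  then have i: "real i < t * real m" "t * real m \<le> real i + 1"
    unfolding i_def by (simp_all add: of_nat_diff) linarith+
  have "t * real m \<le> real m" using t(3) r by (simp add: mult_left_le_one_le)
  then have im: "i < m" using i by linarith
  have "real (j * K) < real (i + 1)" using tj i by simp
  then have ji: "j * K \<le> i" by linarith
  have "t * real m \<le> real ((j + 1) * K)"
    using t(2) r by (simp add: field_simps)
  then have "real i < real ((j + 1) * K)" using i by linarith
  then have ij: "i < (j + 1) * K" by linarith
  have divK: "l div K = j" if "j * K \<le> l" "l \<le> i" for l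
    using that ij K by (intro div_nat_eqI) (auto simp: algebra_simps)
  define \<theta> where "\<theta> = t * real m - real i"
  have \<theta>: "0 \<le> \<theta>" "\<theta> \<le> 1" using i by (auto simp: \<theta>_def)
  have jm: "j * K < m" using ji im by simp
  have w1: "scaled_walk m x t = ((\<Sum>k<i. x k) + x i * \<theta>) / sqrt (real m)"
    unfolding \<theta>_def using im i r by (intro scaled_walk_at) (simp_all add: field_simps)
  have w2: "scaled_walk m x (real j * (real K / real m)) = (\<Sum>k<j * K. x k) / sqrt (real m)"
    using scaled_walk_at[of "j * K" m "real j * (real K / real m)" x] jm r by (simp add: field_simps)
  have split: "{..<i} = {..<j * K} \<union> {j * K..<i}" using ji by auto
  have s1: "(\<Sum>k<i. x k) = (\<Sum>k<j * K. x k) + (\<Sum>k\<in>{j * K..<i}. x k)"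
    unfolding split by (rule sum.union_disjoint) auto
  have s2: "(\<Sum>k\<in>{j * K..i}. x k) = (\<Sum>k\<in>{j * K..<i}. x k) + x i"
    using ji by (simp add: atLeastLessThanSuc_atLeastAtMost[symmetric] del: )
  have P: "\<bar>\<Sum>k\<in>{j * K..i}. x k\<bar> \<le> e"
    using e(2)[OF im] divK[OF ji] by (simp add: mult.commute)
  have R: "\<bar>\<Sum>k\<in>{j * K..<i}. x k\<bar> \<le> e"
  proof (cases "i = j * K")
    case True
    then show ?thesis using e(1) by simp
  next
    case False
    then have "j * K \<le> i - 1" "i - 1 < m" "0 < i" using ji im by auto
    then have "\<bar>\<Sum>k\<in>{j * K..i - 1}. x k\<bar> \<le> e"
      using e(2)[of "i - 1"] divK[of "i - 1"] by (simp add: mult.commute)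
    moreover have "{j * K..i - 1} = {j * K..<i}" using \<open>0 < i\<close> by auto
    ultimately show ?thesis by simp
  qed
  have "scaled_walk m x t - scaled_walk m x (real j * (real K / real m))
      = ((1 - \<theta>) * (\<Sum>k\<in>{j * K..<i}. x k) + \<theta> * (\<Sum>k\<in>{j * K..i}. x k)) / sqrt (real m)"
    unfolding w1 w2 s1 s2 by (simp add: diff_divide_distrib[symmetric] algebra_simps)
  also have "\<bar>\<dots>\<bar> = \<bar>(1 - \<theta>) * (\<Sum>k\<in>{j * K..<i}. x k) + \<theta> * (\<Sum>k\<in>{j * K..i}. x k)\<bar> / sqrt (real m)"
    by simp
  also have "\<dots> \<le> ((1 - \<theta>) * e + \<theta> * e) / sqrt (real m)"
  proof (rule divide_right_mono)
    have "\<bar>(1 - \<theta>) * (\<Sum>k\<in>{j * K..<i}. x k)\<bar> \<le> (1 - \<theta>) * e"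
      using R \<theta> by (simp add: abs_mult mult_left_mono)
    moreover have "\<bar>\<theta> * (\<Sum>k\<in>{j * K..i}. x k)\<bar> \<le> \<theta> * e"
      using P \<theta> by (simp add: abs_mult mult_left_mono)
    ultimately show "\<bar>(1 - \<theta>) * (\<Sum>k\<in>{j * K..<i}. x k) + \<theta> * (\<Sum>k\<in>{j * K..i}. x k)\<bar>
      \<le> (1 - \<theta>) * e + \<theta> * e" by linarith
  qed simp
  also have "(1 - \<theta>) * e + \<theta> * e = e" by (simp add: algebra_simps)
  finally show ?thesis .
qed

text \<open>A union bound over all $m$ partial sums, through their exponential moments. It costs
  a factor of order $\log m$, which the convergence rate contains anyway. The last
  summand in the bound is the truncation error added up over all steps.\<close>

lemma (in prob_space) walk_oscillation_expectation:
  fixes \<xi> :: "nat \<Rightarrow> 'a \<Rightarrow> real"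
  assumes \<mu>: "has_mean \<mu>" "(\<integral>y. y \<partial>\<mu>) = 0" "integrable \<mu> (\<lambda>y. y\<^sup>2)" "(\<integral>y. y\<^sup>2 \<partial>\<mu>) = 1"
    "integrable \<mu> (\<lambda>y. \<bar>y\<bar> ^ 3)" and b: "0 < b" and K: "real K = b\<^sup>2" and m: "1 \<le> m"
    and ind: "indep_vars (\<lambda>_. borel) \<xi> {..<m}" and law: "\<And>k. k < m \<Longrightarrow> distr M borel (\<xi> k) = \<mu>"
  obtains H where "integrable M H"
    "expectation H \<le> b * (ln (real m) + 2 * exp (exp 2)) + real m * (2 * (\<integral>y. \<bar>y\<bar> ^ 3 \<partial>\<mu>) / b\<^sup>2)"
    "\<And>\<omega>. 0 \<le> H \<omega>"
    "\<And>\<omega> i. i < m \<Longrightarrow> \<bar>\<Sum>k\<in>{K * (i div K)..i}. \<xi> k \<omega>\<bar> \<le> H \<omega>"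
proof
  note tp = truncation_bounds[OF \<mu> b]
  let ?\<beta> = "\<integral>y. \<bar>y\<bar> ^ 3 \<partial>\<mu>"
  have rv: "\<xi> k \<in> borel_measurable M" if "k < m" for k
    using ind that by (auto simp: indep_vars_def)
  have "0 < real K" using K b by simp
  then have K0: "0 < K" by simp
  define J where "J i = {K * (i div K)..i}" for i
  have J: "finite (J i)" "real (card (J i)) \<le> b\<^sup>2" "i < m \<Longrightarrow> J i \<subseteq> {..<m}" for i
  proof -
    have "i < K + K * (i div K)" using dividend_less_times_div[OF K0, of i] by simp
    then have "card (J i) \<le> K" by (simp add: J_def)
    then show "real (card (J i)) \<le> b\<^sup>2" using K by (metis of_nat_le_iff)
  qed (auto simp: J_def)
  define Q where "Q i \<omega> = (\<Sum>k\<in>J i. truncate_centered \<mu> b (\<xi> k \<omega>))" for i \<omega>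
  have Q: "integrable M (\<lambda>\<omega>. exp (\<bar>Q i \<omega>\<bar> / b))" "expectation (\<lambda>\<omega>. exp (\<bar>Q i \<omega>\<bar> / b)) \<le> 2 * exp (exp 2)"
    if "i < m" for i
    unfolding Q_def
    using truncated_sum_exponential_moment[OF \<mu> b J(1,2) indep_vars_subset[OF ind J(3)[OF that]] law] J(3)[OF that]
    by auto
  have err: "integrable M (\<lambda>\<omega>. \<bar>\<xi> k \<omega> - truncate_centered \<mu> b (\<xi> k \<omega>)\<bar>)"
    "expectation (\<lambda>\<omega>. \<bar>\<xi> k \<omega> - truncate_centered \<mu> b (\<xi> k \<omega>)\<bar>) \<le> 2 * ?\<beta> / b\<^sup>2" if "k < m" for k
  proof -
    have me: "(\<lambda>y. \<bar>y - truncate_centered \<mu> b y\<bar>) \<in> borel_measurable borel" using tp(1) by measurable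
    have l: "integrable (distr M borel (\<xi> k)) (\<lambda>y. \<bar>y - truncate_centered \<mu> b y\<bar>)"
      "(\<integral>y. \<bar>y - truncate_centered \<mu> b y\<bar> \<partial>distr M borel (\<xi> k)) \<le> 2 * ?\<beta> / b\<^sup>2"
      using tp(3,4) law[OF that] by simp_all
    show "integrable M (\<lambda>\<omega>. \<bar>\<xi> k \<omega> - truncate_centered \<mu> b (\<xi> k \<omega>)\<bar>)"
      "expectation (\<lambda>\<omega>. \<bar>\<xi> k \<omega> - truncate_centered \<mu> b (\<xi> k \<omega>)\<bar>) \<le> 2 * ?\<beta> / b\<^sup>2"
      using l integrable_distr_eq[OF rv[OF that] me] integral_distr[OF rv[OF that] me] by simp_all
  qed
  define H where "H \<omega> = b * (ln (real m) + 1 / real m * (\<Sum>i<m. exp (\<bar>Q i \<omega>\<bar> / b)))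
    + (\<Sum>k<m. \<bar>\<xi> k \<omega> - truncate_centered \<mu> b (\<xi> k \<omega>)\<bar>)" for \<omega>
  have iQ: "integrable M (\<lambda>\<omega>. \<Sum>i<m. exp (\<bar>Q i \<omega>\<bar> / b))"
    using Q(1) by (intro Bochner_Integration.integrable_sum) auto
  have iE: "integrable M (\<lambda>\<omega>. \<Sum>k<m. \<bar>\<xi> k \<omega> - truncate_centered \<mu> b (\<xi> k \<omega>)\<bar>)"
    using err(1) by (intro Bochner_Integration.integrable_sum) auto
  show "integrable M H" unfolding H_def[abs_def] using iQ iE by simp
  have lnm: "0 \<le> ln (real m)" using m by simp
  show "0 \<le> H \<omega>" for \<omega>
    unfolding H_def using b lnm by (intro add_nonneg_nonneg mult_nonneg_nonneg sum_nonneg) auto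
  have "expectation H = b * (ln (real m) + 1 / real m * (\<Sum>i<m. expectation (\<lambda>\<omega>. exp (\<bar>Q i \<omega>\<bar> / b))))
    + (\<Sum>k<m. expectation (\<lambda>\<omega>. \<bar>\<xi> k \<omega> - truncate_centered \<mu> b (\<xi> k \<omega>)\<bar>))"
    unfolding H_def[abs_def] using iQ iE Q(1) err(1)
    by (simp add: prob_space Bochner_Integration.integral_sum)
  also have "\<dots> \<le> b * (ln (real m) + 1 / real m * (\<Sum>i<m. 2 * exp (exp 2))) + (\<Sum>k<m. 2 * ?\<beta> / b\<^sup>2)"
    using Q(2) err(2) b by (intro add_mono mult_left_mono sum_mono) auto
  also have "\<dots> = b * (ln (real m) + 2 * exp (exp 2)) + real m * (2 * ?\<beta> / b\<^sup>2)"
    using m by simp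
  finally show "expectation H \<le> b * (ln (real m) + 2 * exp (exp 2)) + real m * (2 * ?\<beta> / b\<^sup>2)" .
  fix \<omega> i assume i: "i < m"
  have "\<bar>Q i \<omega>\<bar> \<le> b * (ln (real m) + exp (- ln (real m)) * exp (\<bar>Q i \<omega>\<bar> / b))"
    by (rule soft_max_bound[OF b])
  also have "exp (- ln (real m)) = 1 / real m" using m by (simp add: exp_minus field_simps)
  also have "b * (ln (real m) + 1 / real m * exp (\<bar>Q i \<omega>\<bar> / b))
      \<le> b * (ln (real m) + 1 / real m * (\<Sum>i<m. exp (\<bar>Q i \<omega>\<bar> / b)))"
    using i b by (intro mult_left_mono add_left_mono member_le_sum) auto
  finally have q: "\<bar>Q i \<omega>\<bar> \<le> b * (ln (real m) + 1 / real m * (\<Sum>i<m. exp (\<bar>Q i \<omega>\<bar> / b)))" .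
  have "\<bar>(\<Sum>k\<in>J i. \<xi> k \<omega>) - Q i \<omega>\<bar> = \<bar>\<Sum>k\<in>J i. \<xi> k \<omega> - truncate_centered \<mu> b (\<xi> k \<omega>)\<bar>"
    by (simp add: Q_def sum_subtractf)
  also have "\<dots> \<le> (\<Sum>k\<in>J i. \<bar>\<xi> k \<omega> - truncate_centered \<mu> b (\<xi> k \<omega>)\<bar>)" by (rule sum_abs)
  also have "\<dots> \<le> (\<Sum>k<m. \<bar>\<xi> k \<omega> - truncate_centered \<mu> b (\<xi> k \<omega>)\<bar>)"
    using J(3)[OF i] by (intro sum_mono2) auto
  finally have "\<bar>\<Sum>k\<in>J i. \<xi> k \<omega>\<bar> \<le> H \<omega>" using q unfolding H_def by linarith
  then show "\<bar>\<Sum>k\<in>{K * (i div K)..i}. \<xi> k \<omega>\<bar> \<le> H \<omega>" by (simp add: J_def)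
qed

text \<open>Integrability of \<^term>\<open>g\<close> is part of what is proved: its distance to an integrable function is dominated.
  The extended real bound fits the dominating series that comes from chaining, which may be
  infinite at some points.\<close>

lemma expectation_close:
  fixes g g' :: "'a \<Rightarrow> real"
  assumes "g \<in> borel_measurable M" "integrable M g'" "0 \<le> c"
    and "\<And>\<omega>. \<omega> \<in> space M \<Longrightarrow> ennreal \<bar>g \<omega> - g' \<omega>\<bar> \<le> h \<omega>" "(\<integral>\<^sup>+\<omega>. h \<omega> \<partial>M) \<le> ennreal c"
  shows "\<bar>integral\<^sup>L M g - integral\<^sup>L M g'\<bar> \<le> c"
proof -
  have [measurable]: "g \<in> borel_measurable M" "g' \<in> borel_measurable M" using assms by auto
  have le: "(\<integral>\<^sup>+\<omega>. ennreal (norm (g \<omega> - g' \<omega>)) \<partial>M) \<le> ennreal c"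
  proof -
    have "(\<integral>\<^sup>+\<omega>. ennreal (norm (g \<omega> - g' \<omega>)) \<partial>M) \<le> (\<integral>\<^sup>+\<omega>. h \<omega> \<partial>M)"
      using assms(4) by (intro nn_integral_mono) simp
    then show ?thesis using assms(5) by (rule order_trans)
  qed
  have i: "integrable M (\<lambda>\<omega>. g \<omega> - g' \<omega>)"
    by (rule integrableI_bounded) (use le in \<open>auto simp: order_le_less_trans ennreal_less_top\<close>)
  have "integrable M (\<lambda>\<omega>. (g \<omega> - g' \<omega>) + g' \<omega>)"
    by (rule Bochner_Integration.integrable_add[OF i assms(2)])
  then have ig: "integrable M g" by simp
  have "\<bar>\<integral>\<omega>. g \<omega> - g' \<omega> \<partial>M\<bar> \<le> (\<integral>\<omega>. \<bar>g \<omega> - g' \<omega>\<bar> \<partial>M)" by (rule integral_abs_bound)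
  also have "\<dots> \<le> c"
  proof -
    have "ennreal (\<integral>\<omega>. \<bar>g \<omega> - g' \<omega>\<bar> \<partial>M) = (\<integral>\<^sup>+\<omega>. ennreal \<bar>g \<omega> - g' \<omega>\<bar> \<partial>M)"
      using i by (intro nn_integral_eq_integral[symmetric]) auto
    also have "\<dots> \<le> ennreal c" using le by simp
    finally show ?thesis using assms(3) by simp
  qed
  finally show ?thesis using ig assms(2) by simp
qed

text \<open>Only the increments of the walk over blocks of \<^term>\<open>K\<close> steps matter, up to the oscillation over blocks.
  The block increments are independent and identically distributed. An incomplete last block is
  covered by the oscillation bound as well.\<close>

lemma (in prob_space) walk_block_replacement:
  fixes \<xi> :: "nat \<Rightarrow> 'a \<Rightarrow> real"
  assumes \<mu>: "has_mean \<mu>" "(\<integral>y. y \<partial>\<mu>) = 0" "integrable \<mu> (\<lambda>y. y\<^sup>2)" "(\<integral>y. y\<^sup>2 \<partial>\<mu>) = 1"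
    "integrable \<mu> (\<lambda>y. \<bar>y\<bar> ^ 3)" and b: "0 < b" and K: "real K = b\<^sup>2" and m: "1 \<le> m"
    and ind: "indep_vars (\<lambda>_. borel) \<xi> {..<m}" and law: "\<And>k. k < m \<Longrightarrow> distr M borel (\<xi> k) = \<mu>"
    and f: "f \<in> Lip1 C01"
  shows "\<bar>expectation (\<lambda>\<omega>. f (regulator (scaled_walk m (\<lambda>k. \<xi> k \<omega>))))
      - (\<integral>y. f (regulator (polyline (real K / real m) (m div K) y)) \<partial>PiM {..<m div K} (\<lambda>_. rescaled_conv_power \<mu> m K))\<bar>
    \<le> 2 * (b * (ln (real m) + 2 * exp (exp 2)) + real m * (2 * (\<integral>y. \<bar>y\<bar> ^ 3 \<partial>\<mu>) / b\<^sup>2)) / sqrt (real m)"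
proof -
  define n where "n = m div K"
  define \<delta> where "\<delta> = real K / real m"
  have "0 < real K" using K b by simp
  then have K0: "0 < K" by simp
  have m0: "0 < m" "0 < real m" using m by auto
  have \<delta>: "0 < \<delta>" using K0 m0 by (simp add: \<delta>_def)
  have nK: "n * K \<le> m" "m < (n + 1) * K"
    using K0 dividend_less_div_times[OF K0, of m] by (simp_all add: n_def div_times_less_eq_dividend)
  have grid: "real i * \<delta> = real (i * K) / real m" for i by (simp add: \<delta>_def)
  have n\<delta>: "real n * \<delta> \<le> 1" "1 < (real n + 1) * \<delta>"
  proof -
    show "real n * \<delta> \<le> 1" unfolding grid using nK(1) m0 by (simp only: divide_le_eq_1_pos of_nat_le_iff)
    have "real m < real ((n + 1) * K)" using nK(2) by (simp only: of_nat_less_iff)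
    then have "1 < real ((n + 1) * K) / real m" using m0 by (simp only: less_divide_eq_1_pos)
    then show "1 < (real n + 1) * \<delta>" unfolding grid[symmetric] by (simp add: add.commute)
  qed
  have rv: "\<xi> k \<in> borel_measurable M" if "k < m" for k
    using ind that by (auto simp: indep_vars_def)
  define Y where "Y i \<omega> = (\<Sum>k\<in>{i * K..<Suc i * K}. \<xi> k \<omega>) / sqrt (real m)" for i \<omega>
  define F where "F y = f (regulator (polyline \<delta> n y))" for y
  have F: "coord_lipschitz n 1 F" unfolding F_def[abs_def] by (rule coord_lipschitz_regulator[OF f])
  have blk: "{i * K..<Suc i * K} \<subseteq> {..<m}" if "i < n" for i
  proof -
    have "Suc i * K \<le> n * K" using that by (intro mult_right_mono) auto
    then have "Suc i * K \<le> m" using nK(1) by linarith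
    then show ?thesis by auto
  qed
  have Yind: "indep_vars (\<lambda>_. borel) Y {..<n}"
  proof -
    have "indep_vars (\<lambda>i. PiM {i * K..<Suc i * K} (\<lambda>_. borel)) (\<lambda>i \<omega>. restrict (\<lambda>k. \<xi> k \<omega>) {i * K..<Suc i * K}) {..<n}"
    proof (rule indep_vars_restrict[OF ind])
      show "disjoint_family_on (\<lambda>i. {i * K..<Suc i * K}) {..<n}"
        unfolding disjoint_family_on_def
      proof (intro ballI impI)
        fix i j :: nat assume "i \<noteq> j"
        then consider "Suc i \<le> j" | "Suc j \<le> i" by linarith
        then show "{i * K..<Suc i * K} \<inter> {j * K..<Suc j * K} = {}"
        proof cases
          case 1
          then have "Suc i * K \<le> j * K" by (rule mult_le_mono1)
          then show ?thesis by auto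
        next
          case 2
          then have "Suc j * K \<le> i * K" by (rule mult_le_mono1)
          then show ?thesis by auto
        qed
      qed
    qed (use blk in auto)
    then have "indep_vars (\<lambda>_. borel) (\<lambda>i \<omega>. (\<lambda>y. (\<Sum>k\<in>{i * K..<Suc i * K}. y k) / sqrt (real m))
        (restrict (\<lambda>k. \<xi> k \<omega>) {i * K..<Suc i * K})) {..<n}"
      by (rule indep_vars_compose2) measurable
    then show ?thesis by (simp add: Y_def[abs_def])
  qed
  have Ylaw: "distr M borel (Y i) = rescaled_conv_power \<mu> m K" if "i < n" for i
  proof -
    have [measurable]: "(\<lambda>\<omega>. \<Sum>k\<in>{i * K..<Suc i * K}. \<xi> k \<omega>) \<in> borel_measurable M"
      using blk[OF that] rv by (intro borel_measurable_sum) auto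
    have "distr M borel (\<lambda>\<omega>. \<Sum>k\<in>{i * K..<Suc i * K}. \<xi> k \<omega>) = conv_power \<mu> (card {i * K..<Suc i * K})"
      using blk[OF that] law by (intro distr_iid_sum indep_vars_subset[OF ind]) auto
    also have "card {i * K..<Suc i * K} = K" by simp
    finally have "rescaled_conv_power \<mu> m K
      = distr (distr M borel (\<lambda>\<omega>. \<Sum>k\<in>{i * K..<Suc i * K}. \<xi> k \<omega>)) borel (\<lambda>x. x / sqrt (real m))"
      unfolding rescaled_conv_power_def by (simp only:)
    also have "\<dots> = distr M borel ((\<lambda>x. x / sqrt (real m)) \<circ> (\<lambda>\<omega>. \<Sum>k\<in>{i * K..<Suc i * K}. \<xi> k \<omega>))"
      by (rule distr_distr) measurable
    also have "\<dots> = distr M borel (Y i)" by (simp only: Y_def[abs_def] comp_def)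
    finally show ?thesis by (rule sym)
  qed
  have EF: "expectation (\<lambda>\<omega>. F (\<lambda>i. Y i \<omega>)) = integral\<^sup>L (PiM {..<n} (\<lambda>_. rescaled_conv_power \<mu> m K)) F"
    "integrable M (\<lambda>\<omega>. F (\<lambda>i. Y i \<omega>))"
    by (rule expectation_iid[OF has_mean_rescaled_conv_power[OF \<mu>(1)] F Yind], rule Ylaw, assumption)+
  obtain H where H: "integrable M H"
    "expectation H \<le> b * (ln (real m) + 2 * exp (exp 2)) + real m * (2 * (\<integral>y. \<bar>y\<bar> ^ 3 \<partial>\<mu>) / b\<^sup>2)"
    "\<And>\<omega>. 0 \<le> H \<omega>"
    "\<And>\<omega> i. i < m \<Longrightarrow> \<bar>\<Sum>k\<in>{K * (i div K)..i}. \<xi> k \<omega>\<bar> \<le> H \<omega>"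
    using walk_oscillation_expectation[OF \<mu> b K m ind law] by blast
  let ?c = "2 * (b * (ln (real m) + 2 * exp (exp 2)) + real m * (2 * (\<integral>y. \<bar>y\<bar> ^ 3 \<partial>\<mu>) / b\<^sup>2)) / sqrt (real m)"
  have EH0: "0 \<le> expectation H" using H(3) by (rule Bochner_Integration.integral_nonneg)
  have "\<bar>expectation (\<lambda>\<omega>. f (regulator (scaled_walk m (\<lambda>k. \<xi> k \<omega>)))) - expectation (\<lambda>\<omega>. F (\<lambda>i. Y i \<omega>))\<bar> \<le> ?c"
  proof (rule expectation_close[where h = "\<lambda>\<omega>. ennreal (2 * (H \<omega> / sqrt (real m)))"])
    show "(\<lambda>\<omega>. f (regulator (scaled_walk m (\<lambda>k. \<xi> k \<omega>)))) \<in> borel_measurable M"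
      by (rule walk_functional_measurable[OF f m0(1) rv])
    show "integrable M (\<lambda>\<omega>. F (\<lambda>i. Y i \<omega>))" by (rule EF(2))
    show "0 \<le> ?c" using EH0 H(2) by simp
    have "(\<integral>\<^sup>+\<omega>. ennreal (2 * (H \<omega> / sqrt (real m))) \<partial>M) = ennreal (expectation (\<lambda>\<omega>. 2 * (H \<omega> / sqrt (real m))))"
      using H(1,3) by (intro nn_integral_eq_integral) auto
    also have "\<dots> \<le> ennreal ?c"
      using H(2) by (intro ennreal_leI) (simp add: divide_right_mono)
    finally show "(\<integral>\<^sup>+\<omega>. ennreal (2 * (H \<omega> / sqrt (real m))) \<partial>M) \<le> ennreal ?c" .
    fix \<omega>
    let ?w = "scaled_walk m (\<lambda>k. \<xi> k \<omega>)"
    have Yw: "polyline \<delta> n (\<lambda>i. ?w (real (Suc i) * \<delta>) - ?w (real i * \<delta>)) = polyline \<delta> n (\<lambda>i. Y i \<omega>)"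
    proof -
      have "?w (real (Suc i) * \<delta>) - ?w (real i * \<delta>) = Y i \<omega>" if "i < n" for i
      proof -
        have le: "Suc i * K \<le> n * K" "i * K \<le> Suc i * K" using that by (auto intro!: mult_le_mono1 simp del: mult_Suc)
        then have "Suc i * K \<le> m" "i * K \<le> m" using nK(1) by linarith+
        then have "?w (real (Suc i) * \<delta>) - ?w (real i * \<delta>)
            = ((\<Sum>k<Suc i * K. \<xi> k \<omega>) - (\<Sum>k<i * K. \<xi> k \<omega>)) / sqrt (real m)"
          unfolding grid using scaled_walk_grid[OF m0(1)] by (simp only: diff_divide_distrib)
        also have "(\<Sum>k<Suc i * K. \<xi> k \<omega>) - (\<Sum>k<i * K. \<xi> k \<omega>) = (\<Sum>k\<in>{..<Suc i * K} - {..<i * K}. \<xi> k \<omega>)"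
          using le(2) by (intro sum_diff[symmetric]) auto
        also have "{..<Suc i * K} - {..<i * K} = {i * K..<Suc i * K}" by auto
        finally show ?thesis by (simp only: Y_def)
      qed
      then show ?thesis unfolding polyline_def by (intro ext sum.cong) auto
    qed
    have "\<bar>f (regulator ?w) - F (\<lambda>i. Y i \<omega>)\<bar> \<le> 2 * (H \<omega> / sqrt (real m))"
      unfolding F_def Yw[symmetric]
    proof (rule Lip1_regulator[OF f continuous_on_scaled_walk[OF m0(1)] continuous_on_polyline])
      fix t :: real assume t: "t \<in> {0..1}"
      show "\<bar>?w t - polyline \<delta> n (\<lambda>i. ?w (real (Suc i) * \<delta>) - ?w (real i * \<delta>)) t\<bar> \<le> 2 * (H \<omega> / sqrt (real m))"
      proof (rule polyline_interpolation_error[OF \<delta> _ _ n\<delta>])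
        show "?w 0 = 0" using scaled_walk_grid[OF m0(1), of 0] by simp
        show "\<bar>?w t - ?w (real j * \<delta>)\<bar> \<le> H \<omega> / sqrt (real m)"
          if "real j * \<delta> \<le> t" "t \<le> (real j + 1) * \<delta>" "t \<le> 1" for j t
          using scaled_walk_oscillation[OF K0 m0(1) H(3,4)] that unfolding \<delta>_def by blast
      qed (use t in auto)
    qed
    then show "ennreal \<bar>f (regulator ?w) - F (\<lambda>i. Y i \<omega>)\<bar> \<le> ennreal (2 * (H \<omega> / sqrt (real m)))"
      by (rule ennreal_leI)
  qed
  then show ?thesis unfolding EF(1) unfolding F_def[abs_def] n_def \<delta>_def .
qed

section \<open>Oscillation of Brownian motion over blocks\<close>

text \<open>Every time is reached from the grid point below it by dyadic steps, at most one on each level, and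
  continuity gives the limit. At the right end point of the cell the rounding would already start in the next
  cell; there a single step of level 0 suffices.\<close>

lemma dyadic_chaining:
  fixes w :: "real \<Rightarrow> real" and D :: "nat \<Rightarrow> real"
  assumes w: "continuous_on {0..1} w" and \<delta>: "0 < \<delta>" and D0: "\<And>l. 0 \<le> D l"
    and D: "\<And>l i. (real i + 1) * (\<delta> / 2 ^ l) \<le> 1 \<Longrightarrow>
      \<bar>w ((real i + 1) * (\<delta> / 2 ^ l)) - w (real i * (\<delta> / 2 ^ l))\<bar> \<le> D l"
    and t: "real j * \<delta> \<le> t" "t \<le> (real j + 1) * \<delta>" "t \<le> 1"
  shows "ennreal \<bar>w t - w (real j * \<delta>)\<bar> \<le> (\<Sum>l. ennreal (D l))"
proof (cases "t = (real j + 1) * \<delta>")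
  case True
  then have "\<bar>w t - w (real j * \<delta>)\<bar> \<le> D 0" using D[of j 0] t by simp
  then have "ennreal \<bar>w t - w (real j * \<delta>)\<bar> \<le> (\<Sum>l<1. ennreal (D l))" by (simp add: ennreal_leI)
  also have "\<dots> \<le> (\<Sum>l. ennreal (D l))" by (rule sum_le_suminf) auto
  finally show ?thesis .
next
  case False
  have t0: "0 \<le> t" using t(1) \<delta> by (meson mult_nonneg_nonneg of_nat_0_le_iff less_imp_le order_trans)
  define h where "h l = \<delta> / 2 ^ l" for l :: nat
  have h: "0 < h l" "h l = 2 * h (Suc l)" "h 0 = \<delta>" for l
    using \<delta> by (simp_all add: h_def)
  define q where "q l = nat \<lfloor>t / h l\<rfloor>" for l
  define s where "s l = real (q l) * h l" for l
  have "0 \<le> t / h l" for l using t0 h(1)[of l] by simp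
  then have ql: "real (q l) \<le> t / h l" "t / h l < real (q l) + 1" for l
    unfolding q_def by (simp_all add: of_nat_floor)
  have sl: "s l \<le> t" "t < (real (q l) + 1) * h l" for l
    using ql[of l] h(1)[of l] by (simp_all add: s_def pos_le_divide_eq pos_divide_less_eq)
  have s01: "0 \<le> s l" "s l \<le> 1" for l
  proof -
    show "0 \<le> s l" using h(1)[of l] by (simp add: s_def)
    show "s l \<le> 1" using sl(1)[of l] t(3) by linarith
  qed
  have "real j \<le> t / \<delta>" "t / \<delta> < real j + 1"
    using t False \<delta> by (simp_all add: field_simps)
  then have "q 0 = j" unfolding q_def h(3) by linarith
  then have s_0: "s 0 = real j * \<delta>" by (simp add: s_def h(3))
  have step: "\<bar>w (s (Suc l)) - w (s l)\<bar> \<le> D (Suc l)" for l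
  proof -
    have s2: "s l = real (2 * q l) * h (Suc l)" unfolding s_def h(2)[of l] by simp
    have "real (2 * q l) * h (Suc l) < (real (q (Suc l)) + 1) * h (Suc l)"
      using sl(1)[of l] sl(2)[of "Suc l"] unfolding s2 by linarith
    then have 1: "real (2 * q l) < real (q (Suc l)) + 1" using h(1)[of "Suc l"] by simp
    have "(real (q l) + 1) * h l = (real (2 * q l) + 2) * h (Suc l)"
      unfolding h(2)[of l] by (simp add: algebra_simps)
    then have "real (q (Suc l)) * h (Suc l) < (real (2 * q l) + 2) * h (Suc l)"
      using sl(2)[of l] sl(1)[of "Suc l"] unfolding s_def by linarith
    then have 2: "real (q (Suc l)) < real (2 * q l) + 2" using h(1)[of "Suc l"] by simp
    consider "q (Suc l) = 2 * q l" | "q (Suc l) = 2 * q l + 1" using 1 2 by linarith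
    then show ?thesis
    proof cases
      case 1
      then have "s (Suc l) = s l" unfolding s2 by (simp add: s_def)
      then show ?thesis using D0[of "Suc l"] by simp
    next
      case 2
      then have s1: "s (Suc l) = (real (2 * q l) + 1) * h (Suc l)" by (simp add: s_def add.commute)
      show ?thesis
        using D[of "2 * q l" "Suc l"] s01(2)[of "Suc l"] unfolding s1 s2 h_def by simp
    qed
  qed
  have chain: "\<bar>w (s L) - w (s 0)\<bar> \<le> (\<Sum>l<L. D (Suc l))" for L
  proof (induction L)
    case (Suc L)
    then show ?case using step[of L] by simp
  qed simp
  have bound: "ennreal \<bar>w (s L) - w (real j * \<delta>)\<bar> \<le> (\<Sum>l. ennreal (D l))" for L
  proof -
    have "\<bar>w (s L) - w (s 0)\<bar> \<le> (\<Sum>l<Suc L. D l)"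
      using chain[of L] D0[of 0] unfolding sum.lessThan_Suc_shift by simp
    then have "ennreal \<bar>w (s L) - w (s 0)\<bar> \<le> (\<Sum>l<Suc L. ennreal (D l))"
      using D0 by (subst sum_ennreal) (auto intro: ennreal_leI)
    also have "\<dots> \<le> (\<Sum>l. ennreal (D l))" by (rule sum_le_suminf) auto
    finally show ?thesis by (simp add: s_0)
  qed
  have "(\<lambda>l. t - \<delta> * (1 / 2) ^ l) \<longlonglongrightarrow> t - \<delta> * 0"
    by (intro tendsto_intros LIMSEQ_power_zero) simp
  then have z: "(\<lambda>l. t - h l) \<longlonglongrightarrow> t"
    by (simp add: h_def power_divide)
  have "s \<longlonglongrightarrow> t"
  proof (rule tendsto_sandwich[OF _ _ z tendsto_const])
    show "\<forall>\<^sub>F l in sequentially. t - h l \<le> s l"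
      using sl(2) by (intro always_eventually allI) (simp add: s_def less_imp_le algebra_simps)
    show "\<forall>\<^sub>F l in sequentially. s l \<le> t" using sl(1) by (intro always_eventually allI)
  qed
  then have "(\<lambda>l. w (s l)) \<longlonglongrightarrow> w t"
    using w t0 t(3) s01 by (intro continuous_on_tendsto_compose[OF w]) auto
  then have "(\<lambda>l. ennreal \<bar>w (s l) - w (real j * \<delta>)\<bar>) \<longlonglongrightarrow> ennreal \<bar>w t - w (real j * \<delta>)\<bar>"
    by (intro tendsto_intros tendsto_ennrealI)
  then show ?thesis by (rule LIMSEQ_le_const2) (use bound in auto)
qed

context brownian_motion
begin

lemma increment_law:
  assumes "0 \<le> s" "s < t" "t \<le> 1"
  shows "distr M borel (\<lambda>\<omega>. B t \<omega> - B s \<omega>) = gauss (t - s)"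
proof -
  have "distr M lborel (\<lambda>\<omega>. B t \<omega> - B s \<omega>) = gauss (t - s)"
    using gaussian_increments[OF assms] by (simp add: distributed_def gauss_def)
  moreover have "distr M borel (\<lambda>\<omega>. B t \<omega> - B s \<omega>) = distr M lborel (\<lambda>\<omega>. B t \<omega> - B s \<omega>)"
    by (rule distr_cong) auto
  ultimately show ?thesis by simp
qed

text \<open>The variance of the increment is at most \<open>\<sigma>\<^sup>2\<close>, so the bound is absolute.\<close>

lemma increment_exponential_moment:
  assumes "0 \<le> s" "s \<le> t" "t \<le> 1" "0 < \<sigma>" "t - s \<le> \<sigma>\<^sup>2"
  shows "(\<integral>\<^sup>+\<omega>. ennreal (exp (\<bar>B t \<omega> - B s \<omega>\<bar> / \<sigma>)) \<partial>M) \<le> ennreal (2 * exp (1 / 2))"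
proof (cases "s = t")
  case True
  have "1 \<le> exp (1 / 2 :: real)" by simp
  then have "(1::real) \<le> 2 * exp (1 / 2)" by linarith
  then have "ennreal 1 \<le> ennreal (2 * exp (1 / 2))" by (rule ennreal_leI)
  then show ?thesis using True by (simp add: emeasure_space_1)
next
  case False
  then have st: "s < t" "0 < t - s" using assms(2) by auto
  have [measurable]: "B t \<in> borel_measurable M" "B s \<in> borel_measurable M"
    using assms by (auto intro!: measurable_at)
  have "(\<integral>\<^sup>+\<omega>. ennreal (exp (\<bar>B t \<omega> - B s \<omega>\<bar> / \<sigma>)) \<partial>M)
    = (\<integral>\<^sup>+y. ennreal (exp (\<bar>y\<bar> / \<sigma>)) \<partial>distr M borel (\<lambda>\<omega>. B t \<omega> - B s \<omega>))"
    by (subst nn_integral_distr) auto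
  also have "\<dots> = (\<integral>\<^sup>+y. ennreal (exp (1 / \<sigma> * \<bar>y\<bar>)) \<partial>gauss (t - s))"
    using increment_law[OF assms(1) st(1) assms(3)] by simp
  also have "\<dots> = ennreal (\<integral>y. exp (1 / \<sigma> * \<bar>y\<bar>) \<partial>gauss (t - s))"
    by (rule nn_integral_eq_integral[OF gauss_exp_abs(1)[OF st(2)]]) auto
  also have "\<dots> \<le> ennreal (2 * exp (1 / 2))"
  proof (rule ennreal_leI)
    have "(\<integral>y. exp (1 / \<sigma> * \<bar>y\<bar>) \<partial>gauss (t - s)) \<le> 2 * exp ((1 / \<sigma>)\<^sup>2 * (t - s) / 2)"
      using assms(4) by (intro gauss_exp_abs(2)[OF st(2)]) simp
    also have "(1 / \<sigma>)\<^sup>2 * (t - s) \<le> 1"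
      using assms(4,5) by (simp add: power_divide)
    finally show "(\<integral>y. exp (1 / \<sigma> * \<bar>y\<bar>) \<partial>gauss (t - s)) \<le> 2 * exp (1 / 2)"
      by simp
  qed
  finally show ?thesis .
qed

text \<open>On level $l$ there are about $n 2^l$ increments of size $\sqrt{\delta 2^{-l}}$, and their maximum exceeds that size by a factor
  of order $\log n + l$ in expectation. The sum over the levels converges, so the oscillation over cells of
  length \<open>\<delta>\<close> is of order $\sqrt\delta \log n$.\<close>

lemma brownian_oscillation:
  obtains C where "0 \<le> C" "\<And>\<delta> n. 0 < \<delta> \<Longrightarrow> 1 < (real n + 1) * \<delta> \<Longrightarrow>
    \<exists>H \<in> borel_measurable M. (\<integral>\<^sup>+\<omega>. H \<omega> \<partial>M) \<le> ennreal (sqrt \<delta> * (C * (1 + ln (real n + 1)))) \<and>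
      (\<forall>\<omega>\<in>space M. \<forall>j t. real j * \<delta> \<le> t \<longrightarrow> t \<le> (real j + 1) * \<delta> \<longrightarrow> t \<le> 1 \<longrightarrow>
        ennreal \<bar>B t \<omega> - B (real j * \<delta>) \<omega>\<bar> \<le> H \<omega>)"
proof -
  \<comment> \<open>the ratio of the standard deviations on consecutive dyadic levels\<close>
  define r :: real where "r = sqrt (1 / 2)"
  have r: "0 \<le> r" "r < 1" by (auto simp: r_def)
  define A where "A = 1 + 2 * exp (1 / 2 :: real)"
  have A: "1 \<le> A" by (simp add: A_def)
  have "summable (\<lambda>l. of_nat (Suc l) * r ^ l)"
    using geometric_deriv_sums[of r] r by (simp add: sums_iff)
  moreover have "summable (\<lambda>l. (A - 1) * r ^ l)"
    using r by (intro summable_mult summable_geometric) simp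
  ultimately have "summable (\<lambda>l. of_nat (Suc l) * r ^ l + (A - 1) * r ^ l)"
    by (rule summable_add)
  then have sm: "summable (\<lambda>l. r ^ l * (A + real l))"
    by (rule back_subst[of summable]) (auto simp: algebra_simps)
  define C where "C = (\<Sum>l. r ^ l * (A + real l))"
  have term0: "0 \<le> r ^ l * (A + real l)" for l using r A by simp
  have C: "0 \<le> C" unfolding C_def using term0 by (intro suminf_nonneg sm)
  have main: "\<exists>H \<in> borel_measurable M. (\<integral>\<^sup>+\<omega>. H \<omega> \<partial>M) \<le> ennreal (sqrt \<delta> * (C * (1 + ln (real n + 1)))) \<and>
      (\<forall>\<omega>\<in>space M. \<forall>j t. real j * \<delta> \<le> t \<longrightarrow> t \<le> (real j + 1) * \<delta> \<longrightarrow> t \<le> 1 \<longrightarrow>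
        ennreal \<bar>B t \<omega> - B (real j * \<delta>) \<omega>\<bar> \<le> H \<omega>)"
    if \<delta>: "0 < \<delta>" and n: "1 < (real n + 1) * \<delta>" for \<delta> n
  proof -
    define N :: "nat \<Rightarrow> nat" where "N l = (n + 1) * 2 ^ l" for l
    define \<sigma> where "\<sigma> l = sqrt \<delta> * r ^ l" for l :: nat
    \<comment> \<open>the dyadic grid is cut off at time 1, because the last cell may exceed the unit interval\<close>
    define T where "T l i = min 1 (real i * (\<delta> / 2 ^ l))" for l i :: nat
    define E where "E l \<omega> = (\<Sum>i<N l. exp (\<bar>B (T l (Suc i)) \<omega> - B (T l i) \<omega>\<bar> / \<sigma> l))" for l \<omega>
    define D where "D l \<omega> = \<sigma> l * (ln (real (N l)) + 1 / real (N l) * E l \<omega>)" for l \<omega>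
    have N: "0 < N l" "1 \<le> real (N l)" for l
    proof -
      show "0 < N l" by (simp add: N_def)
      then show "1 \<le> real (N l)" by linarith
    qed
    have \<sigma>: "0 < \<sigma> l" "(\<sigma> l)\<^sup>2 = \<delta> / 2 ^ l" for l
      using \<delta> by (simp_all add: \<sigma>_def r_def power_mult_distrib power_mult[symmetric] mult.commute[of l]
          power_mult[of _ 2] power_divide)
    have T: "0 \<le> T l i" "T l i \<le> 1" "T l i \<le> T l (Suc i)" "T l (Suc i) - T l i \<le> \<delta> / 2 ^ l" for l i
    proof -
      have d: "0 \<le> \<delta> / 2 ^ l" using \<delta> by simp
      have e: "real (Suc i) * (\<delta> / 2 ^ l) = real i * (\<delta> / 2 ^ l) + \<delta> / 2 ^ l"
        by (simp add: distrib_right add_divide_distrib)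
      have "0 \<le> real i * (\<delta> / 2 ^ l)" using d by (intro mult_nonneg_nonneg) auto
      with d show "0 \<le> T l i" "T l i \<le> 1" "T l i \<le> T l (Suc i)" "T l (Suc i) - T l i \<le> \<delta> / 2 ^ l"
        unfolding T_def e by linarith+
    qed
    have Bm [measurable]: "B (T l i) \<in> borel_measurable M" for l i
      using T by (intro measurable_at) auto
    have Em [measurable]: "E l \<in> borel_measurable M" for l
      unfolding E_def[abs_def] by measurable
    have E0: "0 \<le> E l \<omega>" for l \<omega> unfolding E_def by (intro sum_nonneg) simp
    have D0: "0 \<le> D l \<omega>" for l \<omega>
      unfolding D_def using \<sigma>(1)[of l] N(2)[of l] E0[of l \<omega>] by simp
    have Dm: "(\<lambda>\<omega>. ennreal (D l \<omega>)) \<in> borel_measurable M" for l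
      unfolding D_def by measurable
    have intE: "(\<integral>\<^sup>+\<omega>. ennreal (E l \<omega>) \<partial>M) \<le> ennreal (real (N l) * (2 * exp (1 / 2)))" for l
    proof -
      have "(\<integral>\<^sup>+\<omega>. ennreal (E l \<omega>) \<partial>M)
        = (\<Sum>i<N l. \<integral>\<^sup>+\<omega>. ennreal (exp (\<bar>B (T l (Suc i)) \<omega> - B (T l i) \<omega>\<bar> / \<sigma> l)) \<partial>M)"
        unfolding E_def by (simp add: sum_ennreal[symmetric] nn_integral_sum del: sum_ennreal)
      also have "\<dots> \<le> (\<Sum>i<N l. ennreal (2 * exp (1 / 2)))"
        using T \<sigma> by (intro sum_mono increment_exponential_moment) auto
      also have "\<dots> = ennreal (real (N l) * (2 * exp (1 / 2)))"
        by (simp add: ennreal_mult ennreal_of_nat_eq_real_of_nat)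
      finally show ?thesis .
    qed
    have lnN: "ln (real (N l)) = ln (real n + 1) + real l * ln 2" for l
    proof -
      have "real (N l) = (real n + 1) * 2 ^ l" by (simp add: N_def distrib_right)
      then show ?thesis by (simp only: ln_mult_pos ln_realpow) (simp add: ln_mult_pos ln_realpow)
    qed
    have intD: "(\<integral>\<^sup>+\<omega>. ennreal (D l \<omega>) \<partial>M) \<le> ennreal (sqrt \<delta> * (1 + ln (real n + 1)) * (r ^ l * (A + real l)))" for l
    proof -
      have "(\<integral>\<^sup>+\<omega>. ennreal (D l \<omega>) \<partial>M)
        = (\<integral>\<^sup>+\<omega>. ennreal (\<sigma> l * ln (real (N l))) + ennreal (\<sigma> l / real (N l)) * ennreal (E l \<omega>) \<partial>M)"
        using \<sigma>(1)[of l] N(2)[of l] E0[of l]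
        by (intro nn_integral_cong) (simp add: D_def ennreal_mult[symmetric] ennreal_plus[symmetric] distrib_left
            del: ennreal_plus)
      also have "\<dots> = ennreal (\<sigma> l * ln (real (N l))) + ennreal (\<sigma> l / real (N l)) * (\<integral>\<^sup>+\<omega>. ennreal (E l \<omega>) \<partial>M)"
        by (simp add: nn_integral_add nn_integral_cmult emeasure_space_1)
      also have "\<dots> \<le> ennreal (\<sigma> l * ln (real (N l))) + ennreal (\<sigma> l / real (N l)) * ennreal (real (N l) * (2 * exp (1 / 2)))"
        by (intro add_left_mono mult_left_mono intE) simp
      also have "\<dots> = ennreal (\<sigma> l * ln (real (N l)) + \<sigma> l / real (N l) * (real (N l) * (2 * exp (1 / 2))))"
        using \<sigma>(1)[of l] N(2)[of l] by (simp add: ennreal_mult[symmetric] ennreal_plus[symmetric] del: ennreal_plus)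
      also have "\<dots> \<le> ennreal (sqrt \<delta> * (1 + ln (real n + 1)) * (r ^ l * (A + real l)))"
      proof (rule ennreal_leI)
        have l2: "real l * ln 2 \<le> real l" using ln_2_less_1 by (simp add: mult_left_le)
        have ln0: "0 \<le> ln (real n + 1)" by simp
        have "\<sigma> l * ln (real (N l)) + \<sigma> l / real (N l) * (real (N l) * (2 * exp (1 / 2)))
          = \<sigma> l * (ln (real n + 1) + real l * ln 2 + 2 * exp (1 / 2))"
          using N(2)[of l] unfolding lnN by (simp add: algebra_simps)
        also have "\<dots> \<le> \<sigma> l * ((1 + ln (real n + 1)) * (A + real l))"
        proof (rule mult_left_mono)
          have "ln (real n + 1) * 1 \<le> ln (real n + 1) * (A + real l)"
            using A ln0 by (intro mult_left_mono) auto
          then have "ln (real n + 1) + real l + (A - 1) \<le> (1 + ln (real n + 1)) * (A + real l)"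
            by (simp add: distrib_right)
          then show "ln (real n + 1) + real l * ln 2 + 2 * exp (1 / 2) \<le> (1 + ln (real n + 1)) * (A + real l)"
            using l2 by (simp add: A_def)
        qed (use \<sigma>(1)[of l] in simp)
        also have "\<dots> = sqrt \<delta> * (1 + ln (real n + 1)) * (r ^ l * (A + real l))"
          by (simp add: \<sigma>_def mult_ac)
        finally show "\<sigma> l * ln (real (N l)) + \<sigma> l / real (N l) * (real (N l) * (2 * exp (1 / 2)))
          \<le> sqrt \<delta> * (1 + ln (real n + 1)) * (r ^ l * (A + real l))" .
      qed
      finally show ?thesis .
    qed
    define H where "H \<omega> = (\<Sum>l. ennreal (D l \<omega>))" for \<omega>
    have "H \<in> borel_measurable M" unfolding H_def[abs_def] using Dm by measurable
    moreover have "(\<integral>\<^sup>+\<omega>. H \<omega> \<partial>M) \<le> ennreal (sqrt \<delta> * (C * (1 + ln (real n + 1))))"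
    proof -
      have "(\<integral>\<^sup>+\<omega>. H \<omega> \<partial>M) = (\<Sum>l. \<integral>\<^sup>+\<omega>. ennreal (D l \<omega>) \<partial>M)"
        unfolding H_def by (rule nn_integral_suminf[OF Dm])
      also have "\<dots> \<le> (\<Sum>l. ennreal (sqrt \<delta> * (1 + ln (real n + 1)) * (r ^ l * (A + real l))))"
        by (intro suminf_le intD) auto
      also have "\<dots> = ennreal (\<Sum>l. sqrt \<delta> * (1 + ln (real n + 1)) * (r ^ l * (A + real l)))"
        using \<delta> term0 by (intro suminf_ennreal2 summable_mult sm mult_nonneg_nonneg[OF _ term0]) auto
      also have "(\<Sum>l. sqrt \<delta> * (1 + ln (real n + 1)) * (r ^ l * (A + real l))) = sqrt \<delta> * (C * (1 + ln (real n + 1)))"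
        unfolding C_def by (subst suminf_mult[OF sm]) (simp add: mult_ac)
      finally show ?thesis .
    qed
    moreover have "ennreal \<bar>B t \<omega> - B (real j * \<delta>) \<omega>\<bar> \<le> H \<omega>"
      if \<omega>: "\<omega> \<in> space M" and t: "real j * \<delta> \<le> t" "t \<le> (real j + 1) * \<delta>" "t \<le> 1" for \<omega> j t
      unfolding H_def
    proof (rule dyadic_chaining[OF continuous_paths[OF \<omega>] \<delta> D0 _ t])
      fix l i :: nat assume i: "(real i + 1) * (\<delta> / 2 ^ l) \<le> 1"
      have "real i * (\<delta> / 2 ^ l) \<le> (real i + 1) * (\<delta> / 2 ^ l)"
        using \<delta> by (intro mult_right_mono) auto
      then have Ti: "T l (Suc i) = (real i + 1) * (\<delta> / 2 ^ l)" "T l i = real i * (\<delta> / 2 ^ l)"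
        using i by (simp_all only: T_def of_nat_Suc add.commute[of 1] min_absorb2 order_trans)
      have "(real i + 1) * (\<delta> / 2 ^ l) * 2 ^ l \<le> 1 * 2 ^ l" using i by (rule mult_right_mono) simp
      then have "(real i + 1) * \<delta> \<le> 2 ^ l" by simp
      also have "\<dots> < (real n + 1) * \<delta> * 2 ^ l" using n by simp
      finally have "(real i + 1) * \<delta> < (real (N l)) * \<delta>" by (simp add: N_def algebra_simps)
      then have "real i + 1 < real (N l)" using \<delta> by simp
      then have iN: "i < N l" by linarith
      let ?x = "\<bar>B (T l (Suc i)) \<omega> - B (T l i) \<omega>\<bar>"
      have "?x \<le> \<sigma> l * (ln (real (N l)) + exp (- ln (real (N l))) * exp (?x / \<sigma> l))"
        by (rule soft_max_bound[OF \<sigma>(1)])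
      also have "exp (- ln (real (N l))) = 1 / real (N l)" using N(1)[of l] by (simp add: exp_minus inverse_eq_divide)
      also have "\<sigma> l * (ln (real (N l)) + 1 / real (N l) * exp (?x / \<sigma> l)) \<le> D l \<omega>"
        unfolding D_def E_def using iN \<sigma>(1)[of l]
        by (intro mult_left_mono add_left_mono member_le_sum[where f = "\<lambda>i. exp (\<bar>B (T l (Suc i)) \<omega> - B (T l i) \<omega>\<bar> / \<sigma> l)"]) auto
      finally show "\<bar>B ((real i + 1) * (\<delta> / 2 ^ l)) \<omega> - B (real i * (\<delta> / 2 ^ l)) \<omega>\<bar> \<le> D l \<omega>"
        unfolding Ti .
    qed
    ultimately show ?thesis by blast
  qed
  show ?thesis using that[OF C main] by blast
qed

end

context brownian_motion
begin

text \<open>The counterpart of the corresponding statement for the walk, with exactly Gaussian block increments.\<close>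

lemma brownian_block_replacement:
  obtains C where "0 \<le> C" "\<And>\<delta> n f. 0 < \<delta> \<Longrightarrow> real n * \<delta> \<le> 1 \<Longrightarrow> 1 < (real n + 1) * \<delta> \<Longrightarrow> f \<in> Lip1 C01 \<Longrightarrow>
    \<bar>expectation (\<lambda>\<omega>. f (regulator (\<lambda>t. B t \<omega>)))
      - (\<integral>y. f (regulator (polyline \<delta> n y)) \<partial>PiM {..<n} (\<lambda>_. gauss \<delta>))\<bar>
    \<le> 2 * (sqrt \<delta> * (C * (1 + ln (real n + 1))))"
proof -
  obtain C where C: "0 \<le> C" "\<And>\<delta> n. 0 < \<delta> \<Longrightarrow> 1 < (real n + 1) * \<delta> \<Longrightarrow>
    \<exists>H \<in> borel_measurable M. (\<integral>\<^sup>+\<omega>. H \<omega> \<partial>M) \<le> ennreal (sqrt \<delta> * (C * (1 + ln (real n + 1)))) \<and>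
      (\<forall>\<omega>\<in>space M. \<forall>j t. real j * \<delta> \<le> t \<longrightarrow> t \<le> (real j + 1) * \<delta> \<longrightarrow> t \<le> 1 \<longrightarrow>
        ennreal \<bar>B t \<omega> - B (real j * \<delta>) \<omega>\<bar> \<le> H \<omega>)"
    using brownian_oscillation by blast
  have main: "\<bar>expectation (\<lambda>\<omega>. f (regulator (\<lambda>t. B t \<omega>)))
      - (\<integral>y. f (regulator (polyline \<delta> n y)) \<partial>PiM {..<n} (\<lambda>_. gauss \<delta>))\<bar>
    \<le> 2 * (sqrt \<delta> * (C * (1 + ln (real n + 1))))"
    if \<delta>: "0 < \<delta>" and n: "real n * \<delta> \<le> 1" "1 < (real n + 1) * \<delta>" and f: "f \<in> Lip1 C01" for \<delta> n f
  proof -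
    obtain H where H: "H \<in> borel_measurable M"
      "(\<integral>\<^sup>+\<omega>. H \<omega> \<partial>M) \<le> ennreal (sqrt \<delta> * (C * (1 + ln (real n + 1))))"
      "\<And>\<omega> j t. \<omega> \<in> space M \<Longrightarrow> real j * \<delta> \<le> t \<Longrightarrow> t \<le> (real j + 1) * \<delta> \<Longrightarrow> t \<le> 1 \<Longrightarrow>
        ennreal \<bar>B t \<omega> - B (real j * \<delta>) \<omega>\<bar> \<le> H \<omega>"
      using C(2)[OF \<delta> n(2)] by blast
    define Y where "Y i \<omega> = B (real (Suc i) * \<delta>) \<omega> - B (real i * \<delta>) \<omega>" for i \<omega>
    define F where "F y = f (regulator (polyline \<delta> n y))" for y
    have F: "coord_lipschitz n 1 F" unfolding F_def[abs_def] by (rule coord_lipschitz_regulator[OF f])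
    have grid: "0 \<le> real i * \<delta>" "real i * \<delta> \<le> 1" if "i \<le> n" for i
    proof -
      show "0 \<le> real i * \<delta>" using \<delta> by simp
      have "real i * \<delta> \<le> real n * \<delta>" using that \<delta> by (intro mult_right_mono) auto
      then show "real i * \<delta> \<le> 1" using n(1) by linarith
    qed
    have Yind: "indep_vars (\<lambda>_. borel) Y {..<n}"
      unfolding Y_def[abs_def]
    proof (rule independent_increments)
      show "mono_on {..n} (\<lambda>i. real i * \<delta>)"
        using \<delta> by (intro mono_onI mult_right_mono) auto
      show "(\<lambda>i. real i * \<delta>) ` {..n} \<subseteq> {0..1}" using grid by auto
    qed
    have Ylaw: "distr M borel (Y i) = gauss \<delta>" if "i < n" for i
    proof -
      have "real (Suc i) * \<delta> - real i * \<delta> = \<delta>" by (simp add: algebra_simps)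
      then show ?thesis
        unfolding Y_def[abs_def] using increment_law[of "real i * \<delta>" "real (Suc i) * \<delta>"] grid[of i] grid[of "Suc i"] that \<delta>
        by simp
    qed
    have EF: "expectation (\<lambda>\<omega>. F (\<lambda>i. Y i \<omega>)) = integral\<^sup>L (PiM {..<n} (\<lambda>_. gauss \<delta>)) F"
      "integrable M (\<lambda>\<omega>. F (\<lambda>i. Y i \<omega>))"
      by (rule expectation_iid[OF has_mean_gauss[OF \<delta>] F Yind], rule Ylaw, assumption)+
    let ?c = "2 * (sqrt \<delta> * (C * (1 + ln (real n + 1))))"
    have c0: "0 \<le> sqrt \<delta> * (C * (1 + ln (real n + 1)))" using C(1) \<delta> by simp
    have "\<bar>expectation (\<lambda>\<omega>. f (regulator (\<lambda>t. B t \<omega>))) - expectation (\<lambda>\<omega>. F (\<lambda>i. Y i \<omega>))\<bar> \<le> ?c"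
    proof (rule expectation_close[where h = "\<lambda>\<omega>. 2 * H \<omega>"])
      show "(\<lambda>\<omega>. f (regulator (\<lambda>t. B t \<omega>))) \<in> borel_measurable M"
        by (rule regulator_functional_measurable[OF f measurable_at continuous_paths start])
      show "integrable M (\<lambda>\<omega>. F (\<lambda>i. Y i \<omega>))" by (rule EF(2))
      show "0 \<le> ?c" using c0 by simp
      have "(\<integral>\<^sup>+\<omega>. 2 * H \<omega> \<partial>M) = 2 * (\<integral>\<^sup>+\<omega>. H \<omega> \<partial>M)"
        using H(1) by (rule nn_integral_cmult)
      also have "\<dots> \<le> 2 * ennreal (sqrt \<delta> * (C * (1 + ln (real n + 1))))"
        using H(2) by (rule mult_left_mono) simp
      also have "\<dots> = ennreal ?c" using c0 by (subst ennreal_mult) auto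
      finally show "(\<integral>\<^sup>+\<omega>. 2 * H \<omega> \<partial>M) \<le> ennreal ?c" .
      fix \<omega> assume \<omega>: "\<omega> \<in> space M"
      show "ennreal \<bar>f (regulator (\<lambda>t. B t \<omega>)) - F (\<lambda>i. Y i \<omega>)\<bar> \<le> 2 * H \<omega>"
      proof (cases "H \<omega>")
        case top
        then show ?thesis by simp
      next
        case (real e)
        have "\<bar>f (regulator (\<lambda>t. B t \<omega>)) - F (\<lambda>i. Y i \<omega>)\<bar> \<le> 2 * e"
          unfolding F_def
        proof (rule Lip1_regulator[OF f continuous_paths[OF \<omega>] continuous_on_polyline])
          fix t :: real assume t: "t \<in> {0..1}"
          show "\<bar>B t \<omega> - polyline \<delta> n (\<lambda>i. Y i \<omega>) t\<bar> \<le> 2 * e"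
            unfolding Y_def
          proof (rule polyline_interpolation_error[OF \<delta> _ _ n, where w = "\<lambda>t. B t \<omega>"])
            show "\<bar>B t \<omega> - B (real j * \<delta>) \<omega>\<bar> \<le> e"
              if "real j * \<delta> \<le> t" "t \<le> (real j + 1) * \<delta>" "t \<le> 1" for j t
              using H(3)[OF \<omega> that] real by simp
          qed (use t start[OF \<omega>] in auto)
        qed
        then have "ennreal \<bar>f (regulator (\<lambda>t. B t \<omega>)) - F (\<lambda>i. Y i \<omega>)\<bar> \<le> ennreal (2 * e)"
          by (rule ennreal_leI)
        also have "\<dots> = 2 * H \<omega>" using real by (subst ennreal_mult) auto
        finally show ?thesis .
      qed
    qed
    then show ?thesis unfolding EF(1) unfolding F_def[abs_def] .
  qed
  show ?thesis using that[OF C(1) main] by blast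
qed

end

section \<open>Choice of the block length\<close>

lemma Lp_norm_pos:
  assumes "prob_space P" "X \<in> borel_measurable P" "(LINT \<omega>|P. (X \<omega>)\<^sup>2) = 1" "integrable P (\<lambda>\<omega>. \<bar>X \<omega>\<bar> ^ 3)"
  shows "0 < Lp_norm P 3 X"
proof -
  have e: "\<bar>X \<omega>\<bar> powr 3 = \<bar>X \<omega>\<bar> ^ 3" for \<omega> by (simp add: powr_numeral)
  have "(LINT \<omega>|P. \<bar>X \<omega>\<bar> ^ 3) \<noteq> 0"
  proof
    assume "(LINT \<omega>|P. \<bar>X \<omega>\<bar> ^ 3) = 0"
    then have "AE \<omega> in P. \<bar>X \<omega>\<bar> ^ 3 = 0"
      using assms(4) by (subst (asm) integral_nonneg_eq_0_iff_AE) auto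
    then have "AE \<omega> in P. (X \<omega>)\<^sup>2 = 0" by eventually_elim simp
    then have "(LINT \<omega>|P. (X \<omega>)\<^sup>2) = (LINT \<omega>|P. 0)"
      using assms(2) by (intro integral_cong_AE) auto
    then show False using assms(3) by simp
  qed
  moreover have "0 \<le> (LINT \<omega>|P. \<bar>X \<omega>\<bar> ^ 3)" by simp
  ultimately show ?thesis unfolding Lp_norm_def e by simp
qed

text \<open>Blocks of $K = r^2$ steps with $r \approx m^{1/3}$. The number of blocks is then about $m^{1/3}$ too, and
  the two contributions to the error balance: the oscillation over a block is of order $r / \sqrt m$ and the sum of
  the normal approximation errors is of order $(m / r^2) / \sqrt m$, up to logarithms.\<close>

lemma block_size:
  fixes m :: nat
  assumes "2 \<le> m"
  obtains r :: nat where "1 \<le> r" "r \<le> m" "real m / (real r)\<^sup>2 / sqrt (real m) \<le> real m powr (- 1 / 6)"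
    "real r / sqrt (real m) \<le> 2 * real m powr (- 1 / 6)"
proof
  define c where "c = real m powr (1 / 3)"
  define r where "r = nat \<lceil>c\<rceil>"
  have m: "1 \<le> real m" "0 < real m" using assms by auto
  have c1: "1 \<le> c" unfolding c_def using m by (simp add: ge_one_powr_ge_zero)
  have cm: "c \<le> real m" unfolding c_def using powr_mono[of "1 / 3" 1 "real m"] m by simp
  have r: "c \<le> real r" "real r < c + 1" unfolding r_def using c1 by linarith+
  show "1 \<le> r" using r c1 by linarith
  show "r \<le> m" using r cm unfolding r_def by linarith
  have sq: "sqrt (real m) = real m powr (1 / 2)" using m by (simp add: powr_half_sqrt)
  have "real m / (real r)\<^sup>2 / sqrt (real m) \<le> real m / c\<^sup>2 / sqrt (real m)"
    using r c1 m by (intro divide_right_mono divide_left_mono power_mono mult_pos_pos) auto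
  also have "c\<^sup>2 = real m powr (2 / 3)"
    unfolding c_def power2_eq_square by (simp add: powr_add[symmetric])
  also have "real m / real m powr (2 / 3) / sqrt (real m) = real m powr 1 / real m powr (2 / 3) / real m powr (1 / 2)"
    using m sq by simp
  also have "\<dots> = real m powr (- 1 / 6)"
    by (simp only: powr_diff[symmetric]) simp
  finally show "real m / (real r)\<^sup>2 / sqrt (real m) \<le> real m powr (- 1 / 6)" .
  have "real r / sqrt (real m) \<le> 2 * c / sqrt (real m)"
    using r c1 by (intro divide_right_mono) auto
  also have "\<dots> = 2 * (real m powr (1 / 3) / real m powr (1 / 2))"
    unfolding c_def sq by simp
  also have "\<dots> = 2 * real m powr (- 1 / 6)"
    by (simp only: powr_diff[symmetric]) simp
  finally show "real r / sqrt (real m) \<le> 2 * real m powr (- 1 / 6)" .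
qed

text \<open>The three summands are the oscillation of the walk, the normal approximation of the blocks and the
  oscillation of Brownian motion. Additive constants are absorbed into $\log m$ by means of
  $1 \le 2 \log m$.\<close>

lemma rate_arithmetic:
  fixes m r n :: nat and E \<beta> C1 C2 :: real
  assumes m: "2 \<le> m" and r: "1 \<le> r" "r \<le> m" and n: "n = m div r\<^sup>2"
    and C: "0 \<le> E" "0 \<le> \<beta>" "0 \<le> C1" "0 \<le> C2"
    and r1: "real m / (real r)\<^sup>2 / sqrt (real m) \<le> s" and r2: "real r / sqrt (real m) \<le> 2 * s"
  shows "2 * (real r * (ln (real m) + E) + real m * (2 * \<beta> / (real r)\<^sup>2)) / sqrt (real m)
      + real n * (1 * (C1 * (1 + ln (real (r\<^sup>2))) / sqrt (real m)))
      + 2 * (sqrt (real (r\<^sup>2) / real m) * (C2 * (1 + ln (real n + 1))))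
    \<le> (4 + 8 * E + 8 * \<beta> + 4 * C1 + 16 * C2) * s * ln (real m)"
proof -
  define L where "L = ln (real m)"
  have m0: "0 < real m" "2 \<le> real m" using m by auto
  have s: "0 \<le> s" using r1 by (meson divide_nonneg_nonneg of_nat_0_le_iff order_trans real_sqrt_ge_zero zero_le_power2)
  have "ln (1 / 2 :: real) \<le> 1 / 2 - 1" by (rule ln_le_minus_one) simp
  then have "1 / 2 \<le> ln (2 :: real)" by (simp add: ln_div)
  also have ln2L: "ln (2 :: real) \<le> L" unfolding L_def using m0 by simp
  finally have L: "1 \<le> 2 * L" by simp
  have lr: "ln (real (r\<^sup>2)) \<le> 2 * L"
  proof -
    have "ln (real r) \<le> ln (real m)" using r by simp
    then show ?thesis using r by (simp add: L_def ln_realpow)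
  qed
  have lr0: "0 \<le> ln (real (r\<^sup>2))" using r by simp
  have rr: "real (r\<^sup>2) = (real r)\<^sup>2" "0 < (real r)\<^sup>2" using r by simp_all
  have nr: "real n \<le> real m / (real r)\<^sup>2" "n \<le> m"
  proof -
    show "real n \<le> real m / (real r)\<^sup>2" unfolding n rr(1)[symmetric] by (rule of_nat_div_le_of_nat)
    show "n \<le> m" unfolding n by (rule div_le_dividend)
  qed
  have ln: "ln (real n + 1) \<le> 2 * L" "0 \<le> ln (real n + 1)"
  proof -
    have "ln (real n + 1) \<le> ln (2 * real m)" using nr(2) m0 by simp
    also have "\<dots> = ln 2 + L" using m0 by (simp add: L_def ln_mult)
    finally show "ln (real n + 1) \<le> 2 * L" using ln2L by simp
  qed simp
  have "2 * (real r * (L + E) + real m * (2 * \<beta> / (real r)\<^sup>2)) / sqrt (real m)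
    = 2 * (L + E) * (real r / sqrt (real m)) + 4 * \<beta> * (real m / (real r)\<^sup>2 / sqrt (real m))"
    by (simp add: add_divide_distrib algebra_simps)
  also have "\<dots> \<le> 2 * (L + E) * (2 * s) + 4 * \<beta> * s"
    using r1 r2 C L by (intro add_mono mult_left_mono) auto
  also have "\<dots> = 4 * s * L + (4 * E + 4 * \<beta>) * s * 1" by (simp add: algebra_simps)
  also have "\<dots> \<le> 4 * s * L + (4 * E + 4 * \<beta>) * s * (2 * L)"
    using L C s by (intro add_left_mono mult_left_mono) auto
  finally have a: "2 * (real r * (L + E) + real m * (2 * \<beta> / (real r)\<^sup>2)) / sqrt (real m)
    \<le> (4 + 8 * E + 8 * \<beta>) * s * L" by (simp add: algebra_simps)
  have "real n * (1 * (C1 * (1 + ln (real (r\<^sup>2))) / sqrt (real m)))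
    = (real n / sqrt (real m)) * (C1 * (1 + ln (real (r\<^sup>2))))" by simp
  also have "\<dots> \<le> s * (C1 * (2 * L + 2 * L))"
  proof (rule mult_mono)
    have "real n / sqrt (real m) \<le> real m / (real r)\<^sup>2 / sqrt (real m)"
      using nr(1) by (rule divide_right_mono) simp
    then show "real n / sqrt (real m) \<le> s" using r1 by simp
    show "C1 * (1 + ln (real (r\<^sup>2))) \<le> C1 * (2 * L + 2 * L)"
      using C lr L by (intro mult_left_mono add_mono) auto
  qed (use s C lr0 in auto)
  also have "\<dots> = 4 * C1 * s * L" by (simp add: algebra_simps)
  finally have b: "real n * (1 * (C1 * (1 + ln (real (r\<^sup>2))) / sqrt (real m))) \<le> 4 * C1 * s * L" .
  have "sqrt (real (r\<^sup>2) / real m) = real r / sqrt (real m)"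
    by (simp add: real_sqrt_divide)
  then have "2 * (sqrt (real (r\<^sup>2) / real m) * (C2 * (1 + ln (real n + 1))))
    = 2 * ((real r / sqrt (real m)) * (C2 * (1 + ln (real n + 1))))" by simp
  also have "\<dots> \<le> 2 * ((2 * s) * (C2 * (2 * L + 2 * L)))"
    using r2 s C ln L by (intro mult_left_mono mult_mono add_mono) auto
  also have "\<dots> = 16 * C2 * s * L" by (simp add: algebra_simps)
  finally have c: "2 * (sqrt (real (r\<^sup>2) / real m) * (C2 * (1 + ln (real n + 1)))) \<le> 16 * C2 * s * L" .
  have "(4 + 8 * E + 8 * \<beta> + 4 * C1 + 16 * C2) * s * L
    = (4 + 8 * E + 8 * \<beta>) * s * L + 4 * C1 * s * L + 16 * C2 * s * L" by (simp add: algebra_simps)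
  then show ?thesis using a b c unfolding L_def by linarith
qed

theorem corollary3p5:
  fixes P :: "'a measure" and X :: "'a \<Rightarrow> real"
    and M :: "nat \<Rightarrow> 'b measure" and \<xi> :: "nat \<Rightarrow> nat \<Rightarrow> 'b \<Rightarrow> real"
    and N :: "'c measure" and B :: "real \<Rightarrow> 'c \<Rightarrow> real"
  assumes "prob_space P"
    and "X \<in> borel_measurable P"
    and "(LINT \<omega>|P. X \<omega>) = 0"
    and "(LINT \<omega>|P. (X \<omega>)\<^sup>2) = 1"
    and "integrable P (\<lambda>\<omega>. \<bar>X \<omega>\<bar> ^ 3)"
    and "\<And>m. m \<ge> 1 \<Longrightarrow> prob_space (M m)"
    and "\<And>m. m \<ge> 1 \<Longrightarrow> prob_space.indep_vars (M m) (\<lambda>_. borel) (\<xi> m) {..<m}"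
    and "\<And>m k. m \<ge> 1 \<Longrightarrow> k < m \<Longrightarrow> distr (M m) borel (\<xi> m k) = distr P borel X"
    and "brownian_motion N B"
  shows "\<exists>c>0. \<forall>m\<ge>2.
    (SUP f\<in>Lip1 C01. ereal
       ((LINT \<omega>|M m. f (regulator (scaled_walk m (\<lambda>k. \<xi> m k \<omega>))))
        - (LINT \<omega>|N. f (regulator (\<lambda>t. B t \<omega>)))))
    \<le> ereal (c * Lp_norm P 3 X * real m powr (- 1 / 6) * ln (real m))"
proof -
  interpret P: prob_space P by fact
  interpret W: brownian_motion N B by fact
  note [measurable] = assms(2)
  define \<mu> where "\<mu> = distr P borel X"
  have third: "integrable \<mu> (\<lambda>y. \<bar>y\<bar> ^ 3)"
    unfolding \<mu>_def using assms(5) by (subst integrable_distr_eq) auto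
  have second: "integrable \<mu> (\<lambda>y. y\<^sup>2)" "(\<integral>y. y\<^sup>2 \<partial>\<mu>) = 1"
  proof -
    have "integrable P (\<lambda>\<omega>. (X \<omega>)\<^sup>2)"
      using assms(4) not_integrable_integral_eq by fastforce
    then show "integrable \<mu> (\<lambda>y. y\<^sup>2)" unfolding \<mu>_def by (subst integrable_distr_eq) auto
    show "(\<integral>y. y\<^sup>2 \<partial>\<mu>) = 1" unfolding \<mu>_def using assms(4) by (subst integral_distr) auto
  qed
  have \<mu>ps: "prob_space \<mu>" unfolding \<mu>_def by (rule P.prob_space_distr) measurable
  have first: "(\<integral>y. y \<partial>\<mu>) = 0" unfolding \<mu>_def using assms(3) by (subst integral_distr) auto
  have mean: "has_mean \<mu>"
  proof -
    interpret \<mu>: prob_space \<mu> by (rule \<mu>ps)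
    have "integrable \<mu> (\<lambda>y. y)"
    proof (rule Bochner_Integration.integrable_bound)
      show "integrable \<mu> (\<lambda>y. 1 + y\<^sup>2)" using second(1) by simp
      show "(\<lambda>y. y) \<in> borel_measurable \<mu>" by (simp add: \<mu>_def)
      have "norm y \<le> norm (1 + y\<^sup>2)" for y :: real
      proof -
        have "0 \<le> (\<bar>y\<bar> - 1)\<^sup>2" by simp
        then show ?thesis by (simp add: power2_diff)
      qed
      then show "AE y in \<mu>. norm y \<le> norm (1 + y\<^sup>2)" by simp
    qed
    then show ?thesis using \<mu>ps by (simp add: has_mean_def \<mu>_def)
  qed
  note \<mu> = mean first second third
  define \<beta> where "\<beta> = (\<integral>y. \<bar>y\<bar> ^ 3 \<partial>\<mu>)"
  obtain C1 where C1: "0 \<le> C1" "\<And>L h m K. L-lipschitz_on UNIV h \<Longrightarrow> 1 \<le> K \<Longrightarrow> 1 \<le> m \<Longrightarrow>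
    \<bar>(\<integral>z. h z \<partial>rescaled_conv_power \<mu> m K) - (\<integral>z. h z \<partial>gauss (real K / real m))\<bar>
    \<le> L * (C1 * (1 + ln (real K)) / sqrt (real m))"
    by (rule block_law_distance[OF \<mu>]) blast
  obtain C2 where C2: "0 \<le> C2" "\<And>\<delta> n f. 0 < \<delta> \<Longrightarrow> real n * \<delta> \<le> 1 \<Longrightarrow> 1 < (real n + 1) * \<delta> \<Longrightarrow> f \<in> Lip1 C01 \<Longrightarrow>
    \<bar>(LINT \<omega>|N. f (regulator (\<lambda>t. B t \<omega>)))
      - (\<integral>y. f (regulator (polyline \<delta> n y)) \<partial>PiM {..<n} (\<lambda>_. gauss \<delta>))\<bar>
    \<le> 2 * (sqrt \<delta> * (C2 * (1 + ln (real n + 1))))"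
    by (rule W.brownian_block_replacement) blast
  define C where "C = 4 + 8 * (2 * exp (exp 2)) + 8 * \<beta> + 4 * C1 + 16 * C2"
  have \<beta>: "0 \<le> \<beta>" unfolding \<beta>_def by simp
  have Cpos: "0 < C" unfolding C_def using C1(1) C2(1) \<beta> by (simp add: add_pos_nonneg)
  have Lp: "0 < Lp_norm P 3 X" by (rule Lp_norm_pos[OF assms(1,2,4,5)])
  have bound: "(LINT \<omega>|M m. f (regulator (scaled_walk m (\<lambda>k. \<xi> m k \<omega>)))) - (LINT \<omega>|N. f (regulator (\<lambda>t. B t \<omega>)))
    \<le> C * real m powr (- 1 / 6) * ln (real m)"
    if m: "2 \<le> m" and f: "f \<in> Lip1 C01" for m f
  proof -
    interpret Mm: prob_space "M m" using assms(6) m by simp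
    obtain r where r: "1 \<le> r" "r \<le> m" "real m / (real r)\<^sup>2 / sqrt (real m) \<le> real m powr (- 1 / 6)"
      "real r / sqrt (real m) \<le> 2 * real m powr (- 1 / 6)"
      by (rule block_size[OF m])
    define K where "K = r\<^sup>2"
    define n where "n = m div K"
    define \<delta> where "\<delta> = real K / real m"
    have m1: "1 \<le> m" "0 < real m" using m by auto
    have K: "real K = (real r)\<^sup>2" "1 \<le> K" "0 < real r" using r(1) by (simp_all add: K_def)
    have \<delta>: "0 < \<delta>" using K m1 by (simp add: \<delta>_def)
    have n\<delta>: "real n * \<delta> \<le> 1" "1 < (real n + 1) * \<delta>"
    proof -
      have "n * K \<le> m" "m < (n + 1) * K"
        using K(2) dividend_less_div_times[of K m] by (simp_all add: n_def div_times_less_eq_dividend)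
      then have "real (n * K) \<le> real m" "real m < real ((n + 1) * K)"
        by (simp_all only: of_nat_le_iff of_nat_less_iff)
      then have "real n * real K / real m \<le> 1" "1 < (real n + 1) * real K / real m"
        using m1 by (simp_all add: field_simps)
      then show "real n * \<delta> \<le> 1" "1 < (real n + 1) * \<delta>" by (simp_all add: \<delta>_def)
    qed
    let ?F = "\<lambda>y. f (regulator (polyline \<delta> n y))"
    let ?I = "integral\<^sup>L (PiM {..<n} (\<lambda>_. rescaled_conv_power \<mu> m K)) ?F"
    let ?J = "integral\<^sup>L (PiM {..<n} (\<lambda>_. gauss \<delta>)) ?F"
    have law: "distr (M m) borel (\<xi> m k) = \<mu>" if "k < m" for k
      unfolding \<mu>_def by (rule assms(8)[OF m1(1) that])
    have w: "\<bar>(LINT \<omega>|M m. f (regulator (scaled_walk m (\<lambda>k. \<xi> m k \<omega>)))) - ?I\<bar>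
      \<le> 2 * (real r * (ln (real m) + 2 * exp (exp 2)) + real m * (2 * \<beta> / (real r)\<^sup>2)) / sqrt (real m)"
      unfolding \<delta>_def n_def \<beta>_def
      by (rule Mm.walk_block_replacement[OF \<mu> K(3,1) m1(1) assms(7)[OF m1(1)] law f])
    have x: "\<bar>?I - ?J\<bar> \<le> real n * (1 * (C1 * (1 + ln (real K)) / sqrt (real m)))"
    proof (rule product_replacement[OF has_mean_rescaled_conv_power[OF mean] has_mean_gauss[OF \<delta>] _ coord_lipschitz_regulator[OF f]])
      fix L h assume "L-lipschitz_on UNIV (h :: real \<Rightarrow> real)"
      then show "\<bar>(\<integral>z. h z \<partial>rescaled_conv_power \<mu> m K) - (\<integral>z. h z \<partial>gauss \<delta>)\<bar>
          \<le> L * (C1 * (1 + ln (real K)) / sqrt (real m))"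
        unfolding \<delta>_def by (rule C1(2)[OF _ K(2) m1(1)])
    qed
    have b: "\<bar>(LINT \<omega>|N. f (regulator (\<lambda>t. B t \<omega>))) - ?J\<bar> \<le> 2 * (sqrt \<delta> * (C2 * (1 + ln (real n + 1))))"
      by (rule C2(2)[OF \<delta> n\<delta> f])
    have "(LINT \<omega>|M m. f (regulator (scaled_walk m (\<lambda>k. \<xi> m k \<omega>)))) - (LINT \<omega>|N. f (regulator (\<lambda>t. B t \<omega>)))
      \<le> 2 * (real r * (ln (real m) + 2 * exp (exp 2)) + real m * (2 * \<beta> / (real r)\<^sup>2)) / sqrt (real m)
        + real n * (1 * (C1 * (1 + ln (real K)) / sqrt (real m))) + 2 * (sqrt \<delta> * (C2 * (1 + ln (real n + 1))))"
      using w x b by linarith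
    also have "\<dots> \<le> C * real m powr (- 1 / 6) * ln (real m)"
      unfolding C_def \<delta>_def K_def
      by (rule rate_arithmetic[OF m r(1,2) _ _ \<beta> C1(1) C2(1) r(3,4)]) (simp_all add: n_def K_def)
    finally show ?thesis .
  qed
  show ?thesis
  proof (intro exI[of _ "C / Lp_norm P 3 X"] conjI allI impI)
    show "0 < C / Lp_norm P 3 X" using Cpos Lp by simp
    fix m :: nat assume m: "2 \<le> m"
    have e: "C / Lp_norm P 3 X * Lp_norm P 3 X * real m powr (- 1 / 6) * ln (real m) = C * real m powr (- 1 / 6) * ln (real m)"
      using Lp by simp
    show "(SUP f\<in>Lip1 C01. ereal
       ((LINT \<omega>|M m. f (regulator (scaled_walk m (\<lambda>k. \<xi> m k \<omega>))))
        - (LINT \<omega>|N. f (regulator (\<lambda>t. B t \<omega>)))))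
      \<le> ereal (C / Lp_norm P 3 X * Lp_norm P 3 X * real m powr (- 1 / 6) * ln (real m))"
      unfolding e by (intro SUP_least) (use bound[OF m] in simp)
  qed
qed

end
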